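(* Let $\tilde f\in L^2(\frac{dp}{2p},\mathbb R_+)$ and $\tilde g\in L^2(\frac{dk}{2k},\mathbb R_+)$ be two normalized wave functions such that $f(y)$ and $g(x)$ exist almost everywhere and are integrable, and such that $g(0^-)=\lim_{x\to0^-}g(x)$ exists. Suppose there exist constants $\alpha>0$, $C>0$ and $L\ge0$ such that $|f(y)|\le C/|y|^{1+\alpha}$ if $y\le-L$. Let $f_{y_o}(y)=f(y-y_o)$. Then for the relativistic black-hole model, $x(y)=-e^{-y}$, and for all sufficiently large $y_o$, $$\big|\bar N_g[f_{y_o}]-\bar N^{Th}_{2\pi,out}[f_{y_o}]\big|\le\|g\|^2_{L^1(dx,\mathbb R_-)}\,\frac{4\,C^2}{\alpha^2\left(\frac12y_o+L\right)^{2\alpha}}+e^{2L-y_o}\,\|f\|^2_{L^1(dy,\mathbb R)}\,|g(0^-)|^2 ,$$ where $\bar N^{Th}_{\beta,out}[f]=\int_0^\infty\frac{dp}{2p}\frac{|\tilde f(p)|^2}{e^{\beta p}-1}$.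
   Context: A wave function $\tilde f\in L^2(\frac{dp}{2p},\mathbb R_+)$ is extended by $0$ to $p<0$ and $f(y)=\frac1{\sqrt{2\pi}}\int_0^\infty\tilde f(p)e^{ipy}\,dp$; similarly for $g$. Normalized means $\int_0^\infty\frac{dp}{2p}|\tilde f(p)|^2=1$. $\langle u,v\rangle=\int_0^\infty\frac{dk}{2k}u(k)^*v(k)$. $\|g\|_{L^1(dx,\mathbb R_-)}=\int_{-\infty}^0|g(x)|\,dx$. $(U\tilde f)(k)=\frac1{\sqrt{2\pi}}\int_{-\infty}^\infty e^{-ikx(y)}f(y)\,dy$ for $k\in\mathbb R$; $(A\tilde f)(k)=(U\tilde f)(k)$ and $(B\tilde f)(k)=(U\tilde f)(-k)$ for $k>0$. $\bar N_o[f]=\int_0^\infty\frac{dk}{2k}|(U\tilde f)(-k)|^2\in[0,\infty]$ is the mean number of spontaneously created particles, and the mean number stimulated by the incoming one-particle state with wave function $g$ is $\bar N_g[f]=\bar N_o[f]+|\langle\tilde g,A\tilde f\rangle|^2+|\langle\tilde g^*,B\tilde f\rangle|^2$. For the relativistic model it is known that $\bar N_o[f]=\bar N^{Th}_{2\pi,out}[f]$; accordingly, when these are infinite, the difference $\bar N_g[f]-\bar N^{Th}_{2\pi,out}[f]$ means $|\langle\tilde g,A\tilde f\rangle|^2+|\langle\tilde g^*,B\tilde f\rangle|^2$. *)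

theory Defs
  imports "HOL-Probability.Sinc_Integral"
begin

definition wf_measure :: "real measure" where
  "wf_measure = density lborel (\<lambda>p. ennreal (indicator {0<..} p / (2 * p)))"

text \<open>Members of \<open>L\<^sup>2(dp/2p, \<real>\<^sub>+)\<close> are represented by functions on \<open>\<real>\<close> whose values at \<open>p \<le> 0\<close>
  are never used; in the Fourier integral below they are replaced by \<open>0\<close>.\<close>

definition wave_function :: "(real \<Rightarrow> complex) \<Rightarrow> bool" where
  "wave_function u \<longleftrightarrow>
     u \<in> borel_measurable wf_measure \<and> integrable wf_measure (\<lambda>p. (cmod (u p))\<^sup>2)"

definition normalized :: "(real \<Rightarrow> complex) \<Rightarrow> bool" where
  "normalized u \<longleftrightarrow> (LINT p|wf_measure. (cmod (u p))\<^sup>2) = 1"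

text \<open>The pairing \<open>\<integral>\<^sub>0\<^sup>\<infinity> dk/2k u(k)\<^sup>* v(k)\<close> is an improper integral at both ends. It is the Lebesgue
  integral whenever that one exists (lemma \<open>wf_inner_absolute\<close>), but \<open>A\<close> and \<open>B\<close> need not
  map wave functions to square-integrable functions, so absolute convergence is not automatic.\<close>

definition wf_inner :: "(real \<Rightarrow> complex) \<Rightarrow> (real \<Rightarrow> complex) \<Rightarrow> complex" where
  "wf_inner u v = Lim (at_right 0 \<times>\<^sub>F at_top)
     (\<lambda>(a, b). LBINT k:{a..b}. cnj (u k) * v k / of_real (2 * k))"

definition schwartz_function :: "(real \<Rightarrow> complex) \<Rightarrow> bool" where
  "schwartz_function \<phi> \<longleftrightarrow> (\<exists>D. D 0 = \<phi> \<and>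
     (\<forall>n y. (D n has_vector_derivative D (Suc n) y) (at y)) \<and>
     (\<forall>m n. bounded (range (\<lambda>y. of_real (y ^ m) * (D n y :: complex)))))"

definition truncated_fourier :: "real \<Rightarrow> (real \<Rightarrow> complex) \<Rightarrow> real \<Rightarrow> complex" where
  "truncated_fourier R u y = (LBINT p:{0<..R}. u p * cis (p * y)) / of_real (sqrt (2 * pi))"

text \<open>\<open>fourier_integral u f\<close> says that the integral
  \<open>1/sqrt(2\<pi>) \<integral>\<^sub>0\<^sup>\<infinity> u(p) e\<^sup>i\<^sup>p\<^sup>y dp\<close> exists as an almost everywhere defined integrable function
  of \<open>y\<close>, represented by \<open>f\<close>. For \<open>u\<close> in \<open>L\<^sup>2(dp/2p, \<real>\<^sub>+)\<close> the integral over \<open>(0, R]\<close> is absolutely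
  convergent, but the limit \<open>R \<rightarrow> \<infinity>\<close> need not be; it is taken in the sense of
  tempered distributions. If \<open>u\<close> is Lebesgue integrable, \<open>f\<close> is given by the ordinary
  integral (lemma \<open>fourier_integral_absolute\<close>). Bare pointwise convergence almost everywhere would
  not do: it does not make \<open>u\<close> the Fourier transform of \<open>f\<close>.\<close>

definition fourier_integral :: "(real \<Rightarrow> complex) \<Rightarrow> (real \<Rightarrow> complex) \<Rightarrow> bool" where
  "fourier_integral u f \<longleftrightarrow> integrable lborel f \<and>
     (\<forall>\<phi>. schwartz_function \<phi> \<longrightarrow>
        ((\<lambda>R. LBINT y. truncated_fourier R u y * \<phi> y) \<longlongrightarrow> (LBINT y. f y * \<phi> y)) at_top)"

text \<open>Below, \<open>X\<close> is the function \<open>x(y)\<close> of the model and \<open>f\<close> the position-space form of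
  the wave function that the operators are applied to.\<close>

definition U_op :: "(real \<Rightarrow> real) \<Rightarrow> (real \<Rightarrow> complex) \<Rightarrow> real \<Rightarrow> complex" where
  "U_op X f k = (LBINT y. cis (- (k * X y)) * f y) / of_real (sqrt (2 * pi))"

definition A_op :: "(real \<Rightarrow> real) \<Rightarrow> (real \<Rightarrow> complex) \<Rightarrow> real \<Rightarrow> complex" where
  "A_op X f k = U_op X f k"

definition B_op :: "(real \<Rightarrow> real) \<Rightarrow> (real \<Rightarrow> complex) \<Rightarrow> real \<Rightarrow> complex" where
  "B_op X f k = U_op X f (- k)"

definition N_spontaneous :: "(real \<Rightarrow> real) \<Rightarrow> (real \<Rightarrow> complex) \<Rightarrow> ennreal" where
  "N_spontaneous X f = (\<integral>\<^sup>+ k. ennreal ((cmod (U_op X f (- k)))\<^sup>2) \<partial>wf_measure)"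

definition N_induced :: "(real \<Rightarrow> real) \<Rightarrow> (real \<Rightarrow> complex) \<Rightarrow> (real \<Rightarrow> complex) \<Rightarrow> real" where
  "N_induced X gt f =
     (cmod (wf_inner gt (A_op X f)))\<^sup>2 + (cmod (wf_inner (\<lambda>k. cnj (gt k)) (B_op X f)))\<^sup>2"

definition N_stimulated :: "(real \<Rightarrow> real) \<Rightarrow> (real \<Rightarrow> complex) \<Rightarrow> (real \<Rightarrow> complex) \<Rightarrow> ennreal" where
  "N_stimulated X gt f = N_spontaneous X f + ennreal (N_induced X gt f)"

definition N_thermal :: "real \<Rightarrow> (real \<Rightarrow> complex) \<Rightarrow> ennreal" where
  "N_thermal \<beta> ft = (\<integral>\<^sup>+ p. ennreal ((cmod (ft p))\<^sup>2 / (exp (\<beta> * p) - 1)) \<partial>wf_measure)"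

text \<open>The difference between the stimulated and the thermal mean number for the wave function
  \<open>ft\<close> with position-space form \<open>f\<close>. Only when both are infinite is it given by
  convention; if exactly one is infinite it is \<open>\<plusminus>\<infinity>\<close>.\<close>

definition N_difference ::
  "(real \<Rightarrow> real) \<Rightarrow> (real \<Rightarrow> complex) \<Rightarrow> real \<Rightarrow> (real \<Rightarrow> complex) \<Rightarrow> (real \<Rightarrow> complex) \<Rightarrow> ereal" where
  "N_difference X gt \<beta> ft f =
     (if N_stimulated X gt f = \<infinity> \<and> N_thermal \<beta> ft = \<infinity> then ereal (N_induced X gt f)
      else enn2ereal (N_stimulated X gt f) - enn2ereal (N_thermal \<beta> ft))"

definition relativistic_x :: "real \<Rightarrow> real" where
  "relativistic_x y = - exp (- y)"

text \<open>Translating \<open>f\<close> to \<open>f(y - s)\<close> multiplies the wave function by \<open>e\<^sup>-\<^sup>i\<^sup>p\<^sup>s\<close>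
  (lemma \<open>fourier_integral_translate\<close>).\<close>

definition translate_position :: "real \<Rightarrow> (real \<Rightarrow> complex) \<Rightarrow> real \<Rightarrow> complex" where
  "translate_position s f y = f (y - s)"

definition translate_momentum :: "real \<Rightarrow> (real \<Rightarrow> complex) \<Rightarrow> real \<Rightarrow> complex" where
  "translate_momentum s u p = cis (- (p * s)) * u p"

lemma schwartz_function_integrable:
  assumes "schwartz_function \<phi>"
  shows "integrable lborel \<phi>"
proof -
  obtain D where D: "D 0 = \<phi>" "\<And>n y. (D n has_vector_derivative D (Suc n) y) (at y)"
    "\<And>m n. bounded (range (\<lambda>y. of_real (y ^ m) * (D n y :: complex)))"
    using assms unfolding schwartz_function_def by blast
  have cont: "continuous_on UNIV \<phi>"
    using D(1) D(2)[of 0] by (metis continuous_at_imp_continuous_on has_vector_derivative_continuous)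
  obtain b0 where b0: "\<And>y. cmod (of_real (y ^ 0) * D 0 y) \<le> b0"
    using D(3)[of 0 0] unfolding bounded_iff by blast
  obtain b2 where b2: "\<And>y. cmod (of_real (y ^ 2) * D 0 y) \<le> b2"
    using D(3)[of 2 0] unfolding bounded_iff by blast
  have le: "cmod (\<phi> y) \<le> (b0 + b2) * inverse (1 + y\<^sup>2)" for y
  proof -
    have "cmod (\<phi> y) * (1 + y\<^sup>2) \<le> b0 + b2"
      using b0[of y] b2[of y] D(1) by (simp add: norm_mult norm_power algebra_simps)
    moreover have "1 + y\<^sup>2 > 0" by (simp add: add_pos_nonneg)
    ultimately show ?thesis by (simp add: field_simps)
  qed
  have "set_integrable lborel (einterval (-\<infinity>) \<infinity>) (\<lambda>y. inverse (1 + y\<^sup>2))"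
    by (rule integrable_inverse_1_plus_square)
  hence "integrable lborel (\<lambda>y. (b0 + b2) * inverse (1 + y\<^sup>2))"
    by (simp add: set_integrable_def)
  thus ?thesis
    by (rule Bochner_Integration.integrable_bound)
      (use cont le in \<open>auto intro!: borel_measurable_continuous_onI AE_I2 intro: order_trans[OF le] abs_ge_self\<close>)
qed

lemma schwartz_function_shift:
  assumes "schwartz_function \<phi>"
  shows "schwartz_function (\<lambda>y. \<phi> (y + s))"
proof -
  obtain D where D: "D 0 = \<phi>" "\<And>n y. (D n has_vector_derivative D (Suc n) y) (at y)"
    "\<And>m n. bounded (range (\<lambda>y. of_real (y ^ m) * (D n y :: complex)))"
    using assms unfolding schwartz_function_def by blast
  have d: "((\<lambda>y. D n (y + s)) has_vector_derivative D (Suc n) (y + s)) (at y)" for n y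
  proof -
    have "((\<lambda>y. y + s) has_vector_derivative 1) (at y)"
      by (auto intro!: derivative_eq_intros simp flip: has_real_derivative_iff_has_vector_derivative)
    from vector_diff_chain_at[OF this D(2)[of n "y + s"]] show ?thesis by (simp add: o_def)
  qed
  have "bounded (range (\<lambda>y. of_real (y ^ m) * D n (y + s)))" for m n
  proof -
    obtain b0 where b0: "\<And>y. cmod (of_real (y ^ 0) * D n y) \<le> b0"
      using D(3)[of 0 n] unfolding bounded_iff by blast
    obtain b where b: "\<And>y. cmod (of_real (y ^ m) * D n y) \<le> b"
      using D(3)[of m n] unfolding bounded_iff by blast
    have b': "\<bar>y\<bar> ^ m * cmod (D n y) \<le> b" for y
      using b[of y] by (simp add: norm_mult norm_power)
    have "cmod (of_real (y ^ m) * D n (y + s)) \<le> 2 ^ m * (b + \<bar>s\<bar> ^ m * b0)" for y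
    proof -
      have "\<bar>y\<bar> \<le> 2 * max \<bar>y + s\<bar> \<bar>s\<bar>" by (auto simp: max_def abs_if)
      hence "\<bar>y\<bar> ^ m \<le> (2 * max \<bar>y + s\<bar> \<bar>s\<bar>) ^ m" by (rule power_mono) simp
      also have "\<dots> \<le> 2 ^ m * (\<bar>y + s\<bar> ^ m + \<bar>s\<bar> ^ m)"
        by (auto simp: power_mult_distrib max_def)
      finally have "\<bar>y\<bar> ^ m * cmod (D n (y + s)) \<le> 2 ^ m * (\<bar>y + s\<bar> ^ m + \<bar>s\<bar> ^ m) * cmod (D n (y + s))"
        by (rule mult_right_mono) simp
      also have "\<dots> = 2 ^ m * (\<bar>y + s\<bar> ^ m * cmod (D n (y + s)) + \<bar>s\<bar> ^ m * cmod (D n (y + s)))"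
        by (simp add: algebra_simps)
      also have "\<dots> \<le> 2 ^ m * (b + \<bar>s\<bar> ^ m * b0)"
        using b0[of "y + s"] by (intro mult_left_mono add_mono b') auto
      finally show ?thesis by (simp add: norm_mult norm_power)
    qed
    thus ?thesis unfolding bounded_iff by blast
  qed
  thus ?thesis unfolding schwartz_function_def
    using D(1) d by (intro exI[of _ "\<lambda>n y. D n (y + s)"]) auto
qed

lemma fourier_integral_translate:
  assumes "fourier_integral u f"
  shows "fourier_integral (translate_momentum s u) (translate_position s f)"
  unfolding fourier_integral_def
proof (intro conjI allI impI)
  have f: "integrable lborel f" using assms by (simp add: fourier_integral_def)
  show "integrable lborel (translate_position s f)"
    using lborel_integrable_real_affine[OF f, of 1 "- s"]
    by (simp add: translate_position_def[abs_def])
  fix \<phi> assume \<phi>: "schwartz_function \<phi>"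
  have shift: "(LBINT y. h y) = (LBINT y. h (y + s))" for h :: "real \<Rightarrow> complex"
    using lborel_integral_real_affine[of 1 h s] by (simp add: add.commute)
  have tr: "truncated_fourier R (translate_momentum s u) (y + s) = truncated_fourier R u y" for R y
    unfolding truncated_fourier_def translate_momentum_def
    by (rule arg_cong2[where f = "(/)"], rule set_lebesgue_integral_cong)
      (auto simp: algebra_simps cis_mult)
  have "((\<lambda>R. LBINT y. truncated_fourier R u y * \<phi> (y + s)) \<longlongrightarrow> (LBINT y. f y * \<phi> (y + s))) at_top"
    using assms schwartz_function_shift[OF \<phi>] unfolding fourier_integral_def by blast
  thus "((\<lambda>R. LBINT y. truncated_fourier R (translate_momentum s u) y * \<phi> y) \<longlongrightarrow>
      (LBINT y. translate_position s f y * \<phi> y)) at_top"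
    by (subst (1 2) shift) (simp add: tr translate_position_def)
qed

lemma fourier_integral_absolute:
  assumes u: "set_integrable lborel {0<..} u"
    and f: "integrable lborel f"
    and eq: "AE y in lborel. f y = (LBINT p:{0<..}. u p * cis (p * y)) / of_real (sqrt (2 * pi))"
  shows "fourier_integral u f"
  unfolding fourier_integral_def
proof (intro conjI allI impI)
  show "integrable lborel f" by fact
  fix \<phi> assume "schwartz_function \<phi>"
  hence \<phi>: "integrable lborel \<phi>" by (rule schwartz_function_integrable)
  define M where "M = (LBINT p. norm (indicator {0<..} p *\<^sub>R u p))"
  have u': "integrable lborel (\<lambda>p. indicator {0<..} p *\<^sub>R u p)"
    using u by (simp add: set_integrable_def)
  have [measurable]: "(\<lambda>p. indicator {0<..} p *\<^sub>R u p) \<in> borel_measurable borel"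
    using borel_measurable_integrable[OF u'] by simp
  have cismeas: "(\<lambda>z. cis (fst z * snd z)) \<in> borel_measurable (borel \<Otimes>\<^sub>M borel :: (real \<times> real) measure)"
    unfolding borel_prod by (intro borel_measurable_continuous_onI continuous_intros)
  have cis1: "(\<lambda>p. cis (p * y)) \<in> borel_measurable borel" for y :: real
    by (intro borel_measurable_continuous_onI continuous_intros)
  have form: "truncated_fourier R u y =
      (LBINT p. indicator {..R} p *\<^sub>R (indicator {0<..} p *\<^sub>R u p) * cis (p * y)) / of_real (sqrt (2 * pi))" for R y
    unfolding truncated_fourier_def set_lebesgue_integral_def
    by (auto intro!: arg_cong2[where f = "(/)"] Bochner_Integration.integral_cong split: split_indicator)
  have pt: "((\<lambda>R. truncated_fourier R u y) \<longlongrightarrow>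
      (LBINT p:{0<..}. u p * cis (p * y)) / of_real (sqrt (2 * pi))) at_top" for y
  proof -
    have "((\<lambda>R. LBINT p. indicator {..R} p *\<^sub>R (indicator {0<..} p *\<^sub>R u p) * cis (p * y))
        \<longlongrightarrow> (LBINT p. (indicator {0<..} p *\<^sub>R u p) * cis (p * y))) at_top"
    proof (rule integral_dominated_convergence_at_top)
      show "integrable lborel (\<lambda>p. norm (indicator {0<..} p *\<^sub>R u p))"
        using u' by (rule integrable_norm)
      show "AE p in lborel. ((\<lambda>R. indicator {..R} p *\<^sub>R (indicator {0<..} p *\<^sub>R u p) * cis (p * y))
          \<longlongrightarrow> (indicator {0<..} p *\<^sub>R u p) * cis (p * y)) at_top"
      proof (rule AE_I2, rule tendsto_eventually)
        fix p :: real
        show "\<forall>\<^sub>F R in at_top. indicator {..R} p *\<^sub>R (indicator {0<..} p *\<^sub>R u p) * cis (p * y) =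
          (indicator {0<..} p *\<^sub>R u p) * cis (p * y)"
          using eventually_ge_at_top[of p] by eventually_elim simp
      qed
      show "(\<lambda>p. (indicator {0<..} p *\<^sub>R u p) * cis (p * y)) \<in> borel_measurable lborel"
        using cis1[of y] by measurable
      show "(\<lambda>p. indicator {..R} p *\<^sub>R (indicator {0<..} p *\<^sub>R u p) * cis (p * y)) \<in> borel_measurable lborel" for R
        using cis1[of y] by measurable
    qed (auto simp: norm_mult split: split_indicator)
    thus ?thesis unfolding form set_lebesgue_integral_def by (intro tendsto_divide) auto
  qed
  have bound: "cmod (truncated_fourier R u y) \<le> M" for R y
  proof -
    have *: "cmod (LBINT p. indicator {..R} p *\<^sub>R (indicator {0<..} p *\<^sub>R u p) * cis (p * y)) \<le> M"
      unfolding M_def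
    proof (rule Bochner_Integration.integral_norm_bound_integral)
      show "integrable lborel (\<lambda>p. indicator {..R} p *\<^sub>R (indicator {0<..} p *\<^sub>R u p) * cis (p * y))"
      proof (rule Bochner_Integration.integrable_bound[OF u'])
        show "(\<lambda>p. indicator {..R} p *\<^sub>R (indicator {0<..} p *\<^sub>R u p) * cis (p * y)) \<in> borel_measurable lborel"
          using cis1[of y] by measurable
      qed (auto simp: norm_mult split: split_indicator)
      show "integrable lborel (\<lambda>p. norm (indicator {0<..} p *\<^sub>R u p))"
        using u' by (rule integrable_norm)
    qed (auto simp: norm_mult split: split_indicator)
    have "sqrt (2 * pi) \<ge> 1" using pi_gt3 by (simp add: real_le_rsqrt)
    moreover have "M \<ge> 0" unfolding M_def by simp
    ultimately have "M * 1 \<le> M * sqrt (2 * pi)" by (intro mult_left_mono)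
    with * have **: "cmod (LBINT p. indicator {..R} p *\<^sub>R (indicator {0<..} p *\<^sub>R u p) * cis (p * y))
        \<le> M * sqrt (2 * pi)" by linarith
    have "sqrt (2 * pi) > 0" by simp
    thus ?thesis using ** unfolding form norm_divide norm_of_real
      by (metis abs_of_pos pos_divide_le_eq)
  qed
  have meas: "(\<lambda>y. truncated_fourier R u y) \<in> borel_measurable lborel" for R
  proof -
    have "(\<lambda>y. LBINT p. indicator {..R} p *\<^sub>R (indicator {0<..} p *\<^sub>R u p) * cis (p * y))
        \<in> borel_measurable lborel"
    proof (rule lborel.borel_measurable_lebesgue_integral)
      have [measurable]: "(\<lambda>z. cis (snd z * fst z)) \<in> borel_measurable (borel \<Otimes>\<^sub>M borel :: (real \<times> real) measure)"
        unfolding borel_prod by (intro borel_measurable_continuous_onI continuous_intros)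
      show "(\<lambda>(y, p). indicator {..R} p *\<^sub>R (indicator {0<..} p *\<^sub>R u p) * cis (p * y))
          \<in> borel_measurable (lborel \<Otimes>\<^sub>M lborel)"
        unfolding split_beta by measurable
    qed
    thus ?thesis unfolding form by (rule borel_measurable_divide) auto
  qed
  show "((\<lambda>R. LBINT y. truncated_fourier R u y * \<phi> y) \<longlongrightarrow> (LBINT y. f y * \<phi> y)) at_top"
  proof (rule integral_dominated_convergence_at_top)
    show "integrable lborel (\<lambda>y. M * cmod (\<phi> y))"
      using \<phi> by simp
    show "AE y in lborel. ((\<lambda>R. truncated_fourier R u y * \<phi> y) \<longlongrightarrow> f y * \<phi> y) at_top"
      using eq by eventually_elim (simp only:, intro tendsto_mult tendsto_const pt)
    show "\<forall>\<^sub>F R in at_top. AE y in lborel. cmod (truncated_fourier R u y * \<phi> y) \<le> M * cmod (\<phi> y)"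
      by (auto simp: norm_mult intro!: mult_right_mono bound always_eventually)
  qed (use meas f \<phi> in auto)
qed

lemma wf_inner_absolute:
  assumes "set_integrable lborel {0<..} (\<lambda>k. cnj (u k) * v k / of_real (2 * k))"
  shows "wf_inner u v = (LBINT k:{0<..}. cnj (u k) * v k / of_real (2 * k))"
proof -
  define h where "h = (\<lambda>k. cnj (u k) * v k / complex_of_real (2 * k))"
  have h: "set_integrable lborel {0<..} h" using assms by (simp add: h_def)
  have sub: "set_integrable lborel S h" if "S \<in> sets borel" "S \<subseteq> {0<..}" for S
    using set_integrable_subset[OF h] that by auto
  have hm: "(\<lambda>k. indicator S k *\<^sub>R h k) \<in> borel_measurable borel"
    if "S \<in> sets borel" "S \<subseteq> {0<..}" for S
    using borel_measurable_integrable[of lborel] sub[OF that] by (simp add: set_integrable_def)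
  have split: "(LBINT k:{a..b}. h k) = (LBINT k:{a..1}. h k) + (LBINT k:{1..b}. h k)"
    if "0 < a" "a < 1" "1 < b" for a b
  proof -
    have "(LBINT k:{a..b}. h k) = (LBINT k:{a..1}. h k) + (LBINT k:{1<..b}. h k)"
      using that
      by (subst set_integral_Un[symmetric])
        (auto intro!: sub arg_cong2[where f = "set_lebesgue_integral lborel"] )
    also have "(LBINT k:{1<..b}. h k) = (LBINT k:{1..b}. h k)"
      using AE_lborel_singleton[of "1::real"] that
      unfolding set_lebesgue_integral_def
      by (intro integral_cong_AE)
        (auto intro!: hm split: split_indicator)
    finally show ?thesis .
  qed
  have l1: "((\<lambda>a. LBINT k:{a..1}. h k) \<longlongrightarrow> (LBINT k:{0<..1}. h k)) (at_right 0)"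
    by (rule tendsto_set_lebesgue_integral_at_right) (auto intro!: sub)
  have l2: "((\<lambda>b. LBINT k:{1..b}. h k) \<longlongrightarrow> (LBINT k:{1..}. h k)) at_top"
    by (rule tendsto_set_lebesgue_integral_at_top) (auto intro!: sub)
  have "(LBINT k:{0<..1}. h k) + (LBINT k:{1..}. h k) = (LBINT k:{0<..1}. h k) + (LBINT k:{1<..}. h k)"
    using AE_lborel_singleton[of "1::real"]
    unfolding set_lebesgue_integral_def
    by (intro arg_cong2[where f = "(+)"] refl integral_cong_AE)
      (auto intro!: hm split: split_indicator)
  also have "\<dots> = (LBINT k:{0<..}. h k)"
    by (subst set_integral_Un[symmetric])
      (auto intro!: sub arg_cong2[where f = "set_lebesgue_integral lborel"])
  finally have tot: "(LBINT k:{0<..1}. h k) + (LBINT k:{1..}. h k) = (LBINT k:{0<..}. h k)" .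
  have e: "\<forall>\<^sub>F z in at_right 0 \<times>\<^sub>F at_top.
      (LBINT k:{fst z..1}. h k) + (LBINT k:{1..snd z}. h k) = (case z of (a, b) \<Rightarrow> LBINT k:{a..b}. h k)"
  proof -
    have "\<forall>\<^sub>F a in at_right (0::real). 0 < a \<and> a < 1"
      using eventually_at_right_real[OF zero_less_one[where 'a = real]] by eventually_elim simp
    from eventually_prodI[OF this eventually_gt_at_top[of "1::real"]] show ?thesis
      by eventually_elim (auto simp: split)
  qed
  have "((\<lambda>z. (LBINT k:{fst z..1}. h k) + (LBINT k:{1..snd z}. h k)) \<longlongrightarrow>
      (LBINT k:{0<..1}. h k) + (LBINT k:{1..}. h k)) (at_right 0 \<times>\<^sub>F at_top)"
    by (intro tendsto_add filterlim_compose[OF l1 filterlim_fst] filterlim_compose[OF l2 filterlim_snd])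
  hence "((\<lambda>(a, b). LBINT k:{a..b}. h k) \<longlongrightarrow> (LBINT k:{0<..}. h k)) (at_right 0 \<times>\<^sub>F at_top)"
    unfolding tot using e by (rule Lim_transform_eventually)
  thus ?thesis unfolding wf_inner_def h_def
    by (intro tendsto_Lim) (auto simp: prod_filter_eq_bot)
qed

end

theory Submission
  imports Defs "HOL-Complex_Analysis.Complex_Analysis" "HOL-Real_Asymp.Real_Asymp"
    "HOL-Probability.Characteristic_Functions"
begin

text \<open>Write \<open>k = e\<^sup>s\<close>. For \<open>x(y) = - e\<^sup>-\<^sup>y\<close> the function \<open>(U f)(- k)\<close> is, up to \<open>1/sqrt(2\<pi>)\<close>, the convolution
  of \<open>f\<close> with \<open>h(t) = exp(- i e\<^sup>t)\<close>. The Fourier transform of \<open>h\<close> is \<open>\<Gamma>(- i p) e\<^sup>-\<^sup>\<pi>\<^sup>p\<^sup>/\<^sup>2\<close>, whose squared modulus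
  is \<open>2\<pi> / (p (e\<^sup>2\<^sup>\<pi>\<^sup>p - 1))\<close>, so Plancherel's theorem gives the thermal spectrum. Since \<open>h\<close> is not
  integrable and both particle numbers may be infinite, \<open>h\<close> is approximated by its averages
  \<open>h\<^sub>m(t) = (1 + i e\<^sup>t/m)\<^sup>-\<^sup>m\<close> over dilations with Gamma-distributed parameter: averaging does not increase the
  \<open>L\<^sup>2\<close> norm on the position side, while the Fourier multipliers increase with \<open>m\<close>, so that the two sides
  agree in \<open>[0, \<infinity>]\<close> by Fatou's lemma and monotone convergence. The derivative of \<open>h\<^sub>m\<close> is integrable, and
  the Fourier transform of \<open>f\<close> vanishes at \<open>0\<close>; this handles the pole at \<open>p = 0\<close>.

  Hence the difference of the mean numbers is the stimulated part. Because the Fourier transform of \<open>g\<close>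
  vanishes for \<open>k < 0\<close>, both pairings equal, up to a phase and complex conjugation of \<open>g\<close>,
  \<open>1/4 \<integral> g(x) \<integral> f(y) sgn(x - x(y)) dy dx\<close>. The inner integral is \<open>0\<close> for \<open>x \<ge> 0\<close>, at most twice the integral
  of \<open>\<bar>f\<bar>\<close> over \<open>{y. x(y) \<le> x}\<close> and at most the \<open>L\<^sup>1\<close> norm of \<open>f\<close>. Splitting the integral over \<open>x\<close> at
  \<open>x(y\<^sub>o/2 - L)\<close> yields one term that decays like \<open>y\<^sub>o\<^sup>-\<^sup>2\<^sup>\<alpha>\<close> and one that decays like \<open>e\<^sup>-\<^sup>y\<^sup>o\<close>.\<close>

subsection \<open>Fourier transform and convolution of integrable functions\<close>

text \<open>Gamma averages are chosen because in the logarithmic variable an average over dilations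
  is a convolution: it multiplies the Fourier transform by a function of modulus |Gamma(m + i p)| /
  Gamma(m), which increases to 1 since Gamma(m + 1 + i p) = (m + i p) Gamma(m + i p) and |m + i p|
  \<ge> m. The thermal factor comes from turning the contour by a quarter turn and from the
  reflection formula. The function \<open>f\<close> is tied to \<open>ft\<close> only by a
  distributional limit, so it has to be shown that \<open>ft\<close> is the transform of
  \<open>f\<close> almost everywhere. Continuity of the transform then makes it vanish on the whole
  closed half-line; its value at 0 says that \<open>f\<close> has integral 0, on which the estimates
  of the sign transform rest as well. The constants leave room: the pairings contribute at most (2 a
  + b)^2 / 8 \<le> a^2 + b^2 / 4, where 4 a^2 is the term of the bound that decays like a power and
  b decays exponentially. For large y_o the excess 3 a^2 absorbs b^2 / 4. This needs a > 0, so the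
  case that \<open>g\<close> vanishes on the negative half-line is treated separately.\<close>

lemma borel_measurable_cis [measurable (raw)]:
  "f \<in> borel_measurable M \<Longrightarrow> (\<lambda>x. cis (f x)) \<in> borel_measurable M"
  by (rule borel_measurable_continuous_on[of cis]) (auto intro!: continuous_intros)

lemma borel_measurable_cnj [measurable (raw)]:
  "f \<in> borel_measurable M \<Longrightarrow> (\<lambda>x. cnj (f x)) \<in> borel_measurable M"
  by (rule borel_measurable_continuous_on[of cnj]) (auto intro!: continuous_intros)

lemma integrable_cis_mult:
  fixes f :: "real \<Rightarrow> complex"
  assumes "integrable M f" "h \<in> borel_measurable M"
  shows "integrable M (\<lambda>x. cis (h x) * f x)"
  by (rule Bochner_Integration.integrable_bound[OF assms(1)]) (use assms in \<open>auto simp: norm_mult\<close>)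

lemma integrable_bounded_mult:
  fixes f k :: "real \<Rightarrow> complex"
  assumes "integrable lborel f" "k \<in> borel_measurable borel" "\<And>x. cmod (k x) \<le> B"
  shows "integrable lborel (\<lambda>x. k x * f x)"
proof (rule Bochner_Integration.integrable_bound)
  show "integrable lborel (\<lambda>x. B * cmod (f x))" using assms(1) by simp
  have "B \<ge> 0" using order_trans[OF norm_ge_zero assms(3)] .
  thus "AE x in lborel. cmod (k x * f x) \<le> norm (B * cmod (f x))"
    by (auto simp: norm_mult intro!: mult_right_mono assms(3))
qed (use assms in auto)

lemma integrable_pair_product:
  fixes f :: "real \<times> real \<Rightarrow> 'a::{banach, second_countable_topology}"
  assumes f: "f \<in> borel_measurable (borel \<Otimes>\<^sub>M borel)"
    and a: "integrable lborel (a :: real \<Rightarrow> real)" and b: "integrable lborel (b :: real \<Rightarrow> real)"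
    and le: "\<And>x y. norm (f (x, y)) \<le> a x * b y"
  shows "integrable (lborel \<Otimes>\<^sub>M lborel) f"
proof (rule Bochner_Integration.integrable_bound)
  have [measurable]: "a \<in> borel_measurable borel" "b \<in> borel_measurable borel"
    using a b by (auto dest: borel_measurable_integrable)
  show "integrable (lborel \<Otimes>\<^sub>M lborel) (\<lambda>(x, y). a x * b y)"
  proof (rule lborel_pair.Fubini_integrable)
    show "(\<lambda>(x, y). a x * b y) \<in> borel_measurable (lborel \<Otimes>\<^sub>M lborel)" by measurable
    show "integrable lborel (\<lambda>x. LBINT y. norm (case (x, y) of (x, y) \<Rightarrow> a x * b y))"
      using a b by (simp add: abs_mult)
    show "AE x in lborel. integrable lborel (\<lambda>y. case (x, y) of (x, y) \<Rightarrow> a x * b y)"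
      using b by simp
  qed
  show "f \<in> borel_measurable (lborel \<Otimes>\<^sub>M lborel)"
    using f by (simp add: measurable_cong_sets[OF sets_pair_measure_cong[OF sets_lborel sets_lborel] refl])
  show "AE x in lborel \<Otimes>\<^sub>M lborel. norm (f x) \<le> norm (case x of (x, y) \<Rightarrow> a x * b y)"
    using le by (intro AE_I2) (auto intro!: order_trans[OF le] abs_ge_self)
qed

text \<open>Most exchanges of integrals below are dominated by a product of two integrable functions
  of one variable each; this form spares a Tonelli computation every time.\<close>

lemma Fubini_product_bound:
  fixes f :: "real \<Rightarrow> real \<Rightarrow> 'a::{banach, second_countable_topology}"
  assumes "(\<lambda>z. f (fst z) (snd z)) \<in> borel_measurable (borel \<Otimes>\<^sub>M borel)"
    and "integrable lborel (a :: real \<Rightarrow> real)" and "integrable lborel (b :: real \<Rightarrow> real)"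
    and "\<And>x y. norm (f x y) \<le> a x * b y"
  shows "(LBINT x. LBINT y. f x y) = (LBINT y. LBINT x. f x y)"
  by (rule lborel_pair.Fubini_integral[symmetric])
    (use integrable_pair_product[of "\<lambda>z. f (fst z) (snd z)" a b] assms in \<open>auto simp: case_prod_unfold\<close>)

text \<open>Normalised without 1/sqrt(2\<pi>): the convolution theorem is then free of constants,
  Plancherel's theorem carries the factor 2\<pi>, and a wave function corresponds to
  \<open>fourier f\<close> divided by sqrt(2\<pi>).\<close>

definition fourier :: "(real \<Rightarrow> complex) \<Rightarrow> real \<Rightarrow> complex" where
  "fourier f p = (LBINT y. cis (- (p * y)) * f y)"

lemma fourier_bound:
  assumes "integrable lborel f"
  shows "cmod (fourier f p) \<le> (LBINT y. cmod (f y))"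
proof -
  have "cmod (fourier f p) \<le> (LBINT y. cmod (cis (- (p * y)) * f y))"
    unfolding fourier_def by (rule integral_norm_bound)
  thus ?thesis by (simp add: norm_mult)
qed

lemma fourier_measurable [measurable]:
  assumes [measurable]: "f \<in> borel_measurable borel"
  shows "fourier f \<in> borel_measurable borel"
  unfolding fourier_def by measurable

lemma continuous_fourier:
  assumes f: "integrable lborel f"
  shows "continuous_on UNIV (fourier f)"
  unfolding continuous_on_sequentially comp_def fourier_def
proof safe
  fix X :: "nat \<Rightarrow> real" and a assume X: "X \<longlonglongrightarrow> a"
  have [measurable]: "f \<in> borel_measurable borel" using f by (auto dest: borel_measurable_integrable)
  show "(\<lambda>n. LBINT y. cis (- (X n * y)) * f y) \<longlonglongrightarrow> (LBINT y. cis (- (a * y)) * f y)"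
    by (rule integral_dominated_convergence[where w = "\<lambda>y. cmod (f y)"])
      (use f X in \<open>auto simp: norm_mult intro!: tendsto_intros AE_I2\<close>)
qed

text \<open>The kernel comes first and may be merely bounded instead of integrable:
  \<open>osc\<close> and \<open>osc_approx\<close> are such kernels, applied to an integrable
  \<open>f\<close>.\<close>

definition convol :: "(real \<Rightarrow> complex) \<Rightarrow> (real \<Rightarrow> complex) \<Rightarrow> real \<Rightarrow> complex" where
  "convol k f s = (LBINT y. k (s - y) * f y)"

lemma convol_measurable [measurable]:
  assumes [measurable]: "k \<in> borel_measurable borel" "f \<in> borel_measurable borel"
  shows "convol k f \<in> borel_measurable borel"
  unfolding convol_def by measurable

lemma convol_bound:
  assumes k: "k \<in> borel_measurable borel" "\<And>x. cmod (k x) \<le> B" and f: "integrable lborel f"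
  shows "cmod (convol k f s) \<le> B * (LBINT y. cmod (f y))"
proof -
  have [measurable]: "f \<in> borel_measurable borel" "k \<in> borel_measurable borel"
    using f k by (auto dest: borel_measurable_integrable)
  have "B \<ge> 0" using order_trans[OF norm_ge_zero k(2)] .
  have "cmod (convol k f s) \<le> (LBINT y. B * cmod (f y))"
    unfolding convol_def
    by (rule Bochner_Integration.integral_norm_bound_integral)
      (use integrable_bounded_mult[OF f, of "\<lambda>y. k (s - y)"] k f in
        \<open>auto simp: norm_mult intro!: mult_right_mono\<close>)
  thus ?thesis by simp
qed

lemma continuous_convol:
  assumes k: "continuous_on UNIV k" "\<And>x. cmod (k x) \<le> B" and f: "integrable lborel f"
  shows "continuous_on UNIV (convol k f)"
  unfolding continuous_on_sequentially comp_def convol_def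
proof safe
  fix X :: "nat \<Rightarrow> real" and a assume X: "X \<longlonglongrightarrow> a"
  have [measurable]: "f \<in> borel_measurable borel" "k \<in> borel_measurable borel"
    using f k by (auto dest: borel_measurable_integrable intro: borel_measurable_continuous_onI)
  have B: "B \<ge> 0" using order_trans[OF norm_ge_zero k(2)] .
  have "(\<lambda>n. k (X n - y)) \<longlonglongrightarrow> k (a - y)" for y
    by (rule continuous_on_tendsto_compose[OF k(1)]) (use X in \<open>auto intro!: tendsto_intros\<close>)
  thus "(\<lambda>n. LBINT y. k (X n - y) * f y) \<longlonglongrightarrow> (LBINT y. k (a - y) * f y)"
    by (intro integral_dominated_convergence[where w = "\<lambda>y. B * cmod (f y)"])
      (use f in \<open>auto simp: norm_mult intro!: tendsto_intros mult_right_mono k\<close>)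
qed

lemma integrable_convol_pair:
  fixes k f :: "real \<Rightarrow> complex"
  assumes k: "integrable lborel k" and f: "integrable lborel f"
  shows "integrable (lborel \<Otimes>\<^sub>M lborel) (\<lambda>(y, s). k (s - y) * f y)"
proof (rule lborel_pair.Fubini_integrable)
  have [measurable]: "f \<in> borel_measurable borel" "k \<in> borel_measurable borel"
    using f k by (auto dest: borel_measurable_integrable)
  show "(\<lambda>(y, s). k (s - y) * f y) \<in> borel_measurable (lborel \<Otimes>\<^sub>M lborel)"
    by measurable
  have sh: "integrable lborel (\<lambda>s. k (s - y))" for y
    using lborel_integrable_real_affine[OF k, of 1 "-y"] by simp
  show "AE y in lborel. integrable lborel (\<lambda>s. case (y, s) of (y, s) \<Rightarrow> k (s - y) * f y)"
    using sh by simp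
  have "(LBINT s. cmod (k (s - y))) = (LBINT s. cmod (k s))" for y
    using lborel_integral_real_affine[of 1 "\<lambda>s. cmod (k s)" "-y"] by simp
  thus "integrable lborel (\<lambda>y. LBINT s. norm (case (y, s) of (y, s) \<Rightarrow> k (s - y) * f y))"
    using f by (simp add: norm_mult)
qed

lemma integrable_convol:
  assumes "integrable lborel k" and "integrable lborel f"
  shows "integrable lborel (convol k f)"
  using lborel_pair.integrable_snd[of "\<lambda>y s. k (s - y) * f y"] integrable_convol_pair[OF assms]
  by (simp add: convol_def[abs_def])

lemma fourier_convol:
  assumes k: "integrable lborel k" and f: "integrable lborel f"
  shows "fourier (convol k f) p = fourier k p * fourier f p"
proof -
  have [measurable]: "f \<in> borel_measurable borel" "k \<in> borel_measurable borel"
    using f k by (auto dest: borel_measurable_integrable)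
  have i: "integrable (lborel \<Otimes>\<^sub>M lborel) (\<lambda>(y, s). cis (- (p * s)) * (k (s - y) * f y))"
    by (rule Bochner_Integration.integrable_bound[OF integrable_convol_pair[OF k f]])
      (auto simp: norm_mult)
  have "fourier (convol k f) p = (LBINT s. LBINT y. cis (- (p * s)) * (k (s - y) * f y))"
    unfolding fourier_def convol_def by simp
  also have "\<dots> = (LBINT y. LBINT s. cis (- (p * s)) * (k (s - y) * f y))"
    by (rule lborel_pair.Fubini_integral[OF i])
  also have "\<dots> = (LBINT y. fourier k p * (cis (- (p * y)) * f y))"
  proof (rule Bochner_Integration.integral_cong[OF refl])
    fix y
    have "(LBINT s. cis (- (p * s)) * (k (s - y) * f y)) =
        (LBINT s. cis (- (p * (s + y))) * (k s * f y))"
      using lborel_integral_real_affine[of 1 "\<lambda>s. cis (- (p * s)) * (k (s - y) * f y)" y]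
      by (simp add: add.commute)
    also have "\<dots> = (LBINT s. (cis (- (p * s)) * k s) * (cis (- (p * y)) * f y))"
      by (rule Bochner_Integration.integral_cong[OF refl])
        (auto simp: cis_mult algebra_simps)
    also have "\<dots> = fourier k p * (cis (- (p * y)) * f y)"
      unfolding fourier_def by simp
    finally show "(LBINT s. cis (- (p * s)) * (k (s - y) * f y)) = fourier k p * (cis (- (p * y)) * f y)" .
  qed
  finally show ?thesis unfolding fourier_def by simp
qed

section \<open>Gaussian integrals\<close>

lemma integrable_gaussian:
  assumes "\<sigma> > 0"
  shows "integrable lborel (\<lambda>y::real. exp (- (\<sigma> * y)\<^sup>2 / 2))"
proof -
  have "integrable lborel (\<lambda>y. sqrt (2 * pi) * std_normal_density y)" by simp
  hence "integrable lborel (\<lambda>y::real. exp (- y\<^sup>2 / 2))"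
    unfolding std_normal_density_def by simp
  from lborel_integrable_real_affine[OF this, of \<sigma> 0] show ?thesis using assms by simp
qed

text \<open>This is the characteristic function of the standard normal law, freed from its
  normalisation and rescaled by \<sigma>.\<close>

lemma gaussian_fourier:
  assumes "\<sigma> > 0"
  shows "(LBINT y. of_real (exp (- (\<sigma> * y)\<^sup>2 / 2)) * cis (t * y)) =
    of_real (sqrt (2 * pi) / \<sigma> * exp (- (t / \<sigma>)\<^sup>2 / 2))"
proof -
  have "of_real (exp (- (t / \<sigma>)\<^sup>2 / 2)) = char std_normal_distribution (t / \<sigma>)"
    using char_std_normal_distribution by simp
  also have "\<dots> = (LBINT y. std_normal_density y *\<^sub>R cis (t / \<sigma> * y))"
    unfolding char_def
    by (subst integral_density) (auto simp: cis_conv_exp std_normal_density_def)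
  also have "\<dots> = (LBINT y. of_real (exp (- y\<^sup>2 / 2)) * cis (t / \<sigma> * y)) / of_real (sqrt (2 * pi))"
    by (simp add: std_normal_density_def scaleR_conv_of_real)
  finally have "(LBINT y. of_real (exp (- y\<^sup>2 / 2)) * cis (t / \<sigma> * y)) =
      complex_of_real (sqrt (2 * pi) * exp (- (t / \<sigma>)\<^sup>2 / 2))"
    by (simp add: field_simps)
  moreover have "(LBINT y. of_real (exp (- y\<^sup>2 / 2)) * cis (t / \<sigma> * y)) =
     \<sigma> *\<^sub>R (LBINT y. of_real (exp (- (\<sigma> * y)\<^sup>2 / 2)) * cis (t * y))"
    using lborel_integral_real_affine[of \<sigma> "\<lambda>y. complex_of_real (exp (- y\<^sup>2 / 2)) * cis (t / \<sigma> * y)" 0] assms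
    by (simp add: mult_ac)
  ultimately show ?thesis using assms by (simp add: scaleR_conv_of_real field_simps)
qed

subsection \<open>Plancherel's theorem\<close>

lemma nn_integral_Fatou_le:
  fixes u :: "nat \<Rightarrow> 'a \<Rightarrow> ennreal"
  assumes [measurable]: "\<And>n. u n \<in> borel_measurable M"
    and lim: "AE x in M. (\<lambda>n. u n x) \<longlonglongrightarrow> g x"
    and le: "\<And>n. (\<integral>\<^sup>+ x. u n x \<partial>M) \<le> c"
  shows "(\<integral>\<^sup>+ x. g x \<partial>M) \<le> c"
proof -
  have "(\<integral>\<^sup>+ x. g x \<partial>M) = (\<integral>\<^sup>+ x. liminf (\<lambda>n. u n x) \<partial>M)"
    using lim by (intro nn_integral_cong_AE) (auto elim!: eventually_mono dest!: lim_imp_Liminf[rotated])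
  also have "\<dots> \<le> liminf (\<lambda>n. \<integral>\<^sup>+ x. u n x \<partial>M)" by (rule nn_integral_liminf) simp
  also have "\<dots> \<le> liminf (\<lambda>n::nat. c)" by (rule Liminf_mono) (simp add: le)
  also have "\<dots> = c" by (simp add: Liminf_const)
  finally show ?thesis .
qed

text \<open>Monotone convergence in the form of a limit, for a pointwise limit known only almost
  everywhere. Identities for approximants then pass to the limit in [0, \<infinity>] by uniqueness
  of limits, without any check of finiteness.\<close>

lemma nn_integral_incseq_tendsto:
  fixes u :: "nat \<Rightarrow> 'a \<Rightarrow> ennreal"
  assumes [measurable]: "\<And>n. u n \<in> borel_measurable M"
    and mono: "\<And>n x. u n x \<le> u (Suc n) x"
    and lim: "AE x in M. (\<lambda>n. u n x) \<longlonglongrightarrow> g x"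
  shows "(\<lambda>n. \<integral>\<^sup>+ x. u n x \<partial>M) \<longlonglongrightarrow> (\<integral>\<^sup>+ x. g x \<partial>M)"
proof -
  have i: "incseq u" by (intro incseq_SucI le_funI mono)
  have "(\<integral>\<^sup>+ x. g x \<partial>M) = (\<integral>\<^sup>+ x. (SUP n. u n x) \<partial>M)"
  proof (rule nn_integral_cong_AE, use lim in eventually_elim)
    fix x assume "(\<lambda>n. u n x) \<longlonglongrightarrow> g x"
    moreover have "(\<lambda>n. u n x) \<longlonglongrightarrow> (SUP n. u n x)"
      by (rule LIMSEQ_SUP) (intro incseq_SucI mono)
    ultimately show "g x = (SUP n. u n x)" by (rule LIMSEQ_unique)
  qed
  also have "\<dots> = (SUP n. \<integral>\<^sup>+ x. u n x \<partial>M)"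
    by (rule nn_integral_monotone_convergence_SUP[OF i]) simp
  finally show ?thesis
    by (simp add: LIMSEQ_SUP incseq_SucI nn_integral_mono mono)
qed

text \<open>A Gaussian weight makes all integrals absolutely convergent. Fubini then turns the
  weighted integral of the squared transform into the pairing of \<open>F\<close> with a Gaussian
  average of its conjugate. As the weight widens to 1, this average converges pointwise by
  continuity of \<open>F\<close> and is dominated because \<open>F\<close> is bounded, while the
  weighted integral converges monotonically.\<close>

theorem plancherel:
  assumes F: "integrable lborel F" and cont: "continuous_on UNIV F"
    and B: "\<And>x. cmod (F x) \<le> B"
  shows "(\<integral>\<^sup>+ p. ennreal ((cmod (fourier F p))\<^sup>2) \<partial>lborel) =
    ennreal (2 * pi) * (\<integral>\<^sup>+ s. ennreal ((cmod (F s))\<^sup>2) \<partial>lborel)"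
proof -
  define \<sigma> where "\<sigma> n = 1 / real (Suc n)" for n
  have \<sigma>: "\<sigma> n > 0" for n by (simp add: \<sigma>_def)
  have \<sigma>0: "\<sigma> \<longlonglongrightarrow> 0" unfolding \<sigma>_def by real_asymp
  have \<sigma>mono: "\<sigma> (Suc n) \<le> \<sigma> n" for n by (simp add: \<sigma>_def frac_le)
  define w where "w n p = exp (- (\<sigma> n * p)\<^sup>2 / 2)" for n p
  have [measurable]: "w n \<in> borel_measurable borel" for n unfolding w_def by measurable
  have w: "integrable lborel (w n)" for n unfolding w_def by (rule integrable_gaussian[OF \<sigma>])
  have w0: "w n p > 0" for n p by (simp add: w_def)
  have [measurable]: "F \<in> borel_measurable borel" using cont by (rule borel_measurable_continuous_onI)
  define M where "M = (LBINT s. cmod (F s))"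
  have M: "cmod (fourier F p) \<le> M" for p unfolding M_def by (rule fourier_bound[OF F])
  have M0: "M \<ge> 0" unfolding M_def by simp
  have B0: "B \<ge> 0" using order_trans[OF norm_ge_zero B] .
  \<comment> \<open>After the substitution y = s + \<sigma> z, which absorbs the factor 1/\<sigma>
    of the Gaussian transform, this is sqrt(2\<pi>) times the Gaussian mean of \<open>cnj F\<close>
    around \<open>s\<close> at scale \<sigma>.\<close>
  define g where "g n s = (LBINT z. of_real (exp (- z\<^sup>2 / 2)) * cnj (F (s + \<sigma> n * z)))" for n s
  have g: "(LBINT p. of_real (w n p) * cnj (fourier F p) * cis (- (p * s))) =
      of_real (sqrt (2 * pi)) * g n s" for n s
  proof -
    have "(LBINT p. of_real (w n p) * cnj (fourier F p) * cis (- (p * s))) =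
       (LBINT p. LBINT y. of_real (w n p) * cis (p * (y - s)) * cnj (F y))"
    proof (rule Bochner_Integration.integral_cong[OF refl])
      fix p
      have "cnj (fourier F p) = (LBINT y. cis (p * y) * cnj (F y))"
        unfolding fourier_def by (subst Bochner_Integration.integral_cnj[symmetric]) (simp add: cis_cnj)
      hence "of_real (w n p) * cnj (fourier F p) * cis (- (p * s)) =
          of_real (w n p) * cis (- (p * s)) * (LBINT y. cis (p * y) * cnj (F y))"
        by simp
      also have "\<dots> = (LBINT y. of_real (w n p) * cis (- (p * s)) * (cis (p * y) * cnj (F y)))"
        by (rule integral_mult_right_zero[symmetric])
      also have "\<dots> = (LBINT y. of_real (w n p) * cis (p * (y - s)) * cnj (F y))"
        by (rule Bochner_Integration.integral_cong[OF refl]) (auto simp: cis_mult algebra_simps)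
      finally show "of_real (w n p) * cnj (fourier F p) * cis (- (p * s)) = \<dots>" .
    qed
    also have "\<dots> = (LBINT y. LBINT p. of_real (w n p) * cis (p * (y - s)) * cnj (F y))"
      by (rule Fubini_product_bound[where a = "w n" and b = "\<lambda>y. cmod (F y)"])
        (use w F w0 in \<open>auto simp: norm_mult less_imp_le\<close>)
    also have "\<dots> = (LBINT y. of_real (sqrt (2 * pi) / \<sigma> n * exp (- ((y - s) / \<sigma> n)\<^sup>2 / 2)) * cnj (F y))"
    proof (rule Bochner_Integration.integral_cong[OF refl])
      fix y
      have "(LBINT p. of_real (w n p) * cis (p * (y - s)) * cnj (F y)) =
          (LBINT p. of_real (exp (- (\<sigma> n * p)\<^sup>2 / 2)) * cis ((y - s) * p)) * cnj (F y)"
        by (simp add: w_def mult.commute[of _ "y - s"])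
      thus "(LBINT p. of_real (w n p) * cis (p * (y - s)) * cnj (F y)) =
          of_real (sqrt (2 * pi) / \<sigma> n * exp (- ((y - s) / \<sigma> n)\<^sup>2 / 2)) * cnj (F y)"
        unfolding gaussian_fourier[OF \<sigma>[of n]] .
    qed
    also have "\<dots> = of_real (sqrt (2 * pi)) * g n s"
      unfolding g_def using \<sigma>[of n]
      by (subst lborel_integral_real_affine[of "\<sigma> n" _ s])
        (auto simp: scaleR_conv_of_real mult_ac add.commute)
    finally show ?thesis .
  qed
  have gi: "integrable lborel (\<lambda>z::real. exp (- z\<^sup>2 / 2))" using integrable_gaussian[of 1] by simp
  have gv: "(LBINT z. exp (- z\<^sup>2 / 2)) = sqrt (2 * pi)"
    using gaussian_fourier[of 1 0] by (simp flip: of_real_mult)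
  have eq: "(LBINT p. w n p * (cmod (fourier F p))\<^sup>2) =
      Re (of_real (sqrt (2 * pi)) * (LBINT s. F s * g n s))" for n
  proof -
    have "of_real (LBINT p. w n p * (cmod (fourier F p))\<^sup>2) =
       (LBINT p. complex_of_real (w n p * (cmod (fourier F p))\<^sup>2))"
      by (rule integral_complex_of_real[symmetric])
    also have "\<dots> = (LBINT p. LBINT s. of_real (w n p) * cnj (fourier F p) * (cis (- (p * s)) * F s))"
    proof (rule Bochner_Integration.integral_cong[OF refl])
      fix p
      have "complex_of_real (w n p * (cmod (fourier F p))\<^sup>2) =
          of_real (w n p) * cnj (fourier F p) * fourier F p"
        by (simp add: complex_norm_square mult_ac flip: of_real_power)
      also have "\<dots> = (LBINT s. of_real (w n p) * cnj (fourier F p) * (cis (- (p * s)) * F s))"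
        by (subst (2) fourier_def) simp
      finally show "complex_of_real (w n p * (cmod (fourier F p))\<^sup>2) = \<dots>" .
    qed
    also have "\<dots> = (LBINT s. LBINT p. of_real (w n p) * cnj (fourier F p) * (cis (- (p * s)) * F s))"
      by (rule Fubini_product_bound[where a = "\<lambda>p. w n p * M" and b = "\<lambda>y. cmod (F y)"])
        (use w F w0 M M0 in \<open>auto simp: norm_mult less_imp_le intro!: mult_mono\<close>)
    also have "\<dots> = (LBINT s. F s * (LBINT p. of_real (w n p) * cnj (fourier F p) * cis (- (p * s))))"
      by (rule Bochner_Integration.integral_cong[OF refl])
        (subst integral_mult_right_zero[symmetric], simp add: mult_ac)
    also have "\<dots> = of_real (sqrt (2 * pi)) * (LBINT s. F s * g n s)"
      unfolding g by (subst integral_mult_right_zero[symmetric]) (simp add: mult_ac)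
    finally show ?thesis by (metis Re_complex_of_real)
  qed
  have gbound: "cmod (g n s) \<le> sqrt (2 * pi) * B" for n s
  proof -
    have "cmod (g n s) \<le> (LBINT z. cmod (of_real (exp (- z\<^sup>2 / 2)) * cnj (F (s + \<sigma> n * z))))"
      unfolding g_def by (rule Bochner_Integration.integral_norm_bound)
    also have "\<dots> \<le> (LBINT z. exp (- z\<^sup>2 / 2) * B)"
      by (rule Bochner_Integration.integral_mono_AE')
        (use gi B B0 in \<open>auto simp: norm_mult intro!: mult_left_mono\<close>)
    finally show ?thesis using gv by simp
  qed
  have glim: "(\<lambda>n. g n s) \<longlonglongrightarrow> of_real (sqrt (2 * pi)) * cnj (F s)" for s
  proof -
    have "(\<lambda>n. F (s + \<sigma> n * z)) \<longlonglongrightarrow> F s" for z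
      by (rule continuous_on_tendsto_compose[OF cont]) (use \<sigma>0 in \<open>auto intro!: tendsto_eq_intros\<close>)
    hence "(\<lambda>n. g n s) \<longlonglongrightarrow> (LBINT z. of_real (exp (- z\<^sup>2 / 2)) * cnj (F s))"
      unfolding g_def
      by (intro integral_dominated_convergence[where w = "\<lambda>z. exp (- z\<^sup>2 / 2) * B"])
        (use gi B in \<open>auto simp: norm_mult intro!: tendsto_intros mult_left_mono\<close>)
    also have "(LBINT z. complex_of_real (exp (- z\<^sup>2 / 2)) * cnj (F s)) =
        of_real (LBINT z. exp (- z\<^sup>2 / 2)) * cnj (F s)" by simp
    finally show ?thesis using gv by simp
  qed
  have gm: "g n \<in> borel_measurable borel" for n unfolding g_def by measurable
  have "(\<lambda>n. LBINT s. F s * g n s) \<longlonglongrightarrow> (LBINT s. F s * (of_real (sqrt (2 * pi)) * cnj (F s)))"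
    by (rule integral_dominated_convergence[where w = "\<lambda>s. cmod (F s) * (sqrt (2 * pi) * B)"])
      (use F gm glim gbound in \<open>auto simp: norm_mult intro!: tendsto_intros mult_left_mono\<close>)
  also have "(LBINT s. F s * (of_real (sqrt (2 * pi)) * cnj (F s))) =
     (LBINT s. complex_of_real (sqrt (2 * pi) * (cmod (F s))\<^sup>2))"
    by (rule Bochner_Integration.integral_cong[OF refl])
      (simp add: complex_norm_square mult_ac flip: of_real_power)
  also have "\<dots> = of_real (sqrt (2 * pi) * (LBINT s. (cmod (F s))\<^sup>2))" 
    by (simp del: of_real_mult)
  finally have "(\<lambda>n. LBINT p. w n p * (cmod (fourier F p))\<^sup>2) \<longlonglongrightarrow>
     Re (of_real (sqrt (2 * pi)) * of_real (sqrt (2 * pi) * (LBINT s. (cmod (F s))\<^sup>2)))"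
    unfolding eq by (intro tendsto_intros)
  also have "Re (of_real (sqrt (2 * pi)) * of_real (sqrt (2 * pi) * (LBINT s. (cmod (F s))\<^sup>2))) =
      2 * pi * (LBINT s. (cmod (F s))\<^sup>2)"
    by (simp add: mult.assoc[symmetric] del: of_real_mult)
  finally have "(\<lambda>n. LBINT p. w n p * (cmod (fourier F p))\<^sup>2) \<longlonglongrightarrow> 2 * pi * (LBINT s. (cmod (F s))\<^sup>2)" .
  hence l1: "(\<lambda>n. ennreal (LBINT p. w n p * (cmod (fourier F p))\<^sup>2)) \<longlonglongrightarrow>
      ennreal (2 * pi * (LBINT s. (cmod (F s))\<^sup>2))" by (rule tendsto_ennrealI)
  have iw: "integrable lborel (\<lambda>p. w n p * (cmod (fourier F p))\<^sup>2)" for n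
    by (rule Bochner_Integration.integrable_bound[where f = "\<lambda>p. w n p * M\<^sup>2"])
      (use w w0 M M0 in \<open>auto simp: abs_mult less_imp_le intro!: mult_mono power_mono\<close>)
  \<comment> \<open>Monotone rather than dominated convergence, since integrability of the squared
    transform is not known beforehand.\<close>
  have "(\<lambda>n. \<integral>\<^sup>+ p. ennreal (w n p * (cmod (fourier F p))\<^sup>2) \<partial>lborel) \<longlonglongrightarrow>
     (\<integral>\<^sup>+ p. ennreal ((cmod (fourier F p))\<^sup>2) \<partial>lborel)"
  proof (rule nn_integral_incseq_tendsto)
    fix n p
    have "(\<sigma> (Suc n) * p)\<^sup>2 \<le> (\<sigma> n * p)\<^sup>2"
      unfolding power_mult_distrib using \<sigma>mono[of n] \<sigma>[of "Suc n"]
      by (intro mult_right_mono power_mono) auto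
    hence "w n p \<le> w (Suc n) p" by (simp add: w_def)
    thus "ennreal (w n p * (cmod (fourier F p))\<^sup>2) \<le> ennreal (w (Suc n) p * (cmod (fourier F p))\<^sup>2)"
      by (intro ennreal_leI mult_right_mono) auto
  next
    have "(\<lambda>n. w n p * (cmod (fourier F p))\<^sup>2) \<longlonglongrightarrow> exp (- (0 * p)\<^sup>2 / 2) * (cmod (fourier F p))\<^sup>2" for p
      unfolding w_def by (intro tendsto_intros \<sigma>0) auto
    thus "AE p in lborel. (\<lambda>n. ennreal (w n p * (cmod (fourier F p))\<^sup>2)) \<longlonglongrightarrow> ennreal ((cmod (fourier F p))\<^sup>2)"
      by (intro AE_I2 tendsto_ennrealI) simp
  qed simp
  moreover have "(\<integral>\<^sup>+ p. ennreal (w n p * (cmod (fourier F p))\<^sup>2) \<partial>lborel) =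
      ennreal (LBINT p. w n p * (cmod (fourier F p))\<^sup>2)" for n
    by (rule nn_integral_eq_integral[OF iw]) (use w0 in \<open>auto simp: less_imp_le\<close>)
  ultimately have "(\<integral>\<^sup>+ p. ennreal ((cmod (fourier F p))\<^sup>2) \<partial>lborel) =
      ennreal (2 * pi * (LBINT s. (cmod (F s))\<^sup>2))"
    using LIMSEQ_unique[OF _ l1] by simp
  also have "\<dots> = ennreal (2 * pi) * ennreal (LBINT s. (cmod (F s))\<^sup>2)"
    by (rule ennreal_mult) auto
  also have "ennreal (LBINT s. (cmod (F s))\<^sup>2) = (\<integral>\<^sup>+ s. ennreal ((cmod (F s))\<^sup>2) \<partial>lborel)"
  proof (rule nn_integral_eq_integral[symmetric])
    show "integrable lborel (\<lambda>s. (cmod (F s))\<^sup>2)"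
      by (rule Bochner_Integration.integrable_bound[where f = "\<lambda>s. B * cmod (F s)"])
        (use F B B0 in \<open>auto simp: power2_eq_square abs_mult intro!: mult_right_mono\<close>)
  qed auto
  finally show ?thesis .
qed

section \<open>Primitives and Plancherel's theorem with the weight 1/p^2\<close>

lemma set_integral_atMost_has_vector_derivative:
  fixes g :: "real \<Rightarrow> 'a::euclidean_space"
  assumes cont: "continuous_on UNIV g" and int: "\<And>s. set_integrable lborel {..s} g"
  shows "((\<lambda>s. LBINT t:{..s}. g t) has_vector_derivative g x) (at x)"
proof -
  \<comment> \<open>The fundamental theorem is used with a finite lower limit. Near \<open>x\<close>
    the integral is split at \<open>x - 1\<close>, and the part below is constant.\<close>
  have "((\<lambda>u. LBINT y=x-1..u. g y) has_vector_derivative g x) (at x within {x-1..x+1})"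
    by (rule interval_integral_FTC2) (auto intro: continuous_on_subset[OF cont])
  hence "((\<lambda>u. LBINT y=x-1..u. g y) has_vector_derivative g x) (at x within {x-1<..<x+1})"
    by (rule has_vector_derivative_within_subset) auto
  hence *: "((\<lambda>u. (LBINT y:{..x-1}. g y) + (LBINT y=x-1..u. g y)) has_vector_derivative g x) (at x within {x-1<..<x+1})"
    by (auto intro!: derivative_eq_intros)
  have "((\<lambda>s. LBINT t:{..s}. g t) has_vector_derivative g x) (at x within {x-1<..<x+1})"
  proof (rule has_vector_derivative_weaken[OF *])
    fix u assume u: "u \<in> {x-1<..<x+1}"
    have "(LBINT y:{..u}. g y) = (LBINT y:{..x-1} \<union> {x-1<..u}. g y)"
      using u by (intro arg_cong2[where f = "set_lebesgue_integral lborel"]) auto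
    also have "\<dots> = (LBINT y:{..x-1}. g y) + (LBINT y:{x-1<..u}. g y)"
      by (rule set_integral_Un) (auto intro!: int set_integrable_subset[OF int[of u]])
    also have "(LBINT y:{x-1<..u}. g y) = (LBINT y=x-1..u. g y)"
      using u by (simp add: interval_integral_Ioc)
    finally show "(LBINT y:{..x-1}. g y) + (LBINT y=x-1..u. g y) = (LBINT y:{..u}. g y)" by simp
  qed auto
  thus ?thesis by (subst (asm) has_vector_derivative_within_open) auto
qed

lemma set_integral_atMost_tendsto_0:
  fixes g :: "real \<Rightarrow> 'a::{banach, second_countable_topology}"
  assumes "integrable lborel g"
  shows "(\<lambda>n. LBINT t:{..- real n}. g t) \<longlonglongrightarrow> 0"
proof -
  have "(\<lambda>n. LBINT t. indicator {..- real n} t *\<^sub>R g t) \<longlonglongrightarrow> (LBINT t. 0 *\<^sub>R g t)"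
  proof (rule integral_dominated_convergence[where w = "\<lambda>t. norm (g t)"])
    show "AE t in lborel. (\<lambda>n. indicator {..- real n} t *\<^sub>R g t) \<longlonglongrightarrow> 0 *\<^sub>R g t"
    proof (rule AE_I2)
      fix t :: real
      have "\<forall>\<^sub>F n in sequentially. real n > - t"
        using filterlim_real_sequentially unfolding filterlim_at_top_dense by blast
      hence "\<forall>\<^sub>F n in sequentially. (indicator {..- real n} t :: real) = 0"
        by eventually_elim auto
      thus "(\<lambda>n. indicator {..- real n} t *\<^sub>R g t) \<longlonglongrightarrow> 0 *\<^sub>R g t"
        by (intro tendsto_intros tendsto_eventually)
    qed
  qed (use assms in \<open>auto split: split_indicator\<close>)
  thus ?thesis by (simp add: set_lebesgue_integral_def)
qed

text \<open>The causal fundamental solution of v' + \<epsilon> v = G. Its transform 1/(\<epsilon> +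
  i p) regularises the division by i p, and as \<epsilon> tends to 0 the convolution with it becomes
  integration from minus infinity.\<close>

definition exp_kernel :: "real \<Rightarrow> real \<Rightarrow> complex" where
  "exp_kernel \<epsilon> t = of_real (indicator {0..} t * exp (- (\<epsilon> * t)))"

lemma exp_kernel_measurable [measurable]: "exp_kernel \<epsilon> \<in> borel_measurable borel"
  unfolding exp_kernel_def by measurable

lemma exp_kernel_bound: "\<epsilon> > 0 \<Longrightarrow> cmod (exp_kernel \<epsilon> t) \<le> 1"
  by (auto simp: exp_kernel_def split: split_indicator)

lemma integrable_exp_kernel:
  assumes "\<epsilon> > 0"
  shows "integrable lborel (exp_kernel \<epsilon>)"
proof -
  have "integrable lborel (\<lambda>x. indicator {0<..} x *\<^sub>R exp (- (x * \<epsilon>)))"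
    using integrable_I0i_exp_mscale[OF assms] by (simp add: set_integrable_def)
  moreover have "AE x in lborel. indicator {0<..} x *\<^sub>R exp (- (x * \<epsilon>)) = indicator {0..} x * exp (- (\<epsilon> * x))"
    using AE_lborel_singleton[of "0::real"] by eventually_elim (auto simp: mult.commute split: split_indicator)
  ultimately have "integrable lborel (\<lambda>x. indicator {0..} x * exp (- (\<epsilon> * x)))"
    by (subst (asm) integrable_cong_AE) auto
  thus ?thesis unfolding exp_kernel_def by (rule integrable_of_real)
qed

lemma fourier_exp_kernel:
  assumes e: "\<epsilon> > 0"
  shows "fourier (exp_kernel \<epsilon>) p = 1 / Complex \<epsilon> p"
proof -
  define z where "z = Complex \<epsilon> p"
  have z0: "z \<noteq> 0" using e by (auto simp: z_def complex_eq_iff)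
  have ex: "cis (- (p * t)) * of_real (exp (- (\<epsilon> * t))) = exp (- z * of_real t)" for t
  proof -
    have "- z * of_real t = Complex (- (\<epsilon> * t)) (- (p * t))" by (simp add: z_def complex_eq_iff)
    thus ?thesis by (simp only: exp_eq_polar complex.sel mult.commute)
  qed
  \<comment> \<open>The kernel includes the point 0, whereas \<open>einterval 0 \<infinity>\<close>
    is open there; the point is adjoined here and then discarded as a null set.\<close>
  have eq: "(\<lambda>t. cis (- (p * t)) * exp_kernel \<epsilon> t) =
      (\<lambda>t. indicator (einterval 0 \<infinity> \<union> {0}) t *\<^sub>R exp (- z * of_real t))"
    unfolding ex[symmetric] exp_kernel_def
    by (rule ext) (auto simp: einterval_def zero_ereal_def scaleR_conv_of_real split: split_indicator)
  have ae: "AE t in lborel. indicator (einterval 0 \<infinity> \<union> {0}) t *\<^sub>R exp (- z * of_real t) =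
      indicator (einterval 0 \<infinity>) t *\<^sub>R exp (- z * of_real t)"
    using AE_lborel_singleton[of "0::real"] by eventually_elim (auto split: split_indicator)
  have m1: "(\<lambda>t. indicator S t *\<^sub>R exp (- z * of_real t)) \<in> borel_measurable borel"
    if "S \<in> sets borel" for S :: "real set"
    using that by (intro borel_measurable_scaleR borel_measurable_indicator borel_measurable_continuous_onI continuous_intros) auto
  have si: "set_integrable lborel (einterval 0 \<infinity>) (\<lambda>t. exp (- z * of_real t))"
    unfolding set_integrable_def
  proof (subst integrable_cong_AE)
    show "integrable lborel (\<lambda>t. cis (- (p * t)) * exp_kernel \<epsilon> t)"
      using integrable_exp_kernel[OF e] by (rule integrable_cis_mult) auto
    show "AE t in lborel. indicator (einterval 0 \<infinity>) t *\<^sub>R exp (- z * of_real t) = cis (- (p * t)) * exp_kernel \<epsilon> t"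
      unfolding fun_cong[OF eq] using ae by eventually_elim simp
  qed (auto intro!: m1 simp del: einterval_eq_Icc)
  have "fourier (exp_kernel \<epsilon>) p = (LBINT t:einterval 0 \<infinity>. exp (- z * of_real t))"
    unfolding fourier_def eq set_lebesgue_integral_def
    by (rule integral_cong_AE[OF _ _ ae]) (auto intro!: m1)
  also have "\<dots> = (LBINT t=0..\<infinity>. exp (- z * of_real t))"
    by (simp add: interval_lebesgue_integral_def)
  also have "\<dots> = 0 - (- (1 / z))"
  proof (rule interval_integral_FTC_integrable[OF _ _ _ si, where F = "\<lambda>t. - exp (- z * of_real t) / z"])
    fix x :: real
    have "((\<lambda>w. - exp (- z * w) / z) has_field_derivative exp (- z * of_real x)) (at (of_real x))"
      using z0 by (auto intro!: derivative_eq_intros)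
    thus "((\<lambda>t. - exp (- z * of_real t) / z) has_vector_derivative exp (- z * of_real x)) (at x)"
      by (rule has_vector_derivative_real_field)
    show "isCont (\<lambda>t. exp (- z * of_real t)) x" by (intro continuous_intros)
  next
    have "isCont (\<lambda>t. - exp (- z * of_real t) / z) (0::real)" using z0 by (intro continuous_intros) auto
    hence "((\<lambda>t::real. - exp (- z * of_real t) / z) \<longlongrightarrow> - (1 / z)) (at_right 0)"
      unfolding isCont_def by (auto intro: tendsto_within_subset)
    thus "(((\<lambda>t. - exp (- z * of_real t) / z) \<circ> real_of_ereal) \<longlongrightarrow> - (1 / z)) (at_right 0)"
      unfolding zero_ereal_def by (simp add: ereal_tendsto_simps)
  next
    have "((\<lambda>t::real. exp (- (\<epsilon> * t))) \<longlongrightarrow> 0) at_top" using e by real_asymp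
    hence "((\<lambda>t::real. exp (- (\<epsilon> * t)) / cmod z) \<longlongrightarrow> 0) at_top" by (rule tendsto_divide_zero)
    hence "((\<lambda>t::real. - exp (- z * of_real t) / z) \<longlongrightarrow> 0) at_top"
      by (rule Lim_null_comparison[rotated]) (auto simp: norm_divide z_def)
    thus "(((\<lambda>t. - exp (- z * of_real t) / z) \<circ> real_of_ereal) \<longlongrightarrow> 0) (at_left \<infinity>)"
      by (simp add: ereal_tendsto_simps)
  qed auto
  finally show ?thesis by (simp add: z_def)
qed

lemma convol_exp_kernel:
  "convol (exp_kernel \<epsilon>) G s = (LBINT t:{..s}. of_real (exp (- (\<epsilon> * (s - t)))) * G t)"
  unfolding convol_def exp_kernel_def set_lebesgue_integral_def
  by (rule Bochner_Integration.integral_cong[OF refl]) (auto simp: indicator_def)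

text \<open>Integrating factor: pulling exp(- \<epsilon> s) out of the integral leaves an ordinary
  primitive, to which the product rule applies.\<close>

lemma convol_exp_kernel_has_vector_derivative:
  assumes G: "integrable lborel G" and cont: "continuous_on UNIV G" and e: "\<epsilon> > 0"
  shows "(convol (exp_kernel \<epsilon>) G has_vector_derivative G s - \<epsilon> *\<^sub>R convol (exp_kernel \<epsilon>) G s) (at s)"
proof -
  have [measurable]: "G \<in> borel_measurable borel" using G by (auto dest: borel_measurable_integrable)
  have i: "set_integrable lborel {..s} (\<lambda>t. of_real (exp (\<epsilon> * t)) * G t)" for s
    unfolding set_integrable_def
  proof (rule Bochner_Integration.integrable_bound[where f = "\<lambda>t. exp (\<epsilon> * s) * cmod (G t)"])
    show "AE t in lborel. norm (indicator {..s} t *\<^sub>R (of_real (exp (\<epsilon> * t)) * G t)) \<le> norm (exp (\<epsilon> * s) * cmod (G t))"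
      using e by (intro AE_I2) (auto simp: norm_mult split: split_indicator intro!: mult_right_mono)
  qed (use G in auto)
  have eq: "convol (exp_kernel \<epsilon>) G = (\<lambda>s. of_real (exp (- (\<epsilon> * s))) * (LBINT t:{..s}. of_real (exp (\<epsilon> * t)) * G t))"
    unfolding convol_exp_kernel
    by (subst set_integral_mult_right[symmetric], rule ext, rule set_lebesgue_integral_cong)
      (auto simp: algebra_simps exp_diff exp_minus exp_add field_simps)
  have d1: "((\<lambda>s. LBINT t:{..s}. of_real (exp (\<epsilon> * t)) * G t) has_vector_derivative of_real (exp (\<epsilon> * s)) * G s) (at s)"
    by (rule set_integral_atMost_has_vector_derivative[OF _ i]) (intro continuous_intros cont)
  have d2: "((\<lambda>s. complex_of_real (exp (- (\<epsilon> * s)))) has_vector_derivative of_real (- \<epsilon> * exp (- (\<epsilon> * s)))) (at s)"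
    by (rule has_vector_derivative_of_real) (auto intro!: derivative_eq_intros)
  have "((\<lambda>s. of_real (exp (- (\<epsilon> * s))) * (LBINT t:{..s}. of_real (exp (\<epsilon> * t)) * G t)) has_vector_derivative
      of_real (exp (- (\<epsilon> * s))) * (of_real (exp (\<epsilon> * s)) * G s) +
      of_real (- \<epsilon> * exp (- (\<epsilon> * s))) * (LBINT t:{..s}. of_real (exp (\<epsilon> * t)) * G t)) (at s)"
    by (rule has_vector_derivative_mult[OF d2 d1])
  also have "of_real (exp (- (\<epsilon> * s))) * (of_real (exp (\<epsilon> * s)) * G s) = G s"
    by (simp add: mult.assoc[symmetric] exp_minus flip: of_real_mult)
  also have "of_real (- \<epsilon> * exp (- (\<epsilon> * s))) * (LBINT t:{..s}. of_real (exp (\<epsilon> * t)) * G t) =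
      - \<epsilon> *\<^sub>R (of_real (exp (- (\<epsilon> * s))) * (LBINT t:{..s}. of_real (exp (\<epsilon> * t)) * G t))"
    by (simp only: of_real_mult scaleR_conv_of_real mult.assoc)
  finally show ?thesis unfolding eq by (simp only: diff_conv_add_uminus scaleR_minus_left)
qed

text \<open>With \<open>w = F - v\<close> one has \<open>w' = \<epsilon> v\<close>, so \<open>\<bar>F\<bar>\<^sup>2 - \<bar>v\<bar>\<^sup>2 = \<bar>w\<bar>\<^sup>2 + (\<bar>w\<bar>\<^sup>2)' / \<epsilon>\<close>.\<close>

lemma nn_integral_convol_exp_kernel_le:
  assumes G: "integrable lborel G" and cont: "continuous_on UNIV G" and e: "\<epsilon> > 0"
  shows "(\<integral>\<^sup>+ s. ennreal ((cmod (convol (exp_kernel \<epsilon>) G s))\<^sup>2) \<partial>lborel) \<le>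
    (\<integral>\<^sup>+ s. ennreal ((cmod (LBINT t:{..s}. G t))\<^sup>2) \<partial>lborel)"
proof -
  define F where "F = (\<lambda>s. LBINT t:{..s}. G t)"
  define v where "v = convol (exp_kernel \<epsilon>) G"
  define w where "w = (\<lambda>s. F s - v s)"
  define M where "M = (LBINT t. cmod (G t))"
  have [measurable]: "G \<in> borel_measurable borel" using G by (auto dest: borel_measurable_integrable)
  have Gi: "set_integrable lborel {..s} G" for s
    using G by (simp add: set_integrable_def integrable_mult_indicator)
  have Fd: "(F has_vector_derivative G s) (at s)" for s
    unfolding F_def by (rule set_integral_atMost_has_vector_derivative[OF cont Gi])
  have vd: "(v has_vector_derivative G s - \<epsilon> *\<^sub>R v s) (at s)" for s
    unfolding v_def by (rule convol_exp_kernel_has_vector_derivative[OF G cont e])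
  have wd: "(w has_vector_derivative \<epsilon> *\<^sub>R v s) (at s)" for s
    unfolding w_def using has_vector_derivative_diff[OF Fd vd, of s] by simp
  have Fc: "continuous_on UNIV F" and vc: "continuous_on UNIV v" and wc: "continuous_on UNIV w"
    using Fd vd wd by (meson continuous_at_imp_continuous_on has_vector_derivative_continuous)+
  have [measurable]: "F \<in> borel_measurable borel" "v \<in> borel_measurable borel"
    using Fc vc by (auto intro: borel_measurable_continuous_onI)
  have Dw: "((\<lambda>s. (cmod (w s))\<^sup>2) has_vector_derivative 2 * \<epsilon> * Re (cnj (w s) * v s)) (at s)" for s
  proof -
    have "((\<lambda>s. cnj (w s) * w s) has_vector_derivative
        cnj (w s) * (\<epsilon> *\<^sub>R v s) + cnj (\<epsilon> *\<^sub>R v s) * w s) (at s)"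
      by (rule has_vector_derivative_mult[OF has_vector_derivative_cnj[OF wd] wd])
    hence "((\<lambda>s. Re (cnj (w s) * w s)) has_vector_derivative
        Re (cnj (w s) * (\<epsilon> *\<^sub>R v s) + cnj (\<epsilon> *\<^sub>R v s) * w s)) (at s)"
      by (rule bounded_linear.has_vector_derivative[OF bounded_linear_Re])
    moreover have "(\<lambda>s. Re (cnj (w s) * w s)) = (\<lambda>s. (cmod (w s))\<^sup>2)"
      unfolding cmod_power2 by (simp add: fun_eq_iff power2_eq_square)
    moreover have "Re (cnj (w s) * (\<epsilon> *\<^sub>R v s) + cnj (\<epsilon> *\<^sub>R v s) * w s) = 2 * \<epsilon> * Re (cnj (w s) * v s)"
      by (simp add: algebra_simps)
    ultimately show ?thesis by (simp only:)
  qed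
  have le: "2 * \<epsilon> * Re (cnj (w s) * v s) \<le> \<epsilon> * ((cmod (F s))\<^sup>2 - (cmod (v s))\<^sup>2)" for s
  proof -
    have "(cmod (F s))\<^sup>2 - (cmod (v s))\<^sup>2 = (cmod (w s))\<^sup>2 + 2 * Re (cnj (w s) * v s)"
      unfolding w_def cmod_power2 by (simp add: power2_eq_square algebra_simps)
    hence "(cmod (F s))\<^sup>2 - (cmod (v s))\<^sup>2 \<ge> 2 * Re (cnj (w s) * v s)" by simp
    hence "\<epsilon> * (2 * Re (cnj (w s) * v s)) \<le> \<epsilon> * ((cmod (F s))\<^sup>2 - (cmod (v s))\<^sup>2)"
      using e by (intro mult_left_mono) auto
    thus ?thesis by (simp add: mult_ac)
  qed
  \<comment> \<open>The boundary term at the left end of [-n, n], divided by \<epsilon>; it tends to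
    0 because \<open>F\<close> and \<open>v\<close> both vanish at minus infinity. The boundary term
    at the right end has the favourable sign and is dropped.\<close>
  define q where "q n = (cmod (w (- real n)))\<^sup>2 / \<epsilon>" for n
  have iv: "set_integrable lborel {- real n..real n} (\<lambda>s. (cmod (v s))\<^sup>2)"
    and iF: "set_integrable lborel {- real n..real n} (\<lambda>s. (cmod (F s))\<^sup>2)" for n
    by (auto intro!: borel_integrable_atLeastAtMost' continuous_intros continuous_on_subset[OF vc] continuous_on_subset[OF Fc])
  have fin: "(LBINT s:{- real n..real n}. (cmod (v s))\<^sup>2) \<le> (LBINT s:{- real n..real n}. (cmod (F s))\<^sup>2) + q n" for n
  proof -
    have cD: "continuous_on {- real n..real n} (\<lambda>s. 2 * \<epsilon> * Re (cnj (w s) * v s))"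
      by (intro continuous_intros continuous_on_subset[OF wc] continuous_on_subset[OF vc]) auto
    have iD: "set_integrable lborel {- real n..real n} (\<lambda>s. 2 * \<epsilon> * Re (cnj (w s) * v s))"
      using cD by (rule borel_integrable_atLeastAtMost')
    have "(LBINT s:{- real n..real n}. 2 * \<epsilon> * Re (cnj (w s) * v s)) =
        (cmod (w (real n)))\<^sup>2 - (cmod (w (- real n)))\<^sup>2"
      unfolding set_lebesgue_integral_def
      by (rule integral_FTC_atLeastAtMost[OF _ has_vector_derivative_at_within[OF Dw] cD]) auto
    hence "- (cmod (w (- real n)))\<^sup>2 \<le> (LBINT s:{- real n..real n}. 2 * \<epsilon> * Re (cnj (w s) * v s))"
      by simp
    also have "\<dots> \<le> (LBINT s:{- real n..real n}. \<epsilon> * ((cmod (F s))\<^sup>2 - (cmod (v s))\<^sup>2))"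
      by (rule set_integral_mono[OF iD]) (use le iv iF in auto)
    also have "\<dots> = \<epsilon> * ((LBINT s:{- real n..real n}. (cmod (F s))\<^sup>2) - (LBINT s:{- real n..real n}. (cmod (v s))\<^sup>2))"
      using iv iF by simp
    finally have "- q n \<le> (LBINT s:{- real n..real n}. (cmod (F s))\<^sup>2) - (LBINT s:{- real n..real n}. (cmod (v s))\<^sup>2)"
      using e unfolding q_def by (simp add: field_simps)
    thus ?thesis by simp
  qed
  have conv: "(\<integral>\<^sup>+ s. ennreal (indicator {- real n..real n} s * (cmod (u s))\<^sup>2) \<partial>lborel) =
     ennreal (LBINT s:{- real n..real n}. (cmod (u s))\<^sup>2)"
    if "set_integrable lborel {- real n..real n} (\<lambda>s. (cmod (u s))\<^sup>2)" for n and u :: "real \<Rightarrow> complex"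
    using that unfolding set_integrable_def set_lebesgue_integral_def
    by (subst nn_integral_eq_integral) auto
  \<comment> \<open>On a bounded interval both integrals are finite and can be rearranged as reals;
    only afterwards is the right side enlarged to the whole line, where it may be infinite.\<close>
  have step: "(\<integral>\<^sup>+ s. ennreal (indicator {- real n..real n} s * (cmod (v s))\<^sup>2) \<partial>lborel) \<le>
      (\<integral>\<^sup>+ s. ennreal ((cmod (F s))\<^sup>2) \<partial>lborel) + ennreal (q n)" for n
  proof -
    have "ennreal (LBINT s:{- real n..real n}. (cmod (v s))\<^sup>2) \<le>
        ennreal ((LBINT s:{- real n..real n}. (cmod (F s))\<^sup>2) + q n)"
      by (rule ennreal_leI[OF fin])
    also have "\<dots> = ennreal (LBINT s:{- real n..real n}. (cmod (F s))\<^sup>2) + ennreal (q n)"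
      by (rule ennreal_plus) (use e in \<open>auto simp: q_def set_lebesgue_integral_def\<close>)
    also have "ennreal (LBINT s:{- real n..real n}. (cmod (F s))\<^sup>2) \<le> (\<integral>\<^sup>+ s. ennreal ((cmod (F s))\<^sup>2) \<partial>lborel)"
      unfolding conv[OF iF, symmetric]
      by (intro nn_integral_mono ennreal_leI) (auto split: split_indicator)
    finally show ?thesis unfolding conv[OF iv] by (simp add: add_right_mono)
  qed
  have q0: "q \<longlonglongrightarrow> 0"
  proof -
    have v0: "(\<lambda>n. v (- real n)) \<longlonglongrightarrow> 0"
    proof (rule Lim_null_comparison)
      show "(\<lambda>n. LBINT t:{..- real n}. cmod (G t)) \<longlonglongrightarrow> 0"
        using G by (intro set_integral_atMost_tendsto_0) auto
      show "\<forall>\<^sub>F n in sequentially. cmod (v (- real n)) \<le> (LBINT t:{..- real n}. cmod (G t))"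
      proof (rule always_eventually, rule allI)
        fix n
        have i: "integrable lborel (\<lambda>t. indicator {..- real n} t *\<^sub>R cmod (G t))"
          by (rule integrable_mult_indicator) (use G in auto)
        have "cmod (v (- real n)) \<le> (LBINT t:{..- real n}. cmod (of_real (exp (- (\<epsilon> * (- real n - t)))) * G t))"
          unfolding v_def convol_exp_kernel set_lebesgue_integral_def
          by (rule order_trans[OF Bochner_Integration.integral_norm_bound]) (simp add: norm_mult)
        also have "\<dots> \<le> (LBINT t:{..- real n}. cmod (G t))"
          unfolding set_lebesgue_integral_def
          by (rule Bochner_Integration.integral_mono_AE')
            (use i e in \<open>auto simp: norm_mult mult_left_le_one_le split: split_indicator\<close>)
        finally show "cmod (v (- real n)) \<le> (LBINT t:{..- real n}. cmod (G t))" .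
      qed
    qed
    have "(\<lambda>n. F (- real n)) \<longlonglongrightarrow> 0" unfolding F_def by (rule set_integral_atMost_tendsto_0[OF G])
    from tendsto_diff[OF this v0] have "(\<lambda>n. w (- real n)) \<longlonglongrightarrow> 0" by (simp add: w_def)
    hence "q \<longlonglongrightarrow> (cmod 0)\<^sup>2 / \<epsilon>" unfolding q_def using e by (intro tendsto_intros) auto
    thus ?thesis by simp
  qed
  have "(\<lambda>n. \<integral>\<^sup>+ s. ennreal (indicator {- real n..real n} s * (cmod (v s))\<^sup>2) \<partial>lborel) \<longlonglongrightarrow>
      (\<integral>\<^sup>+ s. ennreal ((cmod (v s))\<^sup>2) \<partial>lborel)"
  proof (rule nn_integral_incseq_tendsto)
    show "AE s in lborel. (\<lambda>n. ennreal (indicator {- real n..real n} s * (cmod (v s))\<^sup>2)) \<longlonglongrightarrow> ennreal ((cmod (v s))\<^sup>2)"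
    proof (rule AE_I2, rule tendsto_eventually)
      fix s :: real
      have "\<forall>\<^sub>F n in sequentially. real n > \<bar>s\<bar>"
        using filterlim_real_sequentially unfolding filterlim_at_top_dense by blast
      thus "\<forall>\<^sub>F n in sequentially. ennreal (indicator {- real n..real n} s * (cmod (v s))\<^sup>2) = ennreal ((cmod (v s))\<^sup>2)"
        by eventually_elim (auto simp: indicator_def)
    qed
  qed (auto intro!: ennreal_leI mult_right_mono split: split_indicator)
  moreover have "(\<lambda>n. (\<integral>\<^sup>+ s. ennreal ((cmod (F s))\<^sup>2) \<partial>lborel) + ennreal (q n)) \<longlonglongrightarrow>
      (\<integral>\<^sup>+ s. ennreal ((cmod (F s))\<^sup>2) \<partial>lborel) + ennreal 0"
    by (intro tendsto_intros tendsto_ennrealI q0)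
  ultimately have "(\<integral>\<^sup>+ s. ennreal ((cmod (v s))\<^sup>2) \<partial>lborel) \<le> (\<integral>\<^sup>+ s. ennreal ((cmod (F s))\<^sup>2) \<partial>lborel) + ennreal 0"
    by (rule LIMSEQ_le) (use step in auto)
  thus ?thesis by (simp add: F_def v_def)
qed

text \<open>The primitive need not be integrable, so \<open>plancherel\<close> is applied to its
  damped versions \<open>v n\<close>, whose transform is that of \<open>G\<close> divided by
  \<epsilon> + i p. The momentum side increases as \<epsilon> decreases. One inequality holds
  because damping does not increase the square integral, the other follows from Fatou's lemma. Both
  sides may be infinite, for instance when the transform of \<open>G\<close> does not vanish at
  0.\<close>

theorem plancherel_primitive:
  assumes G: "integrable lborel G" and cont: "continuous_on UNIV G"
  shows "(\<integral>\<^sup>+ p. ennreal ((cmod (fourier G p))\<^sup>2 / p\<^sup>2) \<partial>lborel) =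
    ennreal (2 * pi) * (\<integral>\<^sup>+ s. ennreal ((cmod (LBINT t:{..s}. G t))\<^sup>2) \<partial>lborel)"
proof -
  define F where "F = (\<lambda>s. LBINT t:{..s}. G t)"
  define e where "e n = 1 / real (Suc n)" for n
  have e: "e n > 0" for n by (simp add: e_def)
  have e0: "e \<longlonglongrightarrow> 0" unfolding e_def by real_asymp
  have emono: "e (Suc n) \<le> e n" for n by (simp add: e_def frac_le)
  define v where "v n = convol (exp_kernel (e n)) G" for n
  have [measurable]: "G \<in> borel_measurable borel" using G by (auto dest: borel_measurable_integrable)
  have [measurable]: "v n \<in> borel_measurable borel" for n unfolding v_def by measurable
  have P: "(\<integral>\<^sup>+ p. ennreal ((cmod (fourier G p))\<^sup>2 / ((e n)\<^sup>2 + p\<^sup>2)) \<partial>lborel) =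
      ennreal (2 * pi) * (\<integral>\<^sup>+ s. ennreal ((cmod (v n s))\<^sup>2) \<partial>lborel)" for n
  proof -
    have c: "continuous_on UNIV (v n)"
      unfolding v_def using convol_exp_kernel_has_vector_derivative[OF G cont e]
      by (meson continuous_at_imp_continuous_on has_vector_derivative_continuous)
    have i: "integrable lborel (v n)"
      unfolding v_def by (rule integrable_convol[OF integrable_exp_kernel[OF e] G])
    have b: "cmod (v n s) \<le> 1 * (LBINT t. cmod (G t))" for s
      unfolding v_def by (rule convol_bound[OF _ exp_kernel_bound[OF e] G]) simp
    have "(\<integral>\<^sup>+ p. ennreal ((cmod (fourier (v n) p))\<^sup>2) \<partial>lborel) =
      ennreal (2 * pi) * (\<integral>\<^sup>+ s. ennreal ((cmod (v n s))\<^sup>2) \<partial>lborel)" by (rule plancherel[OF i c b])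
    moreover have "(cmod (fourier (v n) p))\<^sup>2 = (cmod (fourier G p))\<^sup>2 / ((e n)\<^sup>2 + p\<^sup>2)" for p
      unfolding v_def fourier_convol[OF integrable_exp_kernel[OF e] G] fourier_exp_kernel[OF e]
      by (simp add: norm_mult norm_divide power_mult_distrib power_divide cmod_power2)
    ultimately show ?thesis by simp
  qed
  have lim: "(\<lambda>n. \<integral>\<^sup>+ p. ennreal ((cmod (fourier G p))\<^sup>2 / ((e n)\<^sup>2 + p\<^sup>2)) \<partial>lborel) \<longlonglongrightarrow>
      (\<integral>\<^sup>+ p. ennreal ((cmod (fourier G p))\<^sup>2 / p\<^sup>2) \<partial>lborel)"
  proof (rule nn_integral_incseq_tendsto)
    fix n p
    show "ennreal ((cmod (fourier G p))\<^sup>2 / ((e n)\<^sup>2 + p\<^sup>2)) \<le> ennreal ((cmod (fourier G p))\<^sup>2 / ((e (Suc n))\<^sup>2 + p\<^sup>2))"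
      using e[of n] e[of "Suc n"] emono[of n]
      by (intro ennreal_leI divide_left_mono add_right_mono power_mono mult_pos_pos add_pos_nonneg) auto
  next
    show "AE p in lborel. (\<lambda>n. ennreal ((cmod (fourier G p))\<^sup>2 / ((e n)\<^sup>2 + p\<^sup>2))) \<longlonglongrightarrow> ennreal ((cmod (fourier G p))\<^sup>2 / p\<^sup>2)"
      using AE_lborel_singleton[of "0::real"]
    proof eventually_elim
      fix p :: real assume "p \<noteq> 0"
      hence "(\<lambda>n. (cmod (fourier G p))\<^sup>2 / ((e n)\<^sup>2 + p\<^sup>2)) \<longlonglongrightarrow> (cmod (fourier G p))\<^sup>2 / (0\<^sup>2 + p\<^sup>2)"
        by (intro tendsto_intros e0) auto
      thus "(\<lambda>n. ennreal ((cmod (fourier G p))\<^sup>2 / ((e n)\<^sup>2 + p\<^sup>2))) \<longlonglongrightarrow> ennreal ((cmod (fourier G p))\<^sup>2 / p\<^sup>2)"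
        by (intro tendsto_ennrealI) simp
    qed
  qed simp
  have v_lim: "(\<lambda>n. v n s) \<longlonglongrightarrow> F s" for s
    unfolding v_def F_def convol_exp_kernel set_lebesgue_integral_def
  proof (rule integral_dominated_convergence[where w = "\<lambda>t. cmod (G t)"])
    show "AE t in lborel. (\<lambda>n. indicator {..s} t *\<^sub>R (of_real (exp (- (e n * (s - t)))) * G t)) \<longlonglongrightarrow> indicator {..s} t *\<^sub>R G t"
    proof (rule AE_I2)
      fix t
      have "(\<lambda>n. indicator {..s} t *\<^sub>R (of_real (exp (- (e n * (s - t)))) * G t)) \<longlonglongrightarrow> indicator {..s} t *\<^sub>R (of_real (exp (- (0 * (s - t)))) * G t)"
        by (intro tendsto_intros e0)
      thus "(\<lambda>n. indicator {..s} t *\<^sub>R (of_real (exp (- (e n * (s - t)))) * G t)) \<longlonglongrightarrow> indicator {..s} t *\<^sub>R G t" by simp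
    qed
    show "AE t in lborel. norm (indicator {..s} t *\<^sub>R (complex_of_real (exp (- (e n * (s - t)))) * G t)) \<le> cmod (G t)" for n
      using e[of n] by (intro AE_I2) (auto simp: norm_mult mult_left_le_one_le split: split_indicator)
  qed (use G in auto)
  have "(\<integral>\<^sup>+ p. ennreal ((cmod (fourier G p))\<^sup>2 / p\<^sup>2) \<partial>lborel) \<le>
    ennreal (2 * pi) * (\<integral>\<^sup>+ s. ennreal ((cmod (F s))\<^sup>2) \<partial>lborel)"
  proof (rule LIMSEQ_le_const2[OF lim], intro exI allI impI)
    fix n :: nat
    show "(\<integral>\<^sup>+ p. ennreal ((cmod (fourier G p))\<^sup>2 / ((e n)\<^sup>2 + p\<^sup>2)) \<partial>lborel) \<le> ennreal (2 * pi) * (\<integral>\<^sup>+ s. ennreal ((cmod (F s))\<^sup>2) \<partial>lborel)"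
      unfolding P v_def F_def by (intro mult_left_mono nn_integral_convol_exp_kernel_le[OF G cont e]) simp
  qed
  moreover have "ennreal (2 * pi) * (\<integral>\<^sup>+ s. ennreal ((cmod (F s))\<^sup>2) \<partial>lborel) \<le>
      (\<integral>\<^sup>+ p. ennreal ((cmod (fourier G p))\<^sup>2 / p\<^sup>2) \<partial>lborel)"
  proof -
    have [measurable]: "F \<in> borel_measurable borel"
      by (rule borel_measurable_LIMSEQ_metric[OF _ v_lim]) simp
    have "(\<integral>\<^sup>+ s. ennreal (2 * pi) * ennreal ((cmod (F s))\<^sup>2) \<partial>lborel) \<le>
      (\<integral>\<^sup>+ p. ennreal ((cmod (fourier G p))\<^sup>2 / p\<^sup>2) \<partial>lborel)"
    proof (rule nn_integral_Fatou_le)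
      show "AE s in lborel. (\<lambda>n. ennreal (2 * pi) * ennreal ((cmod (v n s))\<^sup>2)) \<longlonglongrightarrow> ennreal (2 * pi) * ennreal ((cmod (F s))\<^sup>2)"
        by (intro AE_I2 ennreal_tendsto_cmult tendsto_ennrealI tendsto_intros v_lim) simp
      fix n :: nat
      have "(\<integral>\<^sup>+ s. ennreal (2 * pi) * ennreal ((cmod (v n s))\<^sup>2) \<partial>lborel) =
          (\<integral>\<^sup>+ p. ennreal ((cmod (fourier G p))\<^sup>2 / ((e n)\<^sup>2 + p\<^sup>2)) \<partial>lborel)"
        unfolding P by (rule nn_integral_cmult) simp
      also have "\<dots> \<le> (\<integral>\<^sup>+ p. ennreal ((cmod (fourier G p))\<^sup>2 / p\<^sup>2) \<partial>lborel)"
        using AE_lborel_singleton[of "0::real"]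
        by (intro nn_integral_mono_AE, eventually_elim) (auto intro!: ennreal_leI divide_left_mono mult_pos_pos add_nonneg_pos)
      finally show "(\<integral>\<^sup>+ s. ennreal (2 * pi) * ennreal ((cmod (v n s))\<^sup>2) \<partial>lborel) \<le> \<dots>" .
    qed simp
    thus ?thesis by (subst (asm) nn_integral_cmult) auto
  qed
  ultimately show ?thesis unfolding F_def by (rule antisym)
qed

subsection \<open>Integrals along the exponential map\<close>

text \<open>Substitution on [-n, n] followed by monotone limits. Being an equality of measures, it
  transfers to the line nonnegative integrals over dk/2k as well as complex ones such as Euler's
  integral.\<close>

lemma distr_lborel_exp:
  "distr lborel borel exp = density lborel (\<lambda>x. ennreal (indicator {0<..} x / x :: real))"
proof (rule measure_eqI)
  fix A :: "real set" assume "A \<in> sets (distr lborel borel exp)"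
  hence [measurable]: "A \<in> sets borel" by simp
  have eq: "(\<integral>\<^sup>+ t. ennreal (indicator {- real n..real n} t * indicator A (exp t)) \<partial>lborel) =
      (\<integral>\<^sup>+ x. ennreal (indicator {exp (- real n)..exp (real n)} x * (indicator A x / x)) \<partial>lborel)" for n
  proof -
    have "(\<integral>\<^sup>+ x. ennreal (indicator A x / x * indicator {exp (- real n)..exp (real n)} x) \<partial>lborel) =
        (\<integral>\<^sup>+ t. ennreal (indicator A (exp t) / exp t * exp t * indicator {- real n..real n} t) \<partial>lborel)"
      by (rule nn_integral_substitution)
        (auto intro!: derivative_eq_intros continuous_intros simp: set_borel_measurable_def)
    thus ?thesis by (simp add: mult.commute)
  qed
  have large: "\<forall>\<^sub>F n in sequentially. real n > c" for c
    using filterlim_real_sequentially unfolding filterlim_at_top_dense by blast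
  have "(\<lambda>n. \<integral>\<^sup>+ t. ennreal (indicator {- real n..real n} t * indicator A (exp t)) \<partial>lborel) \<longlonglongrightarrow>
      (\<integral>\<^sup>+ t. ennreal (indicator A (exp t)) \<partial>lborel)"
  proof (rule nn_integral_incseq_tendsto)
    show "AE t in lborel. (\<lambda>n. ennreal (indicator {- real n..real n} t * indicator A (exp t))) \<longlonglongrightarrow> ennreal (indicator A (exp t))"
    proof (intro AE_I2 tendsto_eventually)
      fix t :: real
      show "\<forall>\<^sub>F n in sequentially. ennreal (indicator {- real n..real n} t * indicator A (exp t)) = ennreal (indicator A (exp t))"
        by (rule eventually_mono[OF large[of "\<bar>t\<bar>"]]) (auto simp: indicator_def)
    qed
  qed (auto intro!: ennreal_leI split: split_indicator)
  moreover have "(\<lambda>n. \<integral>\<^sup>+ x. ennreal (indicator {exp (- real n)..exp (real n)} x * (indicator A x / x)) \<partial>lborel) \<longlonglongrightarrow>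
      (\<integral>\<^sup>+ x. ennreal (indicator {0<..} x / x) * indicator A x \<partial>lborel)"
  proof (rule nn_integral_incseq_tendsto)
    show "AE x in lborel. (\<lambda>n. ennreal (indicator {exp (- real n)..exp (real n)} x * (indicator A x / x))) \<longlonglongrightarrow>
        ennreal (indicator {0<..} x / x) * indicator A x"
    proof (rule AE_I2, rule tendsto_eventually)
      fix x :: real
      show "\<forall>\<^sub>F n in sequentially. ennreal (indicator {exp (- real n)..exp (real n)} x * (indicator A x / x)) =
          ennreal (indicator {0<..} x / x) * indicator A x"
      proof (cases "x > 0")
        case True
        show ?thesis using large[of "\<bar>ln x\<bar>"]
        proof eventually_elim
          case (elim n)
          hence "- real n \<le> ln x" "ln x \<le> real n" by auto
          hence "exp (- real n) \<le> x" "x \<le> exp (real n)" using True by (metis exp_le_cancel_iff exp_ln)+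
          thus ?case using True by (auto split: split_indicator)
        qed
      next
        case False
        have "\<not> exp (- real n) \<le> x" for n using False by (meson exp_gt_zero less_le_trans)
        thus ?thesis using False by (auto split: split_indicator)
      qed
    qed
    fix n :: nat and x :: real
    have "exp (- real (Suc n)) \<le> exp (- real n)" "exp (real n) \<le> exp (real (Suc n))" by auto
    moreover have "exp (- real n) \<le> x \<Longrightarrow> x > 0" by (meson exp_gt_zero less_le_trans)
    moreover have "exp (- real (Suc n)) \<le> x \<Longrightarrow> x > 0" by (meson exp_gt_zero less_le_trans)
    ultimately show "ennreal (indicator {exp (- real n)..exp (real n)} x * (indicator A x / x)) \<le>
        ennreal (indicator {exp (- real (Suc n))..exp (real (Suc n))} x * (indicator A x / x))"
      by (intro ennreal_leI) (auto split: split_indicator simp del: of_nat_Suc exp_le_cancel_iff intro: order_trans)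
  qed simp
  ultimately have "(\<integral>\<^sup>+ t. ennreal (indicator A (exp t)) \<partial>lborel) =
      (\<integral>\<^sup>+ x. ennreal (indicator {0<..} x / x) * indicator A x \<partial>lborel)"
    unfolding eq by (rule LIMSEQ_unique)
  moreover have "emeasure (distr lborel borel exp) A = (\<integral>\<^sup>+ t. ennreal (indicator A (exp t)) \<partial>lborel)"
  proof -
    have [measurable]: "exp -` A \<in> sets borel"
      using measurable_sets[of exp borel "borel :: real measure" A] by simp
    have "(\<integral>\<^sup>+ t. ennreal (indicator A (exp t)) \<partial>lborel) = (\<integral>\<^sup>+ t. indicator (exp -` A) t \<partial>lborel)"
      by (intro nn_integral_cong) (auto split: split_indicator)
    thus ?thesis by (simp add: emeasure_distr)
  qed
  ultimately show "emeasure (distr lborel borel exp) A = emeasure (density lborel (\<lambda>x. ennreal (indicator {0<..} x / x))) A"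
    by (subst emeasure_density) auto
qed simp

lemma nn_integral_wf_measure:
  assumes [measurable]: "G \<in> borel_measurable borel"
  shows "(\<integral>\<^sup>+ k. G k \<partial>wf_measure) = ennreal (1 / 2) * (\<integral>\<^sup>+ s. G (exp s) \<partial>lborel)"
proof -
  have "(\<integral>\<^sup>+ s. G (exp s) \<partial>lborel) = (\<integral>\<^sup>+ k. G k \<partial>distr lborel borel exp)"
    by (subst nn_integral_distr) auto
  also have "\<dots> = (\<integral>\<^sup>+ k. ennreal (indicator {0<..} k / k) * G k \<partial>lborel)"
    unfolding distr_lborel_exp by (subst nn_integral_density) auto
  also have "ennreal (1 / 2) * \<dots> = (\<integral>\<^sup>+ k. ennreal (1 / 2) * (ennreal (indicator {0<..} k / k) * G k) \<partial>lborel)"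
    by (subst nn_integral_cmult) auto
  also have "\<dots> = (\<integral>\<^sup>+ k. ennreal (indicator {0<..} k / (2 * k)) * G k \<partial>lborel)"
  proof (rule nn_integral_cong)
    fix k :: real
    have "ennreal (1 / 2) * ennreal (indicator {0<..} k / k) = ennreal (indicator {0<..} k / (2 * k))"
      by (subst ennreal_mult'[symmetric]) (auto split: split_indicator)
    thus "ennreal (1 / 2) * (ennreal (indicator {0<..} k / k) * G k) = ennreal (indicator {0<..} k / (2 * k)) * G k"
      by (simp only: mult.assoc[symmetric])
  qed
  finally show ?thesis unfolding wf_measure_def by (subst nn_integral_density) auto
qed

section \<open>Euler's integral on the line and shifts of the contour\<close>

lemma Gamma_integral_exp:
  assumes z: "Re z > 0"
  shows "integrable lborel (\<lambda>t. exp (z * of_real t - exp (of_real t)))"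
    and "(LBINT t. exp (z * of_real t - exp (of_real t))) = Gamma z"
proof -
  define G where "G x = exp (z * of_real (ln x) - of_real x)" for x :: real
  have [measurable]: "G \<in> borel_measurable borel"
  proof -
    have "(\<lambda>x. exp (of_real (Re z * ln x - x)) * cis (Im z * ln x)) \<in> borel_measurable (borel :: real measure)"
      by measurable
    moreover have "exp (of_real (Re z * ln x - x)) * cis (Im z * ln x) = G x" for x
      unfolding G_def cis_conv_exp exp_add[symmetric]
      by (rule arg_cong[where f = exp]) (auto simp: complex_eq_iff)
    ultimately show ?thesis by (simp only:)
  qed
  have Gt: "G (exp t) = exp (z * of_real t - exp (of_real t))" for t by (simp add: G_def exp_of_real)
  \<comment> \<open>With x = e^t the measure dt becomes dx/x, which accounts for the exponent z - 1
    of Euler's integral.\<close>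
  have pt: "(indicator {0<..} x / x) *\<^sub>R G x = indicator {0<..} x *\<^sub>R (of_real x powr (z - 1) / of_real (exp x))" for x :: real
    by (auto simp: G_def powr_def Ln_of_real scaleR_conv_of_real exp_diff exp_of_real algebra_simps
       field_simps split: split_indicator)
  have "(\<lambda>t. of_real t powr (z - 1) / of_real (exp (1 * t))) absolutely_integrable_on {0<..}"
    by (rule absolutely_integrable_Gamma_integral[OF z]) simp
  hence abs: "(\<lambda>t. of_real t powr (z - 1) / of_real (exp t)) absolutely_integrable_on {0<..}" by simp
  have "set_integrable lborel {0<..} (\<lambda>t. of_real t powr (z - 1) / of_real (exp t))"
    using abs unfolding set_integrable_def pt[symmetric]
    by (subst (asm) integrable_completion) auto
  hence i: "integrable lborel (\<lambda>x. (indicator {0<..} x / x) *\<^sub>R G x)"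
    unfolding pt set_integrable_def .
  have "integrable (density lborel (\<lambda>x. ennreal (indicator {0<..} x / x :: real))) G"
    using i by (subst integrable_density) (auto split: split_indicator)
  hence "integrable (distr lborel borel exp) G" unfolding distr_lborel_exp .
  thus "integrable lborel (\<lambda>t. exp (z * of_real t - exp (of_real t)))"
    by (subst (asm) integrable_distr_eq) (auto simp: Gt)
  have "(LBINT t. exp (z * of_real t - exp (of_real t))) = integral\<^sup>L (distr lborel borel exp) G"
    by (subst integral_distr) (auto simp: Gt)
  also have "\<dots> = (LBINT x. (indicator {0<..} x / x) *\<^sub>R G x)"
    unfolding distr_lborel_exp by (subst integral_density) (auto split: split_indicator)
  \<comment> \<open>Euler's integral is given as a Henstock-Kurzweil integral, which is reached
    through the completed measure.\<close>
  also have "\<dots> = (LINT x|lebesgue. (indicator {0<..} x / x) *\<^sub>R G x)"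
    by (rule integral_completion[symmetric]) simp
  also have "\<dots> = integral {0<..} (\<lambda>t. of_real t powr (z - 1) / of_real (exp t))"
    using set_lebesgue_integral_eq_integral(2)[OF abs] unfolding pt set_lebesgue_integral_def .
  also have "\<dots> = Gamma z"
    by (rule integral_unique[OF Gamma_integral_complex'[OF z]])
  finally show "(LBINT t. exp (z * of_real t - exp (of_real t))) = Gamma z" .
qed

lemma LBINT_tendsto_UNIV:
  fixes f :: "real \<Rightarrow> 'a::{banach, second_countable_topology}"
  assumes f: "integrable lborel f"
  shows "(\<lambda>n. LBINT t:{- real n..real n}. f t) \<longlonglongrightarrow> (LBINT t. f t)"
  unfolding set_lebesgue_integral_def
proof (rule integral_dominated_convergence[where w = "\<lambda>t. norm (f t)"])
  have large: "\<forall>\<^sub>F n in sequentially. real n > c" for c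
    using filterlim_real_sequentially unfolding filterlim_at_top_dense by blast
  show "AE t in lborel. (\<lambda>n. indicator {- real n..real n} t *\<^sub>R f t) \<longlonglongrightarrow> f t"
  proof (intro AE_I2 tendsto_eventually)
    fix t :: real
    show "\<forall>\<^sub>F n in sequentially. indicator {- real n..real n} t *\<^sub>R f t = f t"
      by (rule eventually_mono[OF large[of "\<bar>t\<bar>"]]) (auto simp: indicator_def)
  qed
qed (use f in \<open>auto split: split_indicator\<close>)

text \<open>The horizontal contour is shifted by comparing a primitive at its two ends, so that
  no contour integral along a rectangle is needed.\<close>

lemma horizontal_contour_shift:
  fixes \<phi> :: "complex \<Rightarrow> complex"
  assumes hol: "\<phi> holomorphic_on {w. - c < Im w \<and> Im w < d}"
    and c: "c > 0" "0 \<le> \<theta>" "\<theta> < d"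
    and b: "\<And>t \<tau>. 0 \<le> \<tau> \<Longrightarrow> \<tau> \<le> \<theta> \<Longrightarrow> cmod (\<phi> (Complex t \<tau>)) \<le> b t"
    and b0: "(\<lambda>n. b (real n)) \<longlonglongrightarrow> 0" "(\<lambda>n. b (- real n)) \<longlonglongrightarrow> 0"
    and i0: "integrable lborel (\<lambda>t. \<phi> (Complex t 0))"
    and i1: "integrable lborel (\<lambda>t. \<phi> (Complex t \<theta>))"
  shows "(LBINT t. \<phi> (Complex t \<theta>)) = (LBINT t. \<phi> (Complex t 0))"
proof -
  define S where "S = {w. - c < Im w \<and> Im w < d}"
  have S: "S = {w. - c < Im w} \<inter> {w. Im w < d}" by (auto simp: S_def)
  \<comment> \<open>Convexity of the strip provides a global primitive; the strip exceeds the
    heights from 0 to \<theta> on both sides, so that both lines lie in its interior.\<close>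
  have "convex S" unfolding S
    by (intro convex_Int convex_halfspace_Im_gt convex_halfspace_Im_lt)
  moreover have "open S" unfolding S
    by (intro open_Int open_halfspace_Im_gt open_halfspace_Im_lt)
  ultimately obtain P where P': "\<And>w. w \<in> S \<Longrightarrow> (P has_field_derivative \<phi> w) (at w within S)"
    using hol holomorphic_convex_primitive'[of S \<phi>] unfolding S_def[symmetric] by blast
  have P: "(P has_field_derivative \<phi> w) (at w)" if "w \<in> S" for w
    using P'[OF that] by (simp only: at_within_open[OF that \<open>open S\<close>])
  have cont: "continuous_on S \<phi>" using hol unfolding S_def by (rule holomorphic_on_imp_continuous_on)
  have inS: "Complex t \<tau> \<in> S" if "0 \<le> \<tau>" "\<tau> \<le> \<theta>" for t \<tau> using that c by (simp add: S_def)
  have FTC: "(LBINT t:{- real n..real n}. \<phi> (Complex t \<tau>)) = P (Complex (real n) \<tau>) - P (Complex (- real n) \<tau>)"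
    if \<tau>: "0 \<le> \<tau>" "\<tau> \<le> \<theta>" for n \<tau>
    unfolding set_lebesgue_integral_def
  proof (rule integral_FTC_atLeastAtMost)
    fix x :: real
    have "((\<lambda>w. P (w + \<i> * of_real \<tau>)) has_field_derivative \<phi> (Complex x \<tau>)) (at (of_real x))"
    proof -
      have "(P has_field_derivative \<phi> (Complex x \<tau>)) (at (of_real x + \<i> * of_real \<tau>))"
        using P[OF inS[OF \<tau>, of x]] by (simp add: Complex_eq)
      moreover have "((\<lambda>w. w + \<i> * of_real \<tau>) has_field_derivative 1) (at (of_real x))"
        by (auto intro!: derivative_eq_intros)
      ultimately show ?thesis
        using DERIV_chain2[where f = P and g = "\<lambda>w. w + \<i> * of_real \<tau>"] by fastforce
    qed
    hence "((\<lambda>t. P (of_real t + \<i> * of_real \<tau>)) has_vector_derivative \<phi> (Complex x \<tau>)) (at x)"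
      by (rule has_vector_derivative_real_field)
    thus "((\<lambda>t. P (Complex t \<tau>)) has_vector_derivative \<phi> (Complex x \<tau>)) (at x within {- real n..real n})"
      by (simp add: Complex_eq has_vector_derivative_at_within)
    show "continuous_on {- real n..real n} (\<lambda>t. \<phi> (Complex t \<tau>))"
      by (rule continuous_on_compose2[OF cont]) (use inS \<tau> in \<open>auto simp: Complex_eq intro!: continuous_intros\<close>)
  qed simp
  \<comment> \<open>Takes the place of the vertical sides of a rectangle: the mean value inequality
    along a segment of length \<theta>.\<close>
  have vert: "cmod (P (Complex t \<theta>) - P (Complex t 0)) \<le> b t * \<theta>" for t
  proof -
    have "cmod (P (Complex t \<theta>) - P (Complex t 0)) \<le> b t * cmod (Complex t \<theta> - Complex t 0)"
    proof (rule field_differentiable_bound)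
      show "convex (closed_segment (Complex t 0) (Complex t \<theta>))" by simp
      fix w assume "w \<in> closed_segment (Complex t 0) (Complex t \<theta>)"
      then obtain u where u: "0 \<le> u" "u \<le> 1" "w = (1 - u) *\<^sub>R Complex t 0 + u *\<^sub>R Complex t \<theta>"
        unfolding closed_segment_def by blast
      hence w: "w = Complex t (u * \<theta>)" by (simp add: complex_eq_iff algebra_simps)
      have *: "0 \<le> u * \<theta>" "u * \<theta> \<le> \<theta>" using u c by (auto simp: mult_left_le_one_le)
      show "(P has_field_derivative \<phi> w) (at w within closed_segment (Complex t 0) (Complex t \<theta>))"
        unfolding w by (rule has_field_derivative_at_within[OF P[OF inS[OF *]]])
      show "cmod (\<phi> w) \<le> b t" unfolding w by (rule b[OF *])
    qed auto
    also have "cmod (Complex t \<theta> - Complex t 0) = \<theta>" using c by (simp add: cmod_def)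
    finally show ?thesis .
  qed
  have "(\<lambda>n. (LBINT t:{- real n..real n}. \<phi> (Complex t \<theta>)) - (LBINT t:{- real n..real n}. \<phi> (Complex t 0))) \<longlonglongrightarrow> 0"
  proof (rule Lim_null_comparison)
    have "(\<lambda>n. b (real n) * \<theta> + b (- real n) * \<theta>) \<longlonglongrightarrow> 0 * \<theta> + 0 * \<theta>"
      by (intro tendsto_intros b0)
    thus "(\<lambda>n. b (real n) * \<theta> + b (- real n) * \<theta>) \<longlonglongrightarrow> 0" by simp
    show "\<forall>\<^sub>F n in sequentially. cmod ((LBINT t:{- real n..real n}. \<phi> (Complex t \<theta>)) - (LBINT t:{- real n..real n}. \<phi> (Complex t 0)))
        \<le> b (real n) * \<theta> + b (- real n) * \<theta>"
    proof (rule always_eventually, rule allI)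
      fix n
      have "(LBINT t:{- real n..real n}. \<phi> (Complex t \<theta>)) - (LBINT t:{- real n..real n}. \<phi> (Complex t 0)) =
        (P (Complex (real n) \<theta>) - P (Complex (real n) 0)) - (P (Complex (- real n) \<theta>) - P (Complex (- real n) 0))"
        using c by (simp add: FTC)
      also have "cmod \<dots> \<le> b (real n) * \<theta> + b (- real n) * \<theta>"
        by (rule order_trans[OF norm_triangle_ineq4 add_mono[OF vert vert]])
      finally show "cmod ((LBINT t:{- real n..real n}. \<phi> (Complex t \<theta>)) - (LBINT t:{- real n..real n}. \<phi> (Complex t 0)))
        \<le> b (real n) * \<theta> + b (- real n) * \<theta>" .
    qed
  qed
  moreover have "(\<lambda>n. (LBINT t:{- real n..real n}. \<phi> (Complex t \<theta>)) - (LBINT t:{- real n..real n}. \<phi> (Complex t 0))) \<longlonglongrightarrow>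
      (LBINT t. \<phi> (Complex t \<theta>)) - (LBINT t. \<phi> (Complex t 0))"
    by (intro tendsto_intros LBINT_tendsto_UNIV i0 i1)
  ultimately show ?thesis using LIMSEQ_unique by fastforce
qed

subsection \<open>Gamma averages of the oscillating kernel\<close>

text \<open>Translation by ln k reduces this to k = 1, which is the real Euler integral.\<close>

lemma integrable_exp_minus_exp:
  fixes x k :: real
  assumes "x > 0" "k > 0"
  shows "integrable lborel (\<lambda>t. exp (x * t - k * exp t))"
proof -
  have "integrable lborel (\<lambda>t. cmod (exp (of_real x * of_real t - exp (of_real t))))"
    using Gamma_integral_exp(1)[of "of_real x"] assms by (intro integrable_norm) auto
  moreover have "cmod (exp (of_real x * of_real t - exp (of_real t))) = exp (x * t - exp t)" for t
    by (simp add: exp_of_real)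
  ultimately have "integrable lborel (\<lambda>t. exp (x * t - exp t))" by simp
  from lborel_integrable_real_affine[OF this, of 1 "ln k"]
  have "integrable lborel (\<lambda>t. exp (- (x * ln k)) * exp (x * (ln k + t) - exp (ln k + t)))" by simp
  moreover have "exp (- (x * ln k)) * exp (x * (ln k + t) - exp (ln k + t)) = exp (x * t - k * exp t)" for t
    using assms by (simp add: exp_add[symmetric] algebra_simps) (simp add: exp_add)
  ultimately show ?thesis by simp
qed

lemma norm_exp_minus_exp:
  "cmod (exp (z * of_real t - c * exp (of_real t))) = exp (Re z * t - Re c * exp t)"
  by (simp add: exp_of_real)

text \<open>Put Ln c = a + i \<theta>. Replacing t by t + Ln c amounts to a real translation by
  \<open>a\<close> and a contour shift by \<theta>. Positivity of Re c means \<theta> < \<pi>/2, so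
  that exp(- e^t cos \<tau>) decays on all lines in between; Im c \<ge> 0 fixes the direction of the
  shift.\<close>

lemma Gamma_integral_exp_scaled:
  assumes z: "Re z > 0" and c: "Re c > 0" "Im c \<ge> 0"
  shows "integrable lborel (\<lambda>t. exp (z * of_real t - c * exp (of_real t)))"
    and "(LBINT t. exp (z * of_real t - c * exp (of_real t))) = Gamma z * exp (- z * Ln c)"
proof -
  have c0: "c \<noteq> 0" using c by auto
  define \<theta> where "\<theta> = Im (Ln c)"
  define a where "a = Re (Ln c)"
  have th: "\<theta> \<ge> 0" "\<theta> < pi / 2"
    using c Im_Ln_pos_le[OF c0] Re_Ln_pos_lt[OF c0] Im_Ln_le_pi[OF c0] by (auto simp: \<theta>_def)
  have meas: "(\<lambda>t::real. exp (z * of_real t - c * exp (of_real t))) \<in> borel_measurable borel" for z c :: complex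
    by (intro borel_measurable_continuous_onI continuous_intros)
  have int: "integrable lborel (\<lambda>t. exp (z * of_real t - c * exp (of_real t)))" if "Re c > 0" for c
    by (rule Bochner_Integration.integrable_bound[OF integrable_exp_minus_exp[OF z that]])
      (use meas in \<open>auto simp: exp_of_real\<close>)
  show "integrable lborel (\<lambda>t. exp (z * of_real t - c * exp (of_real t)))" using c(1) by (rule int)
  define \<phi> where "\<phi> w = exp (z * w - exp w)" for w
  define k where "k = cos \<theta>"
  have k: "k > 0" unfolding k_def using th by (intro cos_gt_zero_pi) auto
  have \<phi>eq: "\<phi> (Complex t \<tau>) = exp (z * (\<i> * of_real \<tau>)) * exp (z * of_real t - cis \<tau> * exp (of_real t))" for t \<tau>
  proof -
    have "exp (Complex t \<tau>) = cis \<tau> * exp (of_real t)" by (simp add: exp_eq_polar exp_of_real mult.commute)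
    thus ?thesis unfolding \<phi>_def exp_add[symmetric] by (simp add: Complex_eq algebra_simps)
  qed
  have eq: "(LBINT t. \<phi> (Complex t \<theta>)) = (LBINT t. \<phi> (Complex t 0))"
  proof (rule horizontal_contour_shift)
    show "\<phi> holomorphic_on {w. - 1 < Im w \<and> Im w < pi / 2}"
      unfolding \<phi>_def by (intro holomorphic_intros)
    show "integrable lborel (\<lambda>t. \<phi> (Complex t \<theta>))" "integrable lborel (\<lambda>t. \<phi> (Complex t 0))"
      unfolding \<phi>eq using k by (intro integrable_mult_right int; simp add: k_def)+
    show "cmod (\<phi> (Complex t \<tau>)) \<le> exp (\<bar>Im z\<bar> * \<theta>) * exp (Re z * t - k * exp t)"
      if "0 \<le> \<tau>" "\<tau> \<le> \<theta>" for t \<tau>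
    proof -
      have "- (Im z * \<tau>) \<le> \<bar>Im z\<bar> * \<theta>"
        using that by (metis abs_ge_minus_self abs_mult abs_of_nonneg abs_ge_zero mult_left_mono order_trans)
      moreover have "k \<le> cos \<tau>" unfolding k_def using that th by (intro cos_monotone_0_pi_le) auto
      hence "k * exp t \<le> cos \<tau> * exp t" by (rule mult_right_mono) simp
      ultimately show ?thesis
        unfolding \<phi>eq norm_mult norm_exp_minus_exp unfolding norm_exp_eq_Re
        by (intro mult_mono) auto
    qed
    show "(\<lambda>n. exp (\<bar>Im z\<bar> * \<theta>) * exp (Re z * real n - k * exp (real n))) \<longlonglongrightarrow> 0"
      by (rule tendsto_mult_right_zero) (use z k in real_asymp)
    show "(\<lambda>n. exp (\<bar>Im z\<bar> * \<theta>) * exp (Re z * (- real n) - k * exp (- real n))) \<longlonglongrightarrow> 0"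
      by (rule tendsto_mult_right_zero) (use z k in real_asymp)
  qed (use th in auto)
  have "(LBINT t. \<phi> (Complex t 0)) = Gamma z"
    unfolding \<phi>_def using Gamma_integral_exp(2)[OF z] by (simp add: complex_of_real_def)
  hence "Gamma z = (LBINT t. \<phi> (Complex (a + t) \<theta>))"
    using lborel_integral_real_affine[of 1 "\<lambda>t. \<phi> (Complex t \<theta>)" a] eq by simp
  also have "\<dots> = (LBINT t. exp (z * Ln c) * exp (z * of_real t - c * exp (of_real t)))"
  proof (rule Bochner_Integration.integral_cong[OF refl])
    fix t
    have "Complex (a + t) \<theta> = Ln c + of_real t" by (simp add: complex_eq_iff a_def \<theta>_def)
    moreover have "exp (Ln c + of_real t) = c * exp (of_real t)" using c0 by (simp add: exp_add)
    ultimately show "\<phi> (Complex (a + t) \<theta>) = exp (z * Ln c) * exp (z * of_real t - c * exp (of_real t))"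
      unfolding \<phi>_def exp_add[symmetric] by (simp add: algebra_simps)
  qed
  finally have "Gamma z = exp (z * Ln c) * (LBINT t. exp (z * of_real t - c * exp (of_real t)))" by simp
  thus "(LBINT t. exp (z * of_real t - c * exp (of_real t))) = Gamma z * exp (- z * Ln c)"
    by (simp add: exp_minus field_simps)
qed

lemma Gamma_integral_exp_scaled_nat:
  assumes m: "m > 0" and c: "Re c > 0" "Im c \<ge> 0"
  shows "(LBINT t. exp (of_nat m * of_real t - c * exp (of_real t))) = fact (m - 1) / c ^ m"
proof -
  have "c \<noteq> 0" using c by auto
  hence "exp (- of_nat m * Ln c) = inverse (c ^ m)"
    by (simp add: exp_minus exp_of_nat_mult)
  moreover have "Gamma (of_nat m :: complex) = fact (m - 1)"
    using m Gamma_fact[of "m - 1", where 'a = complex] by (simp add: of_nat_diff)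
  ultimately show ?thesis
    using Gamma_integral_exp_scaled(2)[of "of_nat m" c] m c by (simp add: field_simps)
qed

text \<open>The law of \<open>ln \<lambda>\<close> for a Gamma-distributed \<open>\<lambda>\<close> of shape \<open>m\<close> and mean \<open>1\<close>: it has total mass \<open>1\<close> and
  concentrates at \<open>0\<close> as \<open>m\<close> grows.\<close>

definition gamma_density :: "nat \<Rightarrow> real \<Rightarrow> real" where
  "gamma_density m u = real m ^ m / fact (m - 1) * exp (real m * u - real m * exp u)"

lemma gamma_density_nonneg: "gamma_density m u \<ge> 0"
  by (simp add: gamma_density_def)

lemma gamma_density_measurable [measurable]: "gamma_density m \<in> borel_measurable borel"
  unfolding gamma_density_def by measurable

lemma integrable_gamma_density: "m > 0 \<Longrightarrow> integrable lborel (gamma_density m)"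
  unfolding gamma_density_def by (intro integrable_mult_right integrable_exp_minus_exp) auto

definition osc :: "real \<Rightarrow> complex" where "osc t = cis (- exp t)"

definition osc_approx :: "nat \<Rightarrow> real \<Rightarrow> complex" where
  "osc_approx m t = 1 / (1 + \<i> * of_real (exp t / m)) ^ m"

text \<open>The oscillation joins the exponent of the Gamma density: - m e^u - i e^(t + u) = - c e^u
  with c = m + i e^t. The average is thus a Gamma integral with complex scale and evaluates to (m /
  c)^m.\<close>

lemma gamma_density_osc:
  assumes "m > 0"
  shows "(LBINT u. of_real (gamma_density m u) * osc (t + u)) = osc_approx m t"
proof -
  define c where "c = of_nat m + \<i> * of_real (exp t)"
  have "of_real (gamma_density m u) * osc (t + u) =
      of_real (real m ^ m / fact (m - 1)) * exp (of_nat m * of_real u - c * exp (of_real u))" for u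
  proof -
    have "of_real (gamma_density m u) * osc (t + u) =
        of_real (real m ^ m / fact (m - 1)) * (of_real (exp (real m * u - real m * exp u)) * cis (- exp (t + u)))"
      by (simp add: gamma_density_def osc_def)
    also have "of_real (exp (real m * u - real m * exp u)) * cis (- exp (t + u)) =
        exp (of_nat m * of_real u - c * exp (of_real u))"
      unfolding cis_conv_exp exp_of_real[symmetric] exp_add[symmetric]
      by (rule arg_cong[where f = exp]) (simp add: c_def algebra_simps exp_add exp_of_real)
    finally show ?thesis .
  qed
  hence "(LBINT u. of_real (gamma_density m u) * osc (t + u)) =
      of_real (real m ^ m / fact (m - 1)) * (fact (m - 1) / c ^ m)"
    using Gamma_integral_exp_scaled_nat[OF assms, of c] assms by (simp add: c_def)
  also have "\<dots> = (of_nat m / c) ^ m" by (simp add: power_divide)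
  also have "of_nat m / c = 1 / (1 + \<i> * of_real (exp t / m))"
  proof -
    have "c = of_nat m * (1 + \<i> * of_real (exp t / m))" using assms by (simp add: c_def field_simps)
    thus ?thesis using assms by simp
  qed
  finally show ?thesis by (simp add: osc_approx_def power_divide)
qed

lemma gamma_density_integral: "m > 0 \<Longrightarrow> (LBINT u. gamma_density m u) = 1"
proof -
  assume m: "m > 0"
  have "of_real (gamma_density m u) =
      of_real (real m ^ m / fact (m - 1)) * exp (of_nat m * of_real u - of_nat m * exp (complex_of_real u))" for u
    by (simp add: gamma_density_def exp_of_real exp_diff exp_of_real[symmetric] del: exp_of_real)
  hence "(LBINT u. complex_of_real (gamma_density m u)) =
      of_real (real m ^ m / fact (m - 1)) * (fact (m - 1) / of_nat m ^ m)"
    using Gamma_integral_exp_scaled_nat[OF m, of "of_nat m"] m by simp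
  also have "\<dots> = 1" using m by simp
  finally have "complex_of_real (LBINT u. gamma_density m u) = 1" by simp
  thus ?thesis by (metis of_real_eq_1_iff)
qed

lemma norm_one_plus_i: "cmod (1 + \<i> * of_real x) = sqrt (1 + x\<^sup>2)"
  by (simp add: cmod_def)

lemma one_plus_i_nonzero: "1 + \<i> * complex_of_real x \<noteq> 0"
  by (simp add: complex_eq_iff)

lemma norm_osc_approx_le: "cmod (osc_approx m t) \<le> 1"
proof -
  have "1 \<le> sqrt (1 + (exp t / m)\<^sup>2)" by simp
  hence "1 \<le> sqrt (1 + (exp t / m)\<^sup>2) ^ m" by (rule one_le_power)
  moreover from this have "0 < sqrt (1 + (exp t / m)\<^sup>2) ^ m" by linarith
  ultimately show ?thesis unfolding osc_approx_def norm_divide norm_power norm_one_plus_i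
    by (simp add: divide_le_eq_1_pos del: zero_less_power_eq)
qed

text \<open>With y = e^t / m both sides are m-th powers, of 1 / (1 + i y) and of e^(- i y). These
  bases have modulus at most 1 and differ by at most y^2 / 2, so the powers differ by at most m y^2
  / 2, which is of order 1/m.\<close>

lemma osc_approx_tendsto: "(\<lambda>m. osc_approx m t) \<longlonglongrightarrow> osc t"
proof -
  have "(\<lambda>m. osc_approx m t - osc t) \<longlonglongrightarrow> 0"
  proof (rule Lim_null_comparison)
    show "(\<lambda>m. real m * ((exp t / real m)\<^sup>2 / 2)) \<longlonglongrightarrow> 0" by real_asymp
    show "\<forall>\<^sub>F m in sequentially. cmod (osc_approx m t - osc t) \<le> real m * ((exp t / real m)\<^sup>2 / 2)"
      using eventually_gt_at_top[of 0]
    proof eventually_elim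
      fix m :: nat assume m: "0 < m"
      define y where "y = exp t / real m"
      have nz: "1 + \<i> * of_real y \<noteq> 0" by (rule one_plus_i_nonzero)
      have n1: "cmod (1 + \<i> * of_real y) \<ge> 1" unfolding norm_one_plus_i by simp
      have "osc t = cis (- y) ^ m" unfolding Complex.DeMoivre osc_def y_def using m by simp
      moreover have "osc_approx m t = (1 / (1 + \<i> * of_real y)) ^ m"
        by (simp add: osc_approx_def y_def power_divide)
      moreover have "cmod (1 / (1 + \<i> * of_real y)) \<le> 1"
        using n1 by (simp add: norm_divide divide_le_eq_1)
      moreover have "cmod (1 / (1 + \<i> * of_real y) - cis (- y)) \<le> y\<^sup>2 / 2"
      proof -
        have "1 / (1 + \<i> * of_real y) - cis (- y) = cis (- y) * (cis y - (1 + \<i> * of_real y)) / (1 + \<i> * of_real y)"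
          using nz by (simp add: field_simps cis_mult)
        also have "cmod \<dots> = cmod (cis y - (1 + \<i> * of_real y)) / cmod (1 + \<i> * of_real y)"
          by (simp add: norm_mult norm_divide)
        also have "\<dots> \<le> cmod (cis y - (1 + \<i> * of_real y)) / 1"
          using n1 by (intro divide_left_mono) auto
        also have "\<dots> \<le> y\<^sup>2 / 2"
          using iexp_approx1[of y 1] by (simp add: cis_conv_exp numeral_2_eq_2)
        finally show ?thesis .
      qed
      ultimately have "cmod (osc_approx m t - osc t) \<le> real m * cmod (1 / (1 + \<i> * of_real y) - cis (- y))"
        by (auto intro!: norm_power_diff)
      also have "\<dots> \<le> real m * (y\<^sup>2 / 2)"
        by (rule mult_left_mono) (use \<open>cmod (1 / (1 + \<i> * of_real y) - cis (- y)) \<le> y\<^sup>2 / 2\<close> in auto)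
      finally show "cmod (osc_approx m t - osc t) \<le> real m * ((exp t / real m)\<^sup>2 / 2)"
        by (simp add: y_def)
    qed
  qed
  thus ?thesis by (simp add: LIM_zero_iff)
qed

section \<open>The derivative of the averaged kernel and its Fourier transform\<close>

definition osc_kernel :: "nat \<Rightarrow> real \<Rightarrow> complex" where
  "osc_kernel m t = - \<i> * of_real (exp t) / (1 + \<i> * of_real (exp t / m)) ^ (m + 1)"

text \<open>In Fourier space the derivative takes the place of \<open>osc_approx m\<close>: the
  latter tends to 1 at minus infinity and is not integrable, while its derivative decays
  exponentially at both ends. The extra factor i p is removed again by
  \<open>plancherel_primitive\<close>.\<close>

lemma osc_approx_has_vector_derivative:
  assumes "m > 0"
  shows "(osc_approx m has_vector_derivative osc_kernel m t) (at t)"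
proof -
  have nz: "1 + \<i> * exp (of_real t) / of_nat m \<noteq> 0"
    using one_plus_i_nonzero[of "exp t / m"] by (simp add: exp_of_real)
  have "((\<lambda>w. inverse ((1 + \<i> * exp w / of_nat m) ^ m)) has_field_derivative
      - (\<i> * exp (of_real t) / (1 + \<i> * exp (of_real t) / of_nat m) ^ (m + 1))) (at (of_real t))"
  proof -
    obtain n where n: "m = Suc n" using assms by (cases m) auto
    define D where "D = 1 + \<i> * exp (complex_of_real t) / of_nat m"
    have D: "D \<noteq> 0" using nz by (simp add: D_def)
    have "((\<lambda>w. 1 + \<i> * exp w / of_nat m) has_field_derivative \<i> * exp (of_real t) / of_nat m) (at (of_real t))"
      using assms by (auto intro!: derivative_eq_intros)
    from DERIV_inverse'[OF DERIV_power[OF this, of m]] D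
    have "((\<lambda>w. inverse ((1 + \<i> * exp w / of_nat m) ^ m)) has_field_derivative
      - (inverse (D ^ m) * (of_nat m * (\<i> * exp (of_real t) / of_nat m * D ^ (m - Suc 0))) * inverse (D ^ m))) (at (of_real t))"
      unfolding D_def by simp
    also have "of_nat m * (\<i> * exp (of_real t) / of_nat m * D ^ (m - Suc 0)) = \<i> * exp (of_real t) * D ^ n"
      unfolding n by (simp del: of_nat_Suc)
    also have "- (inverse (D ^ m) * (\<i> * exp (of_real t) * D ^ n) * inverse (D ^ m)) = - (\<i> * exp (of_real t) / D ^ (m + 1))"
      unfolding n using D by (simp add: field_simps)
    finally show ?thesis unfolding D_def .
  qed
  hence "((\<lambda>t. inverse ((1 + \<i> * exp (of_real t) / of_nat m) ^ m)) has_vector_derivative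
      - (\<i> * exp (of_real t) / (1 + \<i> * exp (of_real t) / of_nat m) ^ (m + 1))) (at t)"
    by (rule has_vector_derivative_real_field)
  thus ?thesis by (simp add: osc_approx_def[abs_def] osc_kernel_def exp_of_real divide_inverse mult.assoc)
qed

lemma integrable_exp_minus_abs: "integrable lborel (\<lambda>t::real. exp (- \<bar>t\<bar>))"
proof (rule Bochner_Integration.integrable_bound)
  have i: "integrable lborel (\<lambda>t. cmod (exp_kernel 1 t))"
    using integrable_exp_kernel[of 1] by simp
  from lborel_integrable_real_affine[OF this, of "-1" 0]
  have j: "integrable lborel (\<lambda>t. cmod (exp_kernel 1 (- t)))" by simp
  from Bochner_Integration.integrable_add[OF i j]
  show "integrable lborel (\<lambda>t. cmod (exp_kernel 1 t) + cmod (exp_kernel 1 (- t)))" .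
  show "AE t in lborel. norm (exp (- \<bar>t\<bar>)) \<le> norm (cmod (exp_kernel 1 t) + cmod (exp_kernel 1 (- t)))"
    by (rule AE_I2) (auto simp: exp_kernel_def split: split_indicator)
qed simp

text \<open>|1 + x e^(i \<tau>)|^2 = 1 + 2 x cos \<tau> + x^2 is at least 1 and at least x^2, since
  cos \<tau> \<ge> 0, and two of the m + 1 factors suffice for decay at both ends. The bound is
  uniform in the angle because it has to serve on all lines of a contour shift between \<tau> =
  \<pi>/2, where it concerns \<open>osc_kernel\<close>, and \<tau> = 0.\<close>

lemma kernel_bound:
  fixes t \<tau> :: real
  assumes m: "m > 0" and \<tau>: "0 \<le> \<tau>" "\<tau> \<le> pi / 2"
  shows "exp t / cmod (1 + of_real (exp t / real m) * cis \<tau>) ^ (m + 1) \<le> (real m)\<^sup>2 * exp (- \<bar>t\<bar>)"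
proof -
  define x where "x = exp t / real m"
  have x: "x > 0" using m by (simp add: x_def)
  define D where "D = cmod (1 + of_real x * cis \<tau>)"
  have c: "cos \<tau> \<ge> 0" using \<tau> by (intro cos_ge_zero) auto
  have "D\<^sup>2 = (1 + x * cos \<tau>)\<^sup>2 + (x * sin \<tau>)\<^sup>2" unfolding D_def cmod_power2 by simp
  also have "\<dots> = 1 + 2 * (x * cos \<tau>) + x\<^sup>2 * ((sin \<tau>)\<^sup>2 + (cos \<tau>)\<^sup>2)"
    by (simp only: power2_eq_square algebra_simps)
  finally have D2: "D\<^sup>2 = 1 + 2 * (x * cos \<tau>) + x\<^sup>2" by simp
  have xc: "x * cos \<tau> \<ge> 0" using x c by simp
  have D1: "D \<ge> 1" by (rule power2_le_imp_le) (use D2 xc in \<open>auto simp: D_def\<close>)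
  have "D\<^sup>2 \<le> D ^ (m + 1)" using D1 m by (intro power_increasing) auto
  hence "exp t / D ^ (m + 1) \<le> exp t / D\<^sup>2"
    using D1 by (intro divide_left_mono) auto
  also have "\<dots> \<le> (real m)\<^sup>2 * exp (- \<bar>t\<bar>)"
  proof (cases "t \<ge> 0")
    case True
    have "0 < D\<^sup>2 * x\<^sup>2" using D1 x by simp
    moreover have "x\<^sup>2 \<le> D\<^sup>2" using D2 xc by simp
    ultimately have "exp t / D\<^sup>2 \<le> exp t / x\<^sup>2" by (intro divide_left_mono) auto
    also have "\<dots> = (real m)\<^sup>2 * exp (- \<bar>t\<bar>)"
      using True m by (simp add: x_def power2_eq_square exp_minus field_simps)
    finally show ?thesis .
  next
    case False
    have "1 \<le> (real m)\<^sup>2" using m by simp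
    hence *: "exp t \<le> (real m)\<^sup>2 * exp t" by simp
    have "exp t / D\<^sup>2 \<le> exp t / 1" using D1 by (intro divide_left_mono) auto
    also have "\<dots> \<le> (real m)\<^sup>2 * exp t" using * by simp
    finally show ?thesis using False by simp
  qed
  finally show ?thesis unfolding D_def x_def .
qed

lemma osc_kernel_bound:
  assumes "m > 0"
  shows "cmod (osc_kernel m t) \<le> (real m)\<^sup>2 * exp (- \<bar>t\<bar>)"
proof -
  have "cmod (osc_kernel m t) = exp t / cmod (1 + of_real (exp t / real m) * cis (pi / 2)) ^ (m + 1)"
    unfolding osc_kernel_def norm_divide norm_power norm_mult by (simp add: mult.commute)
  thus ?thesis using kernel_bound[OF assms, of "pi / 2" t] by simp
qed

lemma continuous_osc_kernel:
  assumes "m > 0"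
  shows "continuous_on UNIV (osc_kernel m)"
  unfolding osc_kernel_def[abs_def] using one_plus_i_nonzero assms
  by (intro continuous_intros) (auto simp: divide_eq_0_iff simp del: of_real_divide)

lemma osc_kernel_measurable [measurable]: "osc_kernel m \<in> borel_measurable borel"
  unfolding osc_kernel_def by measurable

lemma integrable_osc_kernel:
  assumes "m > 0"
  shows "integrable lborel (osc_kernel m)"
  by (rule Bochner_Integration.integrable_bound[where f = "\<lambda>t. (real m)\<^sup>2 * exp (- \<bar>t\<bar>)"])
    (use osc_kernel_bound[OF assms] integrable_exp_minus_abs in auto)

text \<open>At a zero e^w would be negative, so that Im w would be an odd multiple of \<pi>. This
  keeps the poles out of the strip of the contour shift below.\<close>

lemma one_plus_exp_nonzero:
  assumes "\<bar>Im w\<bar> < pi" "m > 0"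
  shows "1 + exp w / of_nat m \<noteq> 0"
proof
  assume "1 + exp w / of_nat m = 0"
  hence e: "exp w = - of_real (real m)" using assms(2) by (simp add: field_simps add_eq_0_iff2)
  hence "Im (exp w) = 0" "Re (exp w) < 0" using assms(2) by auto
  hence "sin (Im w) = 0" "exp (Re w) * cos (Im w) < 0" by (auto simp: Re_exp Im_exp)
  moreover from this(1) have "Im w = 0" using assms(1) sin_zero_pi_iff by blast
  ultimately show False by simp
qed

text \<open>\<open>osc_kernel m t\<close> is minus the continuation of this function to t + i
  \<pi>/2. For m = 1 it is the logistic density; in general it is a multiple of the density of the
  difference of the logarithms of two independent Gamma variables, which is why its transform
  factors into Gamma functions.\<close>

definition logistic_kernel :: "nat \<Rightarrow> real \<Rightarrow> complex" where
  "logistic_kernel m t = of_real (exp t / (1 + exp t / real m) ^ (m + 1))"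

text \<open>Lowering the contour from height \<pi>/2 to the real axis turns i e^t into e^t. The
  prefactor has modulus e^(- \<pi> p / 2); it breaks the symmetry between p and - p.\<close>

lemma fourier_osc_kernel_shift:
  assumes m: "m > 0"
  shows "fourier (osc_kernel m) p = - \<i> * exp (- (Complex 1 (- p) * (\<i> * of_real (pi / 2)))) * fourier (logistic_kernel m) p"
proof -
  define z where "z = Complex 1 (- p)"
  define \<phi> where "\<phi> w = exp (z * w) / (1 + exp w / of_nat m) ^ (m + 1)" for w
  have e: "exp (Complex t \<tau>) = of_real (exp t) * cis \<tau>" for t \<tau> by (simp add: exp_eq_polar)
  have zt: "cis (- (p * t)) * of_real (exp t) = exp (z * of_real t)" for t
  proof -
    have "z * of_real t = Complex t (- (p * t))" by (simp add: z_def complex_eq_iff)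
    thus ?thesis by (simp add: e mult.commute)
  qed
  have nphi: "cmod (\<phi> (Complex t \<tau>)) = exp (p * \<tau>) * (exp t / cmod (1 + of_real (exp t / real m) * cis \<tau>) ^ (m + 1))" for t \<tau>
  proof -
    have "Re (z * Complex t \<tau>) = t + p * \<tau>" by (simp add: z_def)
    hence "cmod (exp (z * Complex t \<tau>)) = exp (p * \<tau>) * exp t" by (simp add: exp_add)
    thus ?thesis unfolding \<phi>_def norm_divide norm_power e by simp
  qed
  have b: "cmod (\<phi> (Complex t \<tau>)) \<le> exp (\<bar>p\<bar> * (pi / 2)) * ((real m)\<^sup>2 * exp (- \<bar>t\<bar>))"
    if "0 \<le> \<tau>" "\<tau> \<le> pi / 2" for t \<tau>
  proof -
    have "p * \<tau> \<le> \<bar>p\<bar> * (pi / 2)" using that by (intro mult_mono) auto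
    thus ?thesis unfolding nphi using kernel_bound[OF m that, of t] by (intro mult_mono) auto
  qed
  \<comment> \<open>Height 2 lies above \<pi>/2 and below the first poles, which have height
    \<pi>.\<close>
  have cont: "continuous_on {w. - 1 < Im w \<and> Im w < 2} \<phi>" and hol: "\<phi> holomorphic_on {w. - 1 < Im w \<and> Im w < 2}"
  proof -
    have "1 + exp w / of_nat m \<noteq> 0" if "- 1 < Im w" "Im w < 2" for w
      by (rule one_plus_exp_nonzero[OF _ m]) (use that pi_gt3 in auto)
    thus "\<phi> holomorphic_on {w. - 1 < Im w \<and> Im w < 2}"
      unfolding \<phi>_def using m by (intro holomorphic_intros) auto
    thus "continuous_on {w. - 1 < Im w \<and> Im w < 2} \<phi>" by (rule holomorphic_on_imp_continuous_on)
  qed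
  have int: "integrable lborel (\<lambda>t. \<phi> (Complex t \<tau>))" if \<tau>: "0 \<le> \<tau>" "\<tau> \<le> pi / 2" for \<tau>
  proof (rule Bochner_Integration.integrable_bound)
    show "integrable lborel (\<lambda>t. exp (\<bar>p\<bar> * (pi / 2)) * ((real m)\<^sup>2 * exp (- \<bar>t\<bar>)))"
      using integrable_exp_minus_abs by simp
    have "continuous_on UNIV (\<lambda>t. \<phi> (Complex t \<tau>))"
      by (rule continuous_on_compose2[OF cont])
        (use \<tau> pi_less_4 in \<open>auto simp: Complex_eq intro!: continuous_intros\<close>)
    thus "(\<lambda>t. \<phi> (Complex t \<tau>)) \<in> borel_measurable lborel"
      by (simp add: borel_measurable_continuous_onI)
  qed (use b[OF \<tau>] in auto)
  have "(LBINT t. \<phi> (Complex t (pi / 2))) = (LBINT t. \<phi> (Complex t 0))"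
  proof (rule horizontal_contour_shift[OF hol _ _ _ b])
    show "(\<lambda>n. exp (\<bar>p\<bar> * (pi / 2)) * ((real m)\<^sup>2 * exp (- \<bar>real n\<bar>))) \<longlonglongrightarrow> 0"
      by (intro tendsto_mult_right_zero) real_asymp
    show "(\<lambda>n. exp (\<bar>p\<bar> * (pi / 2)) * ((real m)\<^sup>2 * exp (- \<bar>- real n\<bar>))) \<longlonglongrightarrow> 0"
      by (intro tendsto_mult_right_zero) real_asymp
  qed (use int pi_less_4 in auto)
  moreover have "\<phi> (Complex t 0) = cis (- (p * t)) * logistic_kernel m t" for t
    unfolding \<phi>_def logistic_kernel_def of_real_divide mult.assoc[symmetric] times_divide_eq_right zt
    by (simp add: e exp_of_real complex_of_real_def[symmetric])
  moreover have "\<phi> (Complex t (pi / 2)) = \<i> * exp (z * (\<i> * of_real (pi / 2))) * (cis (- (p * t)) * osc_kernel m t)" for t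
  proof -
    have "exp (z * Complex t (pi / 2)) = exp (z * (\<i> * of_real (pi / 2))) * exp (z * of_real t)"
      unfolding exp_add[symmetric] by (simp add: Complex_eq algebra_simps)
    hence "\<phi> (Complex t (pi / 2)) = exp (z * (\<i> * of_real (pi / 2))) * (cis (- (p * t)) * of_real (exp t)) /
        (1 + \<i> * of_real (exp t / real m)) ^ (m + 1)"
      unfolding \<phi>_def zt by (simp add: e mult.commute)
    thus ?thesis unfolding osc_kernel_def by (simp add: algebra_simps)
  qed
  ultimately have "\<i> * exp (z * (\<i> * of_real (pi / 2))) * fourier (osc_kernel m) p = fourier (logistic_kernel m) p"
    unfolding fourier_def by simp
  hence "- \<i> * exp (- (z * (\<i> * of_real (pi / 2)))) * fourier (logistic_kernel m) p =
    - \<i> * exp (- (z * (\<i> * of_real (pi / 2)))) * (\<i> * exp (z * (\<i> * of_real (pi / 2))) * fourier (osc_kernel m) p)"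
    by simp
  also have "- \<i> * exp (- w) * (\<i> * exp w * F) = F" for w F :: complex
    by (simp add: exp_minus field_simps)
  finally show ?thesis unfolding z_def by simp
qed

text \<open>Up to a constant the kernel is the convolution of \<open>A\<close>, Euler's integrand at
  exponent 1, with \<open>B\<close>, the reflected integrand at exponent \<open>m\<close>, and the
  transform of each is given by a Gamma function. Only moduli are recorded, which discards the phase
  m^(- i p).\<close>

lemma fourier_logistic_kernel:
  assumes m: "m > 0"
  shows "cmod (fourier (logistic_kernel m) p) =
    cmod (Gamma (Complex 1 (- p))) * cmod (Gamma (Complex m p)) / fact (m - 1)"
proof -
  define A where "A t = exp (1 * complex_of_real t - exp (of_real t))" for t
  define B where "B t = exp (of_nat m * complex_of_real (- t) - of_nat m * exp (of_real (- t)))" for t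
  have A: "integrable lborel A" unfolding A_def by (rule Gamma_integral_exp(1)) simp
  have B0: "integrable lborel (\<lambda>t. exp (of_nat m * complex_of_real t - of_nat m * exp (of_real t)))"
    by (rule Gamma_integral_exp_scaled(1)) (use m in auto)
  have B: "integrable lborel B"
    using lborel_integrable_real_affine[OF B0, of "-1" 0] by (simp add: B_def[abs_def])
  have fA: "fourier A p = Gamma (Complex 1 (- p))"
  proof -
    have "cis (- (p * t)) * A t = exp (Complex 1 (- p) * of_real t - exp (of_real t))" for t
      unfolding A_def cis_conv_exp exp_add[symmetric] by (simp add: Complex_eq algebra_simps)
    thus ?thesis unfolding fourier_def by (simp add: Gamma_integral_exp(2))
  qed
  have fB: "fourier B p = Gamma (Complex m p) * exp (- Complex m p * Ln (of_nat m))"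
  proof -
    have "fourier B p = (LBINT t. cis (p * t) * B (- t))"
      unfolding fourier_def
      using lborel_integral_real_affine[of "-1" "\<lambda>y. cis (- (p * y)) * B y" 0] by simp
    also have "\<dots> = (LBINT t. exp (Complex m p * of_real t - of_nat m * exp (of_real t)))"
      unfolding B_def cis_conv_exp exp_add[symmetric] by (simp add: Complex_eq algebra_simps)
    also have "\<dots> = Gamma (Complex m p) * exp (- Complex m p * Ln (of_nat m))"
      by (rule Gamma_integral_exp_scaled(2)) (use m in auto)
    finally show ?thesis .
  qed
  have conv: "convol A B = (\<lambda>s. of_real (fact m / real m ^ (m + 1)) * logistic_kernel m s)"
  proof
    fix s
    have "convol A B s = (LBINT y. A (s + y) * B (- y))"
      unfolding convol_def
      using lborel_integral_real_affine[of "-1" "\<lambda>y. A (s - y) * B y" 0] by simp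
    also have "\<dots> = (LBINT y. of_real (exp s) * exp (of_nat (m + 1) * of_real y - of_real (real m + exp s) * exp (of_real y)))"
    proof (rule Bochner_Integration.integral_cong[OF refl])
      fix y
      show "A (s + y) * B (- y) = of_real (exp s) * exp (of_nat (m + 1) * of_real y - of_real (real m + exp s) * exp (of_real y))"
        unfolding A_def B_def exp_of_real[symmetric] exp_add[symmetric]
        by (rule arg_cong[where f = exp]) (simp add: algebra_simps exp_add exp_of_real)
    qed
    also have "\<dots> = of_real (exp s) * (fact m / (of_real (real m + exp s)) ^ (m + 1))"
      using Gamma_integral_exp_scaled_nat[of "m + 1" "of_real (real m + exp s)"]
      by (simp add: add_pos_pos m)
    also have "\<dots> = of_real (fact m / real m ^ (m + 1)) * logistic_kernel m s"
    proof -
      have "real m + exp s = real m * (1 + exp s / real m)" using m by (simp add: field_simps)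
      hence *: "(real m + exp s) ^ (m + 1) = real m ^ (m + 1) * (1 + exp s / real m) ^ (m + 1)"
        by (simp only: power_mult_distrib)
      have "of_real (exp s) * (fact m / (of_real (real m + exp s)) ^ (m + 1)) =
          complex_of_real (exp s * (fact m / (real m + exp s) ^ (m + 1)))" by simp
      also have "exp s * (fact m / (real m + exp s) ^ (m + 1)) =
          fact m / real m ^ (m + 1) * (exp s / (1 + exp s / real m) ^ (m + 1))"
        unfolding * by simp
      finally show ?thesis unfolding logistic_kernel_def by simp
    qed
    finally show "convol A B s = of_real (fact m / real m ^ (m + 1)) * logistic_kernel m s" .
  qed
  have "of_real (fact m / real m ^ (m + 1)) * fourier (logistic_kernel m) p = fourier (convol A B) p"
    unfolding conv fourier_def by (simp add: mult.left_commute)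
  also have "\<dots> = Gamma (Complex 1 (- p)) * (Gamma (Complex m p) * exp (- Complex m p * Ln (of_nat m)))"
    unfolding fourier_convol[OF A B] fA fB ..
  finally have "cmod (of_real (fact m / real m ^ (m + 1)) * fourier (logistic_kernel m) p) =
    cmod (Gamma (Complex 1 (- p))) * (cmod (Gamma (Complex m p)) * cmod (exp (- Complex m p * Ln (of_nat m))))"
    by (simp add: norm_mult)
  moreover have "cmod (exp (- Complex m p * Ln (of_nat m))) = 1 / real m ^ m"
  proof -
    have "Ln (of_nat m) = of_real (ln (real m))" using m Ln_of_real[of "real m"] by simp
    hence "Re (- Complex m p * Ln (of_nat m)) = - (real m * ln (real m))" by simp
    moreover have "exp (real m * ln (real m)) = real m ^ m" using m by (simp add: exp_of_nat_mult)
    ultimately show ?thesis by (simp only: norm_exp_eq_Re exp_minus inverse_eq_divide)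
  qed
  ultimately have *: "fact m / real m ^ (m + 1) * cmod (fourier (logistic_kernel m) p) =
    cmod (Gamma (Complex 1 (- p))) * cmod (Gamma (Complex m p)) / real m ^ m"
    by (simp add: norm_mult norm_divide norm_power)
  have "fact m = real m * fact (m - 1)" using m fact_reduce[of m] by simp
  thus ?thesis using * m by (simp add: field_simps)
qed

section \<open>Monotonicity and limit of the Gamma quotients\<close>

definition gamma_ratio :: "nat \<Rightarrow> real \<Rightarrow> real" where
  "gamma_ratio m p = cmod (Gamma (Complex 1 (- p))) * cmod (Gamma (Complex m p)) / fact (m - 1)"

lemma norm_fourier_osc_kernel:
  assumes "m > 0"
  shows "cmod (fourier (osc_kernel m) p) = exp (- (pi * p / 2)) * gamma_ratio m p"
  unfolding fourier_osc_kernel_shift[OF assms] norm_mult fourier_logistic_kernel[OF assms] gamma_ratio_def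
  by (simp add: mult.commute)

lemma gamma_ratio_nonneg: "gamma_ratio m p \<ge> 0"
  by (simp add: gamma_ratio_def)

lemma gamma_ratio_Suc:
  assumes "m > 0"
  shows "gamma_ratio (Suc m) p = gamma_ratio m p * (cmod (Complex m p) / m)"
proof -
  have "Complex m p \<notin> \<int>\<^sub>\<le>\<^sub>0"
  proof
    assume "Complex m p \<in> \<int>\<^sub>\<le>\<^sub>0"
    then obtain n where "Complex m p = - of_nat n" by (elim nonpos_Ints_cases')
    thus False using assms by (auto simp: complex_eq_iff)
  qed
  hence "Gamma (Complex m p + 1) = Complex m p * Gamma (Complex m p)" by (rule Gamma_plus1)
  moreover have "Complex m p + 1 = Complex (Suc m) p" by (simp add: complex_eq_iff)
  moreover have "fact m = real m * fact (m - 1)" using assms fact_reduce[of m] by simp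
  ultimately show ?thesis by (simp add: gamma_ratio_def norm_mult mult_ac)
qed

text \<open>Each step multiplies by |m + i p| / m \<ge> 1. This is what makes monotone convergence
  available on the momentum side.\<close>

lemma gamma_ratio_mono: "m > 0 \<Longrightarrow> gamma_ratio m p \<le> gamma_ratio (Suc m) p"
proof -
  assume m: "m > 0"
  have "real m \<le> cmod (Complex m p)" using abs_Re_le_cmod[of "Complex m p"] by simp
  hence "gamma_ratio m p * 1 \<le> gamma_ratio m p * (cmod (Complex m p) / m)"
    using m gamma_ratio_nonneg by (intro mult_left_mono) auto
  thus ?thesis using gamma_ratio_Suc[OF m] by simp
qed

lemma gamma_ratio_prod:
  "(gamma_ratio (Suc n) p)\<^sup>2 = (gamma_ratio 1 p)\<^sup>2 * (\<Prod>k=1..n. 1 + p\<^sup>2 / (real k)\<^sup>2)"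
proof (induction n)
  case (Suc n)
  have "(cmod (Complex (Suc n) p) / Suc n)\<^sup>2 = 1 + p\<^sup>2 / (real (Suc n))\<^sup>2"
    by (simp add: cmod_power2 power_divide add_divide_distrib del: of_nat_Suc)
  thus ?case unfolding gamma_ratio_Suc[OF zero_less_Suc] power_mult_distrib Suc
    by (simp add: mult.assoc)
qed simp

text \<open>For m = 1 the reflection formula gives \<pi> p / sinh(\<pi> p), and the product in
  \<open>gamma_ratio_prod\<close> is Euler's product, with limit sinh(\<pi> p) / (\<pi> p). The
  square thus tends to \<pi> p / sinh(\<pi> p), and the factor e^(- \<pi> p) completes the Planck
  denominator.\<close>

lemma gamma_ratio_tendsto:
  assumes p: "p > 0"
  shows "(\<lambda>n. exp (- (pi * p)) * (gamma_ratio (Suc n) p)\<^sup>2) \<longlonglongrightarrow> 2 * pi * p / (exp (2 * pi * p) - 1)"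
proof -
  \<comment> \<open>The value sinh(\<pi> p), which appears as the sine at the imaginary point i
    \<pi> p.\<close>
  define S where "S = (exp (pi * p) - exp (- (pi * p))) / 2"
  have S: "S > 0" using p by (simp add: S_def)
  have sin: "sin (of_real pi * (\<i> * of_real p)) = \<i> * of_real S"
  proof -
    have "sin (\<i> * of_real (pi * p)) = \<i> * ((exp (of_real (pi * p)) - inverse (exp (of_real (pi * p)))) / 2)"
      by (rule sin_i_times)
    also have "\<dots> = \<i> * of_real S" by (simp only: S_def exp_of_real of_real_divide of_real_diff exp_minus of_real_inverse of_real_numeral)
    finally show ?thesis by (simp add: mult_ac)
  qed
  have g1: "gamma_ratio 1 p = pi * p / S"
  proof -
    have ip: "\<i> * of_real p \<notin> \<int>\<^sub>\<le>\<^sub>0"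
      using p by (auto elim!: nonpos_Ints_cases' simp: complex_eq_iff)
    have "Gamma (Complex 1 p) = \<i> * of_real p * Gamma (\<i> * of_real p)"
      using Gamma_plus1[OF ip] by (simp add: Complex_eq add.commute)
    moreover have "Gamma (\<i> * of_real p) * Gamma (Complex 1 (- p)) = of_real pi / (\<i> * of_real S)"
      using Gamma_reflection_complex[of "\<i> * of_real p"] unfolding sin by (simp add: Complex_eq)
    ultimately have "Gamma (Complex 1 (- p)) * Gamma (Complex 1 p) = \<i> * of_real p * (of_real pi / (\<i> * of_real S))"
      by (metis mult.assoc mult.commute)
    hence "cmod (Gamma (Complex 1 (- p)) * Gamma (Complex 1 p)) = p * (pi / S)"
      using p S by (simp add: norm_mult norm_divide)
    thus ?thesis by (simp add: gamma_ratio_def norm_mult)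
  qed
  have "(\<lambda>n. cmod (of_real pi * (\<i> * of_real p) * (\<Prod>k=1..n. 1 - (\<i> * of_real p)\<^sup>2 / of_nat k ^ 2))) \<longlonglongrightarrow> cmod (\<i> * of_real S)"
    unfolding sin[symmetric] by (intro tendsto_norm sin_product_formula_complex)
  moreover have "cmod (of_real pi * (\<i> * of_real p) * (\<Prod>k=1..n. 1 - (\<i> * of_real p)\<^sup>2 / of_nat k ^ 2)) =
     pi * p * (\<Prod>k=1..n. 1 + p\<^sup>2 / (real k)\<^sup>2)" for n
  proof -
    have "(\<Prod>k=1..n. 1 - (\<i> * complex_of_real p)\<^sup>2 / of_nat k ^ 2) = of_real (\<Prod>k=1..n. 1 + p\<^sup>2 / (real k)\<^sup>2)"
      by (simp add: power_mult_distrib)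
    moreover have "(\<Prod>k=1..n. 1 + p\<^sup>2 / (real k)\<^sup>2) \<ge> 0" by (intro prod_nonneg) auto
    ultimately show ?thesis using p by (simp add: norm_mult del: of_real_prod)
  qed
  ultimately have "(\<lambda>n. pi * p * (\<Prod>k=1..n. 1 + p\<^sup>2 / (real k)\<^sup>2)) \<longlonglongrightarrow> cmod (\<i> * of_real S)"
    by (simp only:)
  hence "(\<lambda>n. pi * p * (\<Prod>k=1..n. 1 + p\<^sup>2 / (real k)\<^sup>2)) \<longlonglongrightarrow> S"
    using S by (simp add: norm_mult)
  hence "(\<lambda>n. exp (- (pi * p)) * (pi * p / S\<^sup>2) * (pi * p * (\<Prod>k=1..n. 1 + p\<^sup>2 / (real k)\<^sup>2))) \<longlonglongrightarrow> exp (- (pi * p)) * (pi * p / S\<^sup>2) * S"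
    by (intro tendsto_intros)
  moreover have "exp (- (pi * p)) * (gamma_ratio (Suc n) p)\<^sup>2 = exp (- (pi * p)) * (pi * p / S\<^sup>2) * (pi * p * (\<Prod>k=1..n. 1 + p\<^sup>2 / (real k)\<^sup>2))" for n
    unfolding gamma_ratio_prod g1 by (simp add: power2_eq_square)
  moreover have "exp (- (pi * p)) * (pi * p / S\<^sup>2) * S = 2 * pi * p / (exp (2 * pi * p) - 1)"
  proof -
    have "exp (- (pi * p)) * (pi * p / S\<^sup>2) * S = pi * p / (exp (pi * p) * S)"
      using S by (simp add: power2_eq_square exp_minus field_simps)
    also have "exp (pi * p) * S = (exp (2 * pi * p) - 1) / 2"
      by (simp add: S_def right_diff_distrib exp_add[symmetric])
    finally show ?thesis by simp
  qed
  ultimately show ?thesis by simp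
qed

subsection \<open>The thermal spectrum\<close>

lemma osc_measurable [measurable]: "osc \<in> borel_measurable borel"
  unfolding osc_def by measurable

lemma osc_approx_measurable [measurable]: "osc_approx m \<in> borel_measurable borel"
  unfolding osc_approx_def by measurable

lemma set_integral_osc_kernel:
  assumes m: "m > 0"
  shows "(LBINT t:{..s}. osc_kernel m t) = osc_approx m s - 1"
proof -
  have "(LBINT t:{..s}. osc_kernel m t) = (LBINT t:einterval (-\<infinity>) (ereal s). osc_kernel m t)"
    unfolding set_lebesgue_integral_def
  proof (rule integral_cong_AE)
    show "AE t in lborel. indicator {..s} t *\<^sub>R osc_kernel m t = indicator (einterval (-\<infinity>) (ereal s)) t *\<^sub>R osc_kernel m t"
      using AE_lborel_singleton[of s] by eventually_elim (auto simp: einterval_def split: split_indicator)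
  qed auto
  also have "\<dots> = (LBINT t=-\<infinity>..ereal s. osc_kernel m t)"
    by (simp add: interval_lebesgue_integral_def)
  also have "\<dots> = osc_approx m s - 1"
  proof (rule interval_integral_FTC_integrable)
    show "(osc_approx m has_vector_derivative osc_kernel m x) (at x)" for x
      by (rule osc_approx_has_vector_derivative[OF m])
    show "isCont (osc_kernel m) x" for x
      using continuous_osc_kernel[OF m] by (simp add: continuous_on_eq_continuous_at)
    show "set_integrable lborel (einterval (-\<infinity>) (ereal s)) (osc_kernel m)"
      unfolding set_integrable_def by (intro integrable_mult_indicator integrable_osc_kernel m) auto
    have "isCont (osc_approx m) s"
      by (rule has_vector_derivative_continuous[OF osc_approx_has_vector_derivative[OF m]])
    hence "(osc_approx m \<longlongrightarrow> osc_approx m s) (at_left s)"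
      unfolding isCont_def by (rule tendsto_within_subset) auto
    thus "((osc_approx m \<circ> real_of_ereal) \<longlongrightarrow> osc_approx m s) (at_left (ereal s))"
      by (simp add: ereal_tendsto_simps)
    have "((\<lambda>t. 1 / (1 + \<i> * of_real (exp t / real m)) ^ m) \<longlongrightarrow> 1 / (1 + \<i> * of_real (0 / real m)) ^ m) at_bot"
      using m by (intro tendsto_intros exp_at_bot) auto
    hence "(osc_approx m \<longlongrightarrow> 1) at_bot" by (simp add: osc_approx_def[abs_def])
    thus "((osc_approx m \<circ> real_of_ereal) \<longlongrightarrow> 1) (at_right (-\<infinity>))"
      by (simp add: ereal_tendsto_simps)
  qed auto
  finally show ?thesis .
qed

text \<open>The primitive of \<open>osc_kernel m\<close> that vanishes at minus infinity is
  \<open>osc_approx m\<close> minus 1; the constant contributes minus the integral of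
  \<open>f\<close>, which is 0.\<close>

lemma convol_osc_approx_primitive:
  assumes m: "m > 0" and f: "integrable lborel f" and f0: "(LBINT y. f y) = 0"
  shows "(LBINT t:{..s}. convol (osc_kernel m) f t) = convol (osc_approx m) f s"
proof -
  have [measurable]: "f \<in> borel_measurable borel" using f by (auto dest: borel_measurable_integrable)
  have i: "integrable (lborel \<Otimes>\<^sub>M lborel) (\<lambda>(y, t). indicator {..s} t *\<^sub>R (osc_kernel m (t - y) * f y))"
    by (rule Bochner_Integration.integrable_bound[OF integrable_convol_pair[OF integrable_osc_kernel[OF m] f]])
      (auto simp: norm_mult split: split_indicator)
  have "(LBINT t:{..s}. convol (osc_kernel m) f t) =
      (LBINT t. LBINT y. indicator {..s} t *\<^sub>R (osc_kernel m (t - y) * f y))"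
    unfolding set_lebesgue_integral_def convol_def by simp
  also have "\<dots> = (LBINT y. LBINT t. indicator {..s} t *\<^sub>R (osc_kernel m (t - y) * f y))"
    by (rule lborel_pair.Fubini_integral[OF i])
  also have "\<dots> = (LBINT y. osc_approx m (s - y) * f y - f y)"
  proof (rule Bochner_Integration.integral_cong[OF refl])
    fix y
    have "(LBINT t. indicator {..s} t *\<^sub>R (osc_kernel m (t - y) * f y)) =
        (LBINT t. indicator {..s} (y + t) *\<^sub>R (osc_kernel m t * f y))"
      using lborel_integral_real_affine[of 1 "\<lambda>t. indicator {..s} t *\<^sub>R (osc_kernel m (t - y) * f y)" y] by simp
    also have "\<dots> = (LBINT t. (indicator {..s - y} t *\<^sub>R osc_kernel m t) * f y)"
      by (rule Bochner_Integration.integral_cong[OF refl]) (auto split: split_indicator)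
    also have "\<dots> = (LBINT t. indicator {..s - y} t *\<^sub>R osc_kernel m t) * f y"
      by (rule integral_mult_left_zero)
    also have "\<dots> = (osc_approx m (s - y) - 1) * f y"
      using set_integral_osc_kernel[OF m, of "s - y"] by (simp only: set_lebesgue_integral_def)
    finally show "(LBINT t. indicator {..s} t *\<^sub>R (osc_kernel m (t - y) * f y)) = osc_approx m (s - y) * f y - f y"
      by (simp add: algebra_simps)
  qed
  also have "\<dots> = convol (osc_approx m) f s"
    unfolding convol_def
    by (subst Bochner_Integration.integral_diff)
      (use f f0 integrable_bounded_mult[OF f, of "\<lambda>y. osc_approx m (s - y)" 1] norm_osc_approx_le in auto)
  finally show ?thesis .
qed

text \<open>Convolution commutes with an average over translations, so the Gamma average may be
  taken over the argument of \<open>convol osc f\<close>, as the comparison of square integrals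
  requires.\<close>

lemma convol_osc_approx_average:
  assumes m: "m > 0" and f: "integrable lborel f"
  shows "convol (osc_approx m) f s = (LBINT u. of_real (gamma_density m u) * convol osc f (s + u))"
proof -
  have [measurable]: "f \<in> borel_measurable borel" using f by (auto dest: borel_measurable_integrable)
  have "(LBINT u. of_real (gamma_density m u) * convol osc f (s + u)) =
      (LBINT u. LBINT y. of_real (gamma_density m u) * (osc (s + u - y) * f y))"
    unfolding convol_def by simp
  also have "\<dots> = (LBINT y. LBINT u. of_real (gamma_density m u) * (osc (s + u - y) * f y))"
    by (rule Fubini_product_bound[where a = "gamma_density m" and b = "\<lambda>y. cmod (f y)"])
      (use integrable_gamma_density[OF m] gamma_density_nonneg f in \<open>auto simp: norm_mult osc_def\<close>)
  also have "\<dots> = (LBINT y. osc_approx m (s - y) * f y)"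
  proof (rule Bochner_Integration.integral_cong[OF refl])
    fix y
    have "(LBINT u. of_real (gamma_density m u) * (osc (s + u - y) * f y)) =
        (LBINT u. of_real (gamma_density m u) * osc ((s - y) + u)) * f y"
      by (subst integral_mult_left_zero[symmetric]) (simp add: algebra_simps)
    thus "(LBINT u. of_real (gamma_density m u) * (osc (s + u - y) * f y)) = osc_approx m (s - y) * f y"
      using gamma_density_osc[OF m] by simp
  qed
  finally show ?thesis unfolding convol_def by simp
qed

text \<open>Jensen's inequality for the probability density \<open>r\<close> holds at each point,
  and integration over \<open>s\<close> removes the translation.\<close>

lemma nn_integral_convol_osc_approx_le:
  assumes m: "m > 0" and f: "integrable lborel f"
  shows "(\<integral>\<^sup>+ s. ennreal ((cmod (convol (osc_approx m) f s))\<^sup>2) \<partial>lborel) \<le>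
    (\<integral>\<^sup>+ s. ennreal ((cmod (convol osc f s))\<^sup>2) \<partial>lborel)"
proof -
  define V where "V = convol osc f"
  define M where "M = (LBINT y. cmod (f y))"
  define r where "r = gamma_density m"
  have [measurable]: "f \<in> borel_measurable borel" using f by (auto dest: borel_measurable_integrable)
  have [measurable]: "V \<in> borel_measurable borel" unfolding V_def by measurable
  have [measurable]: "r \<in> borel_measurable borel" unfolding r_def by measurable
  have V: "cmod (V s) \<le> M" for s
    unfolding V_def M_def using convol_bound[of osc 1 f s] f by (auto simp: osc_def)
  have M0: "M \<ge> 0" unfolding M_def by simp
  have r: "integrable lborel r" "\<And>u. r u \<ge> 0" "(LBINT u. r u) = 1"
    unfolding r_def using m integrable_gamma_density gamma_density_nonneg gamma_density_integral by auto
  have ri: "integrable lborel (\<lambda>u. r u * g u)"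
    if "g \<in> borel_measurable borel" "\<And>u. \<bar>g u\<bar> \<le> c" for g :: "real \<Rightarrow> real" and c
    by (rule Bochner_Integration.integrable_bound[where f = "\<lambda>u. r u * c"])
      (use r that in \<open>auto simp: abs_mult intro!: mult_left_mono order_trans[OF that(2) abs_ge_self]\<close>)
  have pt: "ennreal ((cmod (convol (osc_approx m) f s))\<^sup>2) \<le> (\<integral>\<^sup>+ u. ennreal (r u) * ennreal ((cmod (V (s + u)))\<^sup>2) \<partial>lborel)" for s
  proof -
    define b where "b = (LBINT u. r u * cmod (V (s + u)))"
    have i1: "integrable lborel (\<lambda>u. r u * cmod (V (s + u)))"
      by (rule ri[where c = M]) (use V in auto)
    have i2: "integrable lborel (\<lambda>u. r u * (cmod (V (s + u)))\<^sup>2)"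
      by (rule ri[where c = "M\<^sup>2"]) (use V in \<open>auto intro!: power_mono\<close>)
    have "cmod (convol (osc_approx m) f s) \<le> b"
      unfolding convol_osc_approx_average[OF m f] b_def
      by (rule order_trans[OF Bochner_Integration.integral_norm_bound])
        (use r in \<open>auto simp: norm_mult V_def r_def abs_of_nonneg gamma_density_nonneg\<close>)
    hence "(cmod (convol (osc_approx m) f s))\<^sup>2 \<le> b\<^sup>2" by (intro power_mono) auto
    also have "b\<^sup>2 \<le> (LBINT u. r u * (cmod (V (s + u)))\<^sup>2)"
    proof -
      \<comment> \<open>Jensen's inequality in the form that a variance is nonnegative.\<close>
      have "0 \<le> (LBINT u. r u * (cmod (V (s + u)) - b)\<^sup>2)"
        using r by (intro Bochner_Integration.integral_nonneg) auto
      also have "\<dots> = (LBINT u. r u * (cmod (V (s + u)))\<^sup>2 - 2 * b * (r u * cmod (V (s + u))) + b\<^sup>2 * r u)"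
        by (rule Bochner_Integration.integral_cong[OF refl]) (simp add: power2_eq_square algebra_simps)
      also have "\<dots> = (LBINT u. r u * (cmod (V (s + u)))\<^sup>2) - 2 * b * b + b\<^sup>2"
        using i1 i2 r by (simp add: b_def)
      finally show ?thesis by (simp add: power2_eq_square)
    qed
    finally have "ennreal ((cmod (convol (osc_approx m) f s))\<^sup>2) \<le> ennreal (LBINT u. r u * (cmod (V (s + u)))\<^sup>2)"
      by (rule ennreal_leI)
    also have "\<dots> = (\<integral>\<^sup>+ u. ennreal (r u * (cmod (V (s + u)))\<^sup>2) \<partial>lborel)"
      by (rule nn_integral_eq_integral[symmetric]) (use i2 r in auto)
    finally show ?thesis using r by (simp add: ennreal_mult)
  qed
  have "(\<integral>\<^sup>+ s. ennreal ((cmod (convol (osc_approx m) f s))\<^sup>2) \<partial>lborel) \<le>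
      (\<integral>\<^sup>+ s. \<integral>\<^sup>+ u. ennreal (r u) * ennreal ((cmod (V (s + u)))\<^sup>2) \<partial>lborel \<partial>lborel)"
    by (rule nn_integral_mono) (rule pt)
  also have "\<dots> = (\<integral>\<^sup>+ u. \<integral>\<^sup>+ s. ennreal (r u) * ennreal ((cmod (V (s + u)))\<^sup>2) \<partial>lborel \<partial>lborel)"
    by (rule lborel_pair.Fubini') measurable
  also have "\<dots> = (\<integral>\<^sup>+ u. ennreal (r u) * (\<integral>\<^sup>+ s. ennreal ((cmod (V s))\<^sup>2) \<partial>lborel) \<partial>lborel)"
  proof (rule nn_integral_cong)
    fix u :: real
    have "(\<integral>\<^sup>+ s. ennreal ((cmod (V (s + u)))\<^sup>2) \<partial>lborel) = (\<integral>\<^sup>+ s. ennreal ((cmod (V s))\<^sup>2) \<partial>lborel)"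
      using nn_integral_real_affine[of "\<lambda>s. ennreal ((cmod (V s))\<^sup>2)" 1 u] by (simp add: add.commute)
    thus "(\<integral>\<^sup>+ s. ennreal (r u) * ennreal ((cmod (V (s + u)))\<^sup>2) \<partial>lborel) = ennreal (r u) * (\<integral>\<^sup>+ s. ennreal ((cmod (V s))\<^sup>2) \<partial>lborel)"
      by (subst nn_integral_cmult) auto
  qed
  also have "\<dots> = (\<integral>\<^sup>+ u. ennreal (r u) \<partial>lborel) * (\<integral>\<^sup>+ s. ennreal ((cmod (V s))\<^sup>2) \<partial>lborel)"
    by (rule nn_integral_multc) simp
  also have "(\<integral>\<^sup>+ u. ennreal (r u) \<partial>lborel) = 1"
    using nn_integral_eq_integral[of lborel r] r by simp
  finally show ?thesis unfolding V_def by simp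
qed

theorem nn_integral_convol_osc:
  assumes f: "integrable lborel f" and supp: "\<And>p. p \<le> 0 \<Longrightarrow> fourier f p = 0"
  shows "ennreal (2 * pi) * (\<integral>\<^sup>+ s. ennreal ((cmod (convol osc f s))\<^sup>2) \<partial>lborel) =
    (\<integral>\<^sup>+ p. ennreal (indicator {0<..} p * (2 * pi * (cmod (fourier f p))\<^sup>2 / (p * (exp (2 * pi * p) - 1)))) \<partial>lborel)"
proof -
  define V where "V n = convol (osc_approx (Suc n)) f" for n
  define T where "T = (\<integral>\<^sup>+ p. ennreal (indicator {0<..} p * (2 * pi * (cmod (fourier f p))\<^sup>2 / (p * (exp (2 * pi * p) - 1)))) \<partial>lborel)"
  have [measurable]: "f \<in> borel_measurable borel" using f by (auto dest: borel_measurable_integrable)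
  \<comment> \<open>Measurability is read off from the Fourier transform instead of from the Gamma
    function.\<close>
  have [measurable]: "gamma_ratio m \<in> borel_measurable borel" if "m > 0" for m
  proof -
    have "gamma_ratio m = (\<lambda>p. cmod (fourier (osc_kernel m) p) / exp (- (pi * p / 2)))"
      using norm_fourier_osc_kernel[OF that] by (auto simp: fun_eq_iff)
    thus ?thesis by simp
  qed
  have f0: "(LBINT y. f y) = 0" using supp[of 0] by (simp add: fourier_def)
  \<comment> \<open>The weight 1/p^2 undoes the derivative in \<open>osc_kernel\<close>, so that
    \<open>V n\<close> itself appears on the position side. Both sides may be infinite.\<close>
  have P: "(\<integral>\<^sup>+ p. ennreal (exp (- (pi * p)) * (gamma_ratio (Suc n) p)\<^sup>2 * (cmod (fourier f p))\<^sup>2 / p\<^sup>2) \<partial>lborel) =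
      ennreal (2 * pi) * (\<integral>\<^sup>+ s. ennreal ((cmod (V n s))\<^sup>2) \<partial>lborel)" for n
  proof -
    have m: "Suc n > 0" by simp
    have "(\<integral>\<^sup>+ p. ennreal ((cmod (fourier (convol (osc_kernel (Suc n)) f) p))\<^sup>2 / p\<^sup>2) \<partial>lborel) =
      ennreal (2 * pi) * (\<integral>\<^sup>+ s. ennreal ((cmod (LBINT t:{..s}. convol (osc_kernel (Suc n)) f t))\<^sup>2) \<partial>lborel)"
    proof (rule plancherel_primitive)
      show "integrable lborel (convol (osc_kernel (Suc n)) f)"
        by (rule integrable_convol[OF integrable_osc_kernel[OF m] f])
      have "cmod (osc_kernel (Suc n) t) \<le> (real (Suc n))\<^sup>2" for t
        by (rule order_trans[OF osc_kernel_bound[OF m]]) (simp add: mult_left_le)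
      thus "continuous_on UNIV (convol (osc_kernel (Suc n)) f)"
        by (rule continuous_convol[OF continuous_osc_kernel[OF m] _ f])
    qed
    moreover have "(cmod (fourier (convol (osc_kernel (Suc n)) f) p))\<^sup>2 =
        exp (- (pi * p)) * (gamma_ratio (Suc n) p)\<^sup>2 * (cmod (fourier f p))\<^sup>2" for p
    proof -
      have "(exp (- (pi * p / 2)))\<^sup>2 = exp (- (pi * p))" by (simp add: exp_double[symmetric])
      thus ?thesis
        unfolding fourier_convol[OF integrable_osc_kernel[OF m] f] norm_mult norm_fourier_osc_kernel[OF m]
        by (simp add: power_mult_distrib)
    qed
    ultimately show ?thesis unfolding V_def convol_osc_approx_primitive[OF m f f0] by simp
  qed
  have lim: "(\<lambda>n. \<integral>\<^sup>+ p. ennreal (exp (- (pi * p)) * (gamma_ratio (Suc n) p)\<^sup>2 * (cmod (fourier f p))\<^sup>2 / p\<^sup>2) \<partial>lborel) \<longlonglongrightarrow> T"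
    unfolding T_def
  proof (rule nn_integral_incseq_tendsto)
    fix n p
    show "ennreal (exp (- (pi * p)) * (gamma_ratio (Suc n) p)\<^sup>2 * (cmod (fourier f p))\<^sup>2 / p\<^sup>2) \<le>
        ennreal (exp (- (pi * p)) * (gamma_ratio (Suc (Suc n)) p)\<^sup>2 * (cmod (fourier f p))\<^sup>2 / p\<^sup>2)"
      by (intro ennreal_leI divide_right_mono mult_right_mono mult_left_mono power_mono gamma_ratio_mono gamma_ratio_nonneg) auto
  next
    show "AE p in lborel. (\<lambda>n. ennreal (exp (- (pi * p)) * (gamma_ratio (Suc n) p)\<^sup>2 * (cmod (fourier f p))\<^sup>2 / p\<^sup>2)) \<longlonglongrightarrow>
        ennreal (indicator {0<..} p * (2 * pi * (cmod (fourier f p))\<^sup>2 / (p * (exp (2 * pi * p) - 1))))"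
    proof (rule AE_I2)
      fix p :: real
      show "(\<lambda>n. ennreal (exp (- (pi * p)) * (gamma_ratio (Suc n) p)\<^sup>2 * (cmod (fourier f p))\<^sup>2 / p\<^sup>2)) \<longlonglongrightarrow>
        ennreal (indicator {0<..} p * (2 * pi * (cmod (fourier f p))\<^sup>2 / (p * (exp (2 * pi * p) - 1))))"
      proof (cases "p > 0")
        case True
        have "(\<lambda>n. exp (- (pi * p)) * (gamma_ratio (Suc n) p)\<^sup>2 * (cmod (fourier f p))\<^sup>2 / p\<^sup>2) \<longlonglongrightarrow>
            2 * pi * p / (exp (2 * pi * p) - 1) * (cmod (fourier f p))\<^sup>2 / p\<^sup>2"
          using True by (intro tendsto_intros gamma_ratio_tendsto) auto
        also have "2 * pi * p / (exp (2 * pi * p) - 1) * (cmod (fourier f p))\<^sup>2 / p\<^sup>2 =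
            indicator {0<..} p * (2 * pi * (cmod (fourier f p))\<^sup>2 / (p * (exp (2 * pi * p) - 1)))"
          using True by (simp add: power2_eq_square mult_ac)
        finally show ?thesis by (rule tendsto_ennrealI)
      next
        \<comment> \<open>For p \<le> 0 every approximant is 0 because the transform of
          \<open>f\<close> vanishes there; this includes p = 0, where the weight is
          singular.\<close>
        case False
        thus ?thesis using supp[of p] by simp
      qed
    qed
  qed simp
  \<comment> \<open>An increasing sequence stays below its limit; this is the uniform bound that
    Fatou's lemma asks for.\<close>
  have le1: "ennreal (2 * pi) * (\<integral>\<^sup>+ s. ennreal ((cmod (V n s))\<^sup>2) \<partial>lborel) \<le> T" for n
  proof -
    have "incseq (\<lambda>n. \<integral>\<^sup>+ p. ennreal (exp (- (pi * p)) * (gamma_ratio (Suc n) p)\<^sup>2 * (cmod (fourier f p))\<^sup>2 / p\<^sup>2) \<partial>lborel)"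
      by (intro incseq_SucI nn_integral_mono ennreal_leI divide_right_mono mult_right_mono mult_left_mono
          power_mono gamma_ratio_mono gamma_ratio_nonneg) auto
    from incseq_le[OF this lim, of n] show ?thesis unfolding P .
  qed
  have "T \<le> ennreal (2 * pi) * (\<integral>\<^sup>+ s. ennreal ((cmod (convol osc f s))\<^sup>2) \<partial>lborel)"
  proof (rule LIMSEQ_le_const2[OF lim], intro exI allI impI)
    fix n :: nat
    show "(\<integral>\<^sup>+ p. ennreal (exp (- (pi * p)) * (gamma_ratio (Suc n) p)\<^sup>2 * (cmod (fourier f p))\<^sup>2 / p\<^sup>2) \<partial>lborel)
      \<le> ennreal (2 * pi) * (\<integral>\<^sup>+ s. ennreal ((cmod (convol osc f s))\<^sup>2) \<partial>lborel)"
      unfolding P V_def by (intro mult_left_mono nn_integral_convol_osc_approx_le f) auto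
  qed
  moreover have "(\<integral>\<^sup>+ s. ennreal (2 * pi) * ennreal ((cmod (convol osc f s))\<^sup>2) \<partial>lborel) \<le> T"
  proof (rule nn_integral_Fatou_le)
    have [measurable]: "V n \<in> borel_measurable borel" for n unfolding V_def by measurable
    show "(\<lambda>s. ennreal (2 * pi) * ennreal ((cmod (V n s))\<^sup>2)) \<in> borel_measurable lborel" for n by measurable
    show "(\<integral>\<^sup>+ s. ennreal (2 * pi) * ennreal ((cmod (V n s))\<^sup>2) \<partial>lborel) \<le> T" for n
      using le1[of n] by (subst nn_integral_cmult) auto
    have "(\<lambda>n. V n s) \<longlonglongrightarrow> convol osc f s" for s
      unfolding V_def convol_def
    proof (rule integral_dominated_convergence[where w = "\<lambda>y. cmod (f y)"])
      show "AE y in lborel. (\<lambda>n. osc_approx (Suc n) (s - y) * f y) \<longlonglongrightarrow> osc (s - y) * f y"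
        by (intro AE_I2 tendsto_intros LIMSEQ_Suc[OF osc_approx_tendsto])
      show "AE y in lborel. cmod (osc_approx (Suc n) (s - y) * f y) \<le> cmod (f y)" for n
        using norm_osc_approx_le by (intro AE_I2) (auto simp: norm_mult intro!: mult_left_le_one_le)
    qed (use f in auto)
    thus "AE s in lborel. (\<lambda>n. ennreal (2 * pi) * ennreal ((cmod (V n s))\<^sup>2)) \<longlonglongrightarrow> ennreal (2 * pi) * ennreal ((cmod (convol osc f s))\<^sup>2)"
      by (intro AE_I2 ennreal_tendsto_cmult tendsto_ennrealI tendsto_intros) auto
  qed
  hence "ennreal (2 * pi) * (\<integral>\<^sup>+ s. ennreal ((cmod (convol osc f s))\<^sup>2) \<partial>lborel) \<le> T"
    by (subst (asm) nn_integral_cmult) auto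
  ultimately show ?thesis unfolding T_def by (intro antisym) auto
qed

text \<open>With k = e^s the phase k x(y) equals - e^(s - y), so U at - k is a convolution with
  \<open>osc\<close>. The rest is bookkeeping: 1/2 from dk/2k, 1/(2\<pi>) from the squared prefactor
  of U, and 2\<pi> from passing between \<open>fourier f\<close> and \<open>ft\<close>.\<close>

theorem N_spontaneous_eq_N_thermal:
  assumes f: "integrable lborel f" and supp: "\<And>p. p \<le> 0 \<Longrightarrow> fourier f p = 0"
    and [measurable]: "ft \<in> borel_measurable borel"
    and ft: "AE p in lborel. p > 0 \<longrightarrow> ft p = fourier f p / of_real (sqrt (2 * pi))"
  shows "N_spontaneous relativistic_x f = N_thermal (2 * pi) ft"
proof -
  have [measurable]: "f \<in> borel_measurable borel" using f by (auto dest: borel_measurable_integrable)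
  have "N_spontaneous relativistic_x f = ennreal (1 / 2) * (\<integral>\<^sup>+ s. ennreal ((cmod (U_op relativistic_x f (- exp s)))\<^sup>2) \<partial>lborel)"
    unfolding N_spontaneous_def
  proof (rule nn_integral_wf_measure)
    show "(\<lambda>k. ennreal ((cmod (U_op relativistic_x f (- k)))\<^sup>2)) \<in> borel_measurable borel"
      unfolding U_op_def relativistic_x_def by measurable
  qed
  also have "(\<lambda>s. ennreal ((cmod (U_op relativistic_x f (- exp s)))\<^sup>2)) =
      (\<lambda>s. ennreal (1 / (2 * pi)) * ennreal ((cmod (convol osc f s))\<^sup>2))"
  proof
    fix s
    have "U_op relativistic_x f (- exp s) = convol osc f s / of_real (sqrt (2 * pi))"
      unfolding U_op_def convol_def relativistic_x_def osc_def by (simp add: exp_diff exp_minus field_simps)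
    hence "(cmod (U_op relativistic_x f (- exp s)))\<^sup>2 = 1 / (2 * pi) * (cmod (convol osc f s))\<^sup>2"
      by (simp add: norm_divide power_divide)
    thus "ennreal ((cmod (U_op relativistic_x f (- exp s)))\<^sup>2) = ennreal (1 / (2 * pi)) * ennreal ((cmod (convol osc f s))\<^sup>2)"
      by (simp only: ennreal_mult[OF _ zero_le_power2] pi_ge_zero) (subst ennreal_mult, auto)
  qed
  also have "(\<integral>\<^sup>+ s. ennreal (1 / (2 * pi)) * ennreal ((cmod (convol osc f s))\<^sup>2) \<partial>lborel) =
      ennreal (1 / (2 * pi)) * (\<integral>\<^sup>+ s. ennreal ((cmod (convol osc f s))\<^sup>2) \<partial>lborel)"
    by (rule nn_integral_cmult) simp
  \<comment> \<open>The factor 2\<pi> is split off so that the left side of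
    \<open>nn_integral_convol_osc\<close> appears.\<close>
  also have "ennreal (1 / (2 * pi)) = ennreal (1 / (2 * pi)\<^sup>2) * ennreal (2 * pi)"
    by (subst ennreal_mult[symmetric]) (auto simp: power2_eq_square)
  also have "ennreal (1 / 2) * (ennreal (1 / (2 * pi)\<^sup>2) * ennreal (2 * pi) * (\<integral>\<^sup>+ s. ennreal ((cmod (convol osc f s))\<^sup>2) \<partial>lborel)) =
      ennreal (1 / 2) * ennreal (1 / (2 * pi)\<^sup>2) * (ennreal (2 * pi) * (\<integral>\<^sup>+ s. ennreal ((cmod (convol osc f s))\<^sup>2) \<partial>lborel))"
    by (simp only: mult.assoc)
  also have "ennreal (2 * pi) * (\<integral>\<^sup>+ s. ennreal ((cmod (convol osc f s))\<^sup>2) \<partial>lborel) =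
      (\<integral>\<^sup>+ p. ennreal (indicator {0<..} p * (2 * pi * (cmod (fourier f p))\<^sup>2 / (p * (exp (2 * pi * p) - 1)))) \<partial>lborel)"
    by (rule nn_integral_convol_osc[OF f supp])
  also have "ennreal (1 / 2) * ennreal (1 / (2 * pi)\<^sup>2) * \<dots> = (\<integral>\<^sup>+ p. ennreal (1 / 2) * ennreal (1 / (2 * pi)\<^sup>2) *
      ennreal (indicator {0<..} p * (2 * pi * (cmod (fourier f p))\<^sup>2 / (p * (exp (2 * pi * p) - 1)))) \<partial>lborel)"
    by (rule nn_integral_cmult[symmetric]) simp
  also have "\<dots> = (\<integral>\<^sup>+ p. ennreal (indicator {0<..} p / (2 * p)) * ennreal ((cmod (ft p))\<^sup>2 / (exp (2 * pi * p) - 1)) \<partial>lborel)"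
  proof (rule nn_integral_cong_AE, use ft in eventually_elim)
    fix p :: real assume p: "p > 0 \<longrightarrow> ft p = fourier f p / of_real (sqrt (2 * pi))"
    show "ennreal (1 / 2) * ennreal (1 / (2 * pi)\<^sup>2) *
      ennreal (indicator {0<..} p * (2 * pi * (cmod (fourier f p))\<^sup>2 / (p * (exp (2 * pi * p) - 1)))) =
      ennreal (indicator {0<..} p / (2 * p)) * ennreal ((cmod (ft p))\<^sup>2 / (exp (2 * pi * p) - 1))"
    proof (cases "p > 0")
      case True
      have e: "exp (2 * pi * p) - 1 > 0" using True by simp
      have f2: "(cmod (ft p))\<^sup>2 = (cmod (fourier f p))\<^sup>2 / (2 * pi)"
        using p True by (simp add: norm_divide power_divide)
      have "ennreal (1 / 2) * ennreal (1 / (2 * pi)\<^sup>2) *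
        ennreal (indicator {0<..} p * (2 * pi * (cmod (fourier f p))\<^sup>2 / (p * (exp (2 * pi * p) - 1)))) =
        ennreal (1 / 2 * (1 / (2 * pi)\<^sup>2) * (indicator {0<..} p * (2 * pi * (cmod (fourier f p))\<^sup>2 / (p * (exp (2 * pi * p) - 1)))))"
        using True e by (subst ennreal_mult[symmetric], simp, simp, subst ennreal_mult[symmetric]) auto
      also have "1 / 2 * (1 / (2 * pi)\<^sup>2) * (indicator {0<..} p * (2 * pi * (cmod (fourier f p))\<^sup>2 / (p * (exp (2 * pi * p) - 1)))) =
        indicator {0<..} p / (2 * p) * ((cmod (ft p))\<^sup>2 / (exp (2 * pi * p) - 1))"
        unfolding f2 using True by (simp add: power2_eq_square)
      also have "ennreal (indicator {0<..} p / (2 * p) * ((cmod (ft p))\<^sup>2 / (exp (2 * pi * p) - 1))) =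
        ennreal (indicator {0<..} p / (2 * p)) * ennreal ((cmod (ft p))\<^sup>2 / (exp (2 * pi * p) - 1))"
        using True e by (subst ennreal_mult) auto
      finally show ?thesis .
    qed simp
  qed
  also have "\<dots> = N_thermal (2 * pi) ft"
    unfolding N_thermal_def wf_measure_def by (subst nn_integral_density) auto
  finally show ?thesis .
qed

subsection \<open>Recovering the wave function from its position-space form\<close>

text \<open>A test function with explicit transform: in momentum space it is a Gaussian of width
  \<sigma> around \<open>q\<close>. As \<sigma> tends to 0 it becomes the plane wave e^(- i q
  y).\<close>

definition gaussian_wave :: "real \<Rightarrow> real \<Rightarrow> real \<Rightarrow> complex" where
  "gaussian_wave \<sigma> q y = of_real (exp (- (\<sigma> * y)\<^sup>2 / 2)) * cis (- (q * y))"

lemma gaussian_wave_measurable [measurable]: "gaussian_wave \<sigma> q \<in> borel_measurable borel"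
  unfolding gaussian_wave_def by measurable

lemma power_le_fact_exp:
  fixes x :: real
  assumes "x \<ge> 0"
  shows "x ^ k \<le> fact k * exp x"
proof -
  have "(\<Sum>n\<in>{k}. x ^ n /\<^sub>R fact n) \<le> (\<Sum>n. x ^ n /\<^sub>R fact n)"
    by (rule sum_le_suminf[OF summable_exp_generic]) (use assms in auto)
  hence "x ^ k / fact k \<le> exp x" by (simp add: exp_def divide_inverse mult.commute)
  thus ?thesis by (simp add: field_simps)
qed

lemma bounded_power_gaussian_wave:
  assumes "\<sigma> > 0"
  shows "bounded (range (\<lambda>y. of_real (y ^ k) * gaussian_wave \<sigma> q y))"
proof -
  \<comment> \<open>From |y|^k \<le> 1 + (y^2)^k and s^k e^(- s) \<le> k! with y^2 = 2 s /
    \<sigma>^2.\<close>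
  define B where "B = 1 + (2 / \<sigma>\<^sup>2) ^ k * fact k"
  have "cmod (of_real (y ^ k) * gaussian_wave \<sigma> q y) \<le> B" for y
  proof -
    define s where "s = (\<sigma> * y)\<^sup>2 / 2"
    have s: "s \<ge> 0" by (simp add: s_def)
    have y2: "y\<^sup>2 = 2 / \<sigma>\<^sup>2 * s" using assms by (simp add: s_def power_mult_distrib)
    have "\<bar>y\<bar> ^ k \<le> 1 + (y\<^sup>2) ^ k"
    proof (cases "\<bar>y\<bar> \<le> 1")
      case True
      hence "\<bar>y\<bar> ^ k \<le> 1" by (simp add: power_le_one)
      thus ?thesis by (simp add: add_increasing2)
    next
      case False
      hence "\<bar>y\<bar> * 1 \<le> \<bar>y\<bar> * \<bar>y\<bar>" by (intro mult_left_mono) auto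
      hence "\<bar>y\<bar> \<le> y\<^sup>2" by (simp add: power2_eq_square)
      hence "\<bar>y\<bar> ^ k \<le> (y\<^sup>2) ^ k" by (intro power_mono) auto
      thus ?thesis by simp
    qed
    hence "\<bar>y\<bar> ^ k * exp (- s) \<le> (1 + (y\<^sup>2) ^ k) * exp (- s)" by (rule mult_right_mono) simp
    also have "\<dots> = exp (- s) + (2 / \<sigma>\<^sup>2) ^ k * (s ^ k * exp (- s))"
      unfolding y2 power_mult_distrib[of "2 / \<sigma>\<^sup>2" s k] by (simp only: algebra_simps)
    also have "\<dots> \<le> 1 + (2 / \<sigma>\<^sup>2) ^ k * fact k"
    proof (intro add_mono mult_left_mono)
      have "s ^ k * exp (- s) \<le> fact k * exp s * exp (- s)"
        by (intro mult_right_mono power_le_fact_exp s) simp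
      thus "s ^ k * exp (- s) \<le> fact k" by (simp add: mult.assoc exp_add[symmetric])
    qed (use s in auto)
    finally show ?thesis
      by (simp add: gaussian_wave_def norm_mult norm_power power_abs B_def s_def)
  qed
  thus ?thesis unfolding bounded_iff by blast
qed

lemma bounded_poly_gaussian_wave:
  assumes "\<sigma> > 0"
  shows "bounded (range (\<lambda>y. of_real (y ^ k) * (poly P (of_real y) * gaussian_wave \<sigma> q y)))"
proof (induction P arbitrary: k)
  case 0
  show ?case by (simp add: image_constant_conv)
next
  case (pCons a P)
  obtain c where c: "\<And>y. cmod (of_real (y ^ k) * gaussian_wave \<sigma> q y) \<le> c"
    using bounded_power_gaussian_wave[OF assms, of k q] unfolding bounded_iff by blast
  have "cmod (a * (of_real (y ^ k) * gaussian_wave \<sigma> q y)) \<le> cmod a * c" for y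
    unfolding norm_mult[of a] by (intro mult_left_mono c) simp
  hence "bounded (range (\<lambda>y. a * (of_real (y ^ k) * gaussian_wave \<sigma> q y)))"
    unfolding bounded_iff by blast
  from bounded_plus_comp[OF this pCons.IH[of "Suc k"]]
  show ?case by (simp add: algebra_simps)
qed

lemma schwartz_gaussian_wave:
  assumes "\<sigma> > 0"
  shows "schwartz_function (gaussian_wave \<sigma> q)"
proof -
  \<comment> \<open>\<open>P n\<close> is the polynomial factor of the n-th derivative; the linear
    factor in the recursion is the logarithmic derivative of the Gaussian wave.\<close>
  define P where "P = rec_nat (1 :: complex poly) (\<lambda>_ p. pderiv p + p * [:- (\<i> * of_real q), - of_real (\<sigma>\<^sup>2):])"
  have P: "P 0 = 1" "P (Suc n) = pderiv (P n) + P n * [:- (\<i> * of_real q), - of_real (\<sigma>\<^sup>2):]" for n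
    by (simp_all add: P_def)
  define D where "D n y = poly (P n) (of_real y) * gaussian_wave \<sigma> q y" for n y
  define E where "E w = exp (- of_real (\<sigma>\<^sup>2 / 2) * w\<^sup>2 - \<i> * of_real q * w)" for w :: complex
  have E: "gaussian_wave \<sigma> q y = E (of_real y)" for y
    unfolding gaussian_wave_def E_def cis_conv_exp exp_of_real[symmetric] exp_add[symmetric]
    by (rule arg_cong[where f = exp]) (simp add: power_mult_distrib)
  have "(D n has_vector_derivative D (Suc n) y) (at y)" for n y
  proof -
    have dE: "(E has_field_derivative (- (\<i> * of_real q) - of_real (\<sigma>\<^sup>2) * w) * E w) (at w)" for w
      unfolding E_def by (auto intro!: derivative_eq_intros simp: field_simps)
    have "((\<lambda>w. poly (P n) w * E w) has_field_derivative poly (P (Suc n)) (of_real y) * E (of_real y)) (at (of_real y))"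
      by (rule derivative_eq_intros poly_DERIV dE)+ (simp add: P algebra_simps)
    thus ?thesis unfolding D_def[abs_def] E by (rule has_vector_derivative_real_field)
  qed
  moreover have "D 0 = gaussian_wave \<sigma> q" by (simp add: D_def P fun_eq_iff)
  moreover have "bounded (range (\<lambda>y. of_real (y ^ m) * D n y))" for m n
    unfolding D_def by (rule bounded_poly_gaussian_wave[OF assms])
  ultimately show ?thesis unfolding schwartz_function_def by blast
qed

section \<open>From Gaussian pairings to equality almost everywhere\<close>

lemma AE_lborel_Ex:
  assumes "AE x in lborel. P x" "a < (b::real)"
  shows "\<exists>x. a < x \<and> x < b \<and> P x"
proof (rule ccontr)
  assume *: "\<not> ?thesis"
  obtain N where N: "{x \<in> space lborel. \<not> P x} \<subseteq> N" "emeasure lborel N = 0" "N \<in> sets lborel"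
    using assms(1) by (rule AE_E)
  have "{a<..<b} \<subseteq> N" using * N(1) by auto
  hence "emeasure lborel {a<..<b} \<le> emeasure lborel N" using N(3) by (intro emeasure_mono)
  thus False using assms(2) N(2) by simp
qed

text \<open>Compact intervals form an intersection-stable generator of the Borel sets, so by
  Dynkin's argument the integral vanishes over every Borel set. Complements are handled by the total
  integral, which is 0 as the limit over [-n, n].\<close>

lemma AE_zero_if_interval_integrals_zero:
  fixes h :: "real \<Rightarrow> 'a::{banach, second_countable_topology}"
  assumes h: "integrable lborel h" and zero: "\<And>a b. (LBINT t:{a..b}. h t) = 0"
  shows "AE t in lborel. h t = 0"
proof (rule sigma_finite_measure.density_zero[OF lborel.sigma_finite_measure_axioms h])
  define G where "G = range (\<lambda>(a, b). {a..b :: real})"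
  have all: "(LBINT t. h t) = 0"
    using LBINT_tendsto_UNIV[OF h] unfolding zero by (simp add: LIMSEQ_const_iff)
  have si: "set_integrable lborel S h" if "S \<in> sets borel" for S
    using integrable_mult_indicator[of S lborel h] that h by (simp add: set_integrable_def)
  have sets: "sets borel = sigma_sets UNIV G"
    unfolding G_def by (subst borel_eq_atLeastAtMost) simp
  fix A :: "real set" assume "A \<in> sets lborel"
  hence A: "A \<in> sigma_sets UNIV G" using sets by simp
  have "Int_stable G"
    unfolding G_def Int_stable_def by (auto simp: Int_atLeastAtMost)
  moreover have "G \<subseteq> Pow UNIV" by simp
  ultimately show "(LBINT t:A. h t) = 0"
    using A
  proof (induction rule: sigma_sets_induct_disjoint)
    case (basic A)
    thus ?case using zero by (auto simp: G_def)
  next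
    case empty
    show ?case by (simp add: set_lebesgue_integral_def)
  next
    case (compl A)
    hence A: "A \<in> sets borel" by (simp add: sets)
    have "(LBINT t:A \<union> (UNIV - A). h t) = (LBINT t:A. h t) + (LBINT t:UNIV - A. h t)"
      by (rule set_integral_Un) (use A in \<open>auto intro: si\<close>)
    thus ?case using compl all by (simp add: set_lebesgue_integral_def)
  next
    case (union A)
    hence A: "A i \<in> sets borel" for i by (auto simp: sets)
    have "(LBINT t:\<Union>(range A). h t) = (\<Sum>i. LBINT t:A i. h t)"
    proof (rule lebesgue_integral_countable_add)
      show "set_integrable lborel (\<Union>(range A)) h" by (rule si) (use A in auto)
    qed (use A union in \<open>auto simp: disjoint_family_on_def\<close>)
    thus ?case using union by simp
  qed
qed

text \<open>Square integrability for dp/2p does not make \<open>u\<close> integrable at infinity,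
  but the weight e^(- p) does. The weighted function dominates the limits in momentum space taken
  below.\<close>

lemma wave_function_integrable_exp:
  assumes "wave_function u"
  shows "integrable lborel (\<lambda>p. indicator {0<..} p * (cmod (u p) * exp (- p)))"
    and "u \<in> borel_measurable borel"
proof -
  have s: "sets wf_measure = sets borel" by (simp add: wf_measure_def)
  show [measurable]: "u \<in> borel_measurable borel"
    using assms measurable_cong_sets[OF s refl] by (auto simp: wave_function_def)
  have "integrable wf_measure (\<lambda>p. (cmod (u p))\<^sup>2)" using assms by (simp add: wave_function_def)
  hence 1: "integrable lborel (\<lambda>p. (indicator {0<..} p / (2 * p)) *\<^sub>R (cmod (u p))\<^sup>2)"
    unfolding wf_measure_def by (subst (asm) integrable_density) (auto split: split_indicator)
  have 2: "integrable lborel (\<lambda>p::real. indicator {0<..} p *\<^sub>R exp (- (p * 1)))"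
    using integrable_I0i_exp_mscale[of 1] by (simp add: set_integrable_def)
  show "integrable lborel (\<lambda>p. indicator {0<..} p * (cmod (u p) * exp (- p)))"
  proof (rule Bochner_Integration.integrable_bound[OF Bochner_Integration.integrable_add[OF 1 2]])
    show "AE p in lborel. norm (indicator {0<..} p * (cmod (u p) * exp (- p))) \<le>
        norm ((indicator {0<..} p / (2 * p)) *\<^sub>R (cmod (u p))\<^sup>2 + indicator {0<..} p *\<^sub>R exp (- (p * 1)))"
    proof (rule AE_I2)
      fix p :: real
      show "norm (indicator {0<..} p * (cmod (u p) * exp (- p))) \<le>
        norm ((indicator {0<..} p / (2 * p)) *\<^sub>R (cmod (u p))\<^sup>2 + indicator {0<..} p *\<^sub>R exp (- (p * 1)))"
      proof (cases "p > 0")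
        case True
        \<comment> \<open>The arithmetic-geometric mean inequality, balanced so that the weight 1/(2
          p) of the norm appears: |u| e^(- p) \<le> |u|^2 / (2 p) + p e^(- 2 p) / 2.\<close>
        have "0 \<le> (cmod (u p) - p * exp (- p))\<^sup>2" by simp
        hence "2 * p * (cmod (u p) * exp (- p)) \<le> (cmod (u p))\<^sup>2 + p * p * exp (- p) * exp (- p)"
          by (simp add: power2_eq_square algebra_simps)
        hence "cmod (u p) * exp (- p) \<le> ((cmod (u p))\<^sup>2 + p * p * exp (- p) * exp (- p)) / (2 * p)"
          using True by (simp add: field_simps)
        also have "\<dots> = (cmod (u p))\<^sup>2 / (2 * p) + (p * exp (- p)) * exp (- p) / 2"
          using True by (simp add: field_simps)
        also have "(p * exp (- p)) * exp (- p) / 2 \<le> 1 * exp (- p)"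
        proof -
          have "p \<le> exp p" using exp_ge_add_one_self[of p] by linarith
          hence "p * exp (- p) \<le> 1" by (simp add: exp_minus field_simps)
          hence "(p * exp (- p)) * exp (- p) \<le> 1 * exp (- p)" by (intro mult_right_mono) auto
          thus ?thesis by simp
        qed
        finally show ?thesis using True by simp
      qed simp
    qed
  qed simp
qed

text \<open>The distributional limit is tested on a Gaussian wave. On (0, R] Fubini applies and the
  transform of the Gaussian is explicit; the limit of large R is then dominated, because a Gaussian
  decays faster than e^(- p).\<close>

lemma gaussian_wave_pairing:
  assumes u: "wave_function u" and F: "fourier_integral u f" and \<sigma>: "\<sigma> > 0"
  shows "(LBINT y. f y * gaussian_wave \<sigma> q y) =
    (LBINT p. indicator {0<..} p *\<^sub>R (u p * of_real (exp (- ((p - q) / \<sigma>)\<^sup>2 / 2) / \<sigma>)))"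
proof -
  note W = wave_function_integrable_exp(1)[OF u]
  note [measurable] = wave_function_integrable_exp(2)[OF u]
  define \<gamma> where "\<gamma> p = exp (- ((p - q) / \<sigma>)\<^sup>2 / 2) / \<sigma>" for p
  have [measurable]: "\<gamma> \<in> borel_measurable borel" unfolding \<gamma>_def by measurable
  have \<gamma>: "\<gamma> p \<le> exp (\<sigma>\<^sup>2 / 2 + q) / \<sigma> * exp (- p)" "\<gamma> p \<ge> 0" for p
  proof -
    \<comment> \<open>Completing the square: x^2 / 2 \<ge> \<sigma> x - \<sigma>^2 / 2 at x = (p -
      q) / \<sigma>, which trades the Gaussian for e^(- p).\<close>
    have "0 \<le> ((p - q) / \<sigma> - \<sigma>)\<^sup>2" by simp
    hence "- ((p - q) / \<sigma>)\<^sup>2 / 2 \<le> \<sigma>\<^sup>2 / 2 + q - p"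
      using \<sigma> by (simp add: power2_diff)
    thus "\<gamma> p \<le> exp (\<sigma>\<^sup>2 / 2 + q) / \<sigma> * exp (- p)"
      unfolding \<gamma>_def using \<sigma> by (simp add: divide_right_mono flip: exp_add)
    show "\<gamma> p \<ge> 0" using \<sigma> by (simp add: \<gamma>_def)
  qed
  have trunc: "(LBINT y. truncated_fourier R u y * gaussian_wave \<sigma> q y) =
      (LBINT p. indicator {0<..R} p *\<^sub>R (u p * of_real (\<gamma> p)))" for R
  proof -
    have "(LBINT y. truncated_fourier R u y * gaussian_wave \<sigma> q y) =
        (LBINT y. LBINT p. (indicator {0<..R} p *\<^sub>R u p) * cis ((p - q) * y) * of_real (exp (- (\<sigma> * y)\<^sup>2 / 2)) / of_real (sqrt (2 * pi)))"
    proof (rule Bochner_Integration.integral_cong[OF refl])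
      fix y
      have "truncated_fourier R u y * gaussian_wave \<sigma> q y =
          (LBINT p. indicator {0<..R} p *\<^sub>R (u p * cis (p * y))) * (gaussian_wave \<sigma> q y / of_real (sqrt (2 * pi)))"
        by (simp add: truncated_fourier_def set_lebesgue_integral_def)
      also have "\<dots> = (LBINT p. indicator {0<..R} p *\<^sub>R (u p * cis (p * y)) * (gaussian_wave \<sigma> q y / of_real (sqrt (2 * pi))))"
        by (rule integral_mult_left_zero[symmetric])
      also have "\<dots> = (LBINT p. (indicator {0<..R} p *\<^sub>R u p) * cis ((p - q) * y) * of_real (exp (- (\<sigma> * y)\<^sup>2 / 2)) / of_real (sqrt (2 * pi)))"
      proof (rule Bochner_Integration.integral_cong[OF refl])
        fix p
        have "cis ((p - q) * y) = cis (p * y) * cis (- (q * y))" by (simp add: cis_mult algebra_simps)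
        thus "indicator {0<..R} p *\<^sub>R (u p * cis (p * y)) * (gaussian_wave \<sigma> q y / of_real (sqrt (2 * pi))) =
            (indicator {0<..R} p *\<^sub>R u p) * cis ((p - q) * y) * of_real (exp (- (\<sigma> * y)\<^sup>2 / 2)) / of_real (sqrt (2 * pi))"
          by (simp add: gaussian_wave_def)
      qed
      finally show "truncated_fourier R u y * gaussian_wave \<sigma> q y = \<dots>" .
    qed
    also have "\<dots> = (LBINT p. LBINT y. (indicator {0<..R} p *\<^sub>R u p) * cis ((p - q) * y) * of_real (exp (- (\<sigma> * y)\<^sup>2 / 2)) / of_real (sqrt (2 * pi)))"
    proof (rule Fubini_product_bound)
      show "integrable lborel (\<lambda>y. exp (- (\<sigma> * y)\<^sup>2 / 2) / sqrt (2 * pi))"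
        using integrable_gaussian[OF \<sigma>] by simp
      show "integrable lborel (\<lambda>p. exp R * (indicator {0<..} p * (cmod (u p) * exp (- p))))"
        using W by (rule integrable_mult_right)
      show "norm ((indicator {0<..R} p *\<^sub>R u p) * cis ((p - q) * y) * of_real (exp (- (\<sigma> * y)\<^sup>2 / 2)) / of_real (sqrt (2 * pi))) \<le>
          exp (- (\<sigma> * y)\<^sup>2 / 2) / sqrt (2 * pi) * (exp R * (indicator {0<..} p * (cmod (u p) * exp (- p))))" for y p
      proof (cases "0 < p \<and> p \<le> R")
        case True
        hence "1 \<le> exp R * exp (- p)" by (simp flip: exp_add)
        hence "cmod (u p) * 1 \<le> cmod (u p) * (exp R * exp (- p))" by (intro mult_left_mono) auto
        hence "exp (- (\<sigma> * y)\<^sup>2 / 2) / sqrt (2 * pi) * cmod (u p) \<le> exp (- (\<sigma> * y)\<^sup>2 / 2) / sqrt (2 * pi) * (cmod (u p) * (exp R * exp (- p)))"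
          by (intro mult_left_mono) auto
        thus ?thesis using True by (simp add: norm_mult norm_divide mult_ac)
      qed (auto split: split_indicator)
    qed measurable
    also have "\<dots> = (LBINT p. indicator {0<..R} p *\<^sub>R (u p * of_real (\<gamma> p)))"
    proof (rule Bochner_Integration.integral_cong[OF refl])
      fix p
      have "(LBINT y. (indicator {0<..R} p *\<^sub>R u p) * cis ((p - q) * y) * of_real (exp (- (\<sigma> * y)\<^sup>2 / 2)) / of_real (sqrt (2 * pi))) =
          (LBINT y. (indicator {0<..R} p *\<^sub>R u p) / of_real (sqrt (2 * pi)) * (of_real (exp (- (\<sigma> * y)\<^sup>2 / 2)) * cis ((p - q) * y)))"
        by (rule Bochner_Integration.integral_cong[OF refl]) simp
      also have "\<dots> = (indicator {0<..R} p *\<^sub>R u p) / of_real (sqrt (2 * pi)) * (LBINT y. of_real (exp (- (\<sigma> * y)\<^sup>2 / 2)) * cis ((p - q) * y))"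
        by (rule integral_mult_right_zero)
      also have "\<dots> = indicator {0<..R} p *\<^sub>R (u p * of_real (\<gamma> p))"
        unfolding gaussian_fourier[OF \<sigma>] \<gamma>_def by (simp add: scaleR_conv_of_real)
      finally show "(LBINT y. (indicator {0<..R} p *\<^sub>R u p) * cis ((p - q) * y) * of_real (exp (- (\<sigma> * y)\<^sup>2 / 2)) / of_real (sqrt (2 * pi))) =
          indicator {0<..R} p *\<^sub>R (u p * of_real (\<gamma> p))" .
    qed
    finally show ?thesis .
  qed
  have "((\<lambda>R. LBINT y. truncated_fourier R u y * gaussian_wave \<sigma> q y) \<longlongrightarrow> (LBINT y. f y * gaussian_wave \<sigma> q y)) at_top"
    using F schwartz_gaussian_wave[OF \<sigma>] unfolding fourier_integral_def by blast
  moreover have "((\<lambda>R. LBINT p. indicator {0<..R} p *\<^sub>R (u p * of_real (\<gamma> p))) \<longlongrightarrow>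
      (LBINT p. indicator {0<..} p *\<^sub>R (u p * of_real (\<gamma> p)))) at_top"
  proof (rule integral_dominated_convergence_at_top[where w = "\<lambda>p. exp (\<sigma>\<^sup>2 / 2 + q) / \<sigma> * (indicator {0<..} p * (cmod (u p) * exp (- p)))"])
    show "integrable lborel (\<lambda>p. exp (\<sigma>\<^sup>2 / 2 + q) / \<sigma> * (indicator {0<..} p * (cmod (u p) * exp (- p))))"
      using W by (rule integrable_mult_right)
    show "AE p in lborel. ((\<lambda>R. indicator {0<..R} p *\<^sub>R (u p * of_real (\<gamma> p))) \<longlongrightarrow> indicator {0<..} p *\<^sub>R (u p * of_real (\<gamma> p))) at_top"
    proof (rule AE_I2, rule tendsto_eventually)
      fix p :: real
      show "\<forall>\<^sub>F R in at_top. indicator {0<..R} p *\<^sub>R (u p * complex_of_real (\<gamma> p)) = indicator {0<..} p *\<^sub>R (u p * of_real (\<gamma> p))"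
        using eventually_ge_at_top[of p] by eventually_elim (auto split: split_indicator)
    qed
    have "cmod (u p * of_real (\<gamma> p)) \<le> exp (\<sigma>\<^sup>2 / 2 + q) / \<sigma> * (cmod (u p) * exp (- p))" for p
      using mult_left_mono[OF \<gamma>(1)[of p], of "cmod (u p)"] \<gamma>(2)[of p] by (simp add: norm_mult mult_ac)
    thus "\<forall>\<^sub>F R in at_top. AE p in lborel. norm (indicator {0<..R} p *\<^sub>R (u p * complex_of_real (\<gamma> p))) \<le>
        exp (\<sigma>\<^sup>2 / 2 + q) / \<sigma> * (indicator {0<..} p * (cmod (u p) * exp (- p)))"
      using \<sigma> by (intro always_eventually allI AE_I2) (auto split: split_indicator)
  qed measurable
  ultimately show ?thesis
    unfolding trunc \<gamma>_def by (rule tendsto_unique[OF trivial_limit_at_top_linorder])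
qed

lemma integrable_gaussian_exp_abs: "integrable lborel (\<lambda>z::real. exp (\<bar>z\<bar> - z\<^sup>2 / 2))"
proof (rule Bochner_Integration.integrable_bound)
  show "integrable lborel (\<lambda>z::real. exp 1 * exp (- (1 / sqrt 2 * z)\<^sup>2 / 2))"
    by (intro integrable_mult_right integrable_gaussian) simp
  show "AE z in lborel. norm (exp (\<bar>z\<bar> - z\<^sup>2 / 2)) \<le> norm (exp 1 * exp (- (1 / sqrt 2 * z)\<^sup>2 / 2))"
  proof (rule AE_I2)
    fix z :: real
    have "0 \<le> (\<bar>z\<bar> / 2 - 1)\<^sup>2" by simp
    hence "\<bar>z\<bar> - z\<^sup>2 / 2 \<le> 1 - z\<^sup>2 / 4" by (simp add: power2_eq_square algebra_simps)
    thus "norm (exp (\<bar>z\<bar> - z\<^sup>2 / 2)) \<le> norm (exp 1 * exp (- (1 / sqrt 2 * z)\<^sup>2 / 2))"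
      by (simp add: power_mult_distrib power_divide flip: exp_add)
  qed
qed simp

text \<open>The Gaussian pairings at \<open>q\<close> tend to \<open>fourier f q\<close>, but in
  momentum space they are Gaussian averages of a merely measurable \<open>u\<close>, for which no
  pointwise limit is at hand. Integration over \<open>q\<close> in an interval moves the averaging
  from \<open>u\<close> to the indicator of the interval, which converges away from the two
  endpoints.\<close>

lemma interval_integral_fourier:
  assumes u: "wave_function u" and F: "fourier_integral u f"
  shows "(LBINT q:{a..b}. fourier f q) = (LBINT q:{a..b}. indicator {0<..} q *\<^sub>R (of_real (sqrt (2 * pi)) * u q))"
proof -
  note W = wave_function_integrable_exp(1)[OF u]
  note [measurable] = wave_function_integrable_exp(2)[OF u]
  have f: "integrable lborel f" using F by (simp add: fourier_integral_def)
  have [measurable]: "f \<in> borel_measurable borel" using f by (auto dest: borel_measurable_integrable)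
  define s where "s n = 1 / real (Suc n)" for n
  have s: "s n > 0" "s n \<le> 1" for n by (auto simp: s_def)
  have s0: "s \<longlonglongrightarrow> 0" unfolding s_def by real_asymp
  define M where "M = (LBINT y. cmod (f y))"
  have gw: "cmod (gaussian_wave \<sigma> q y) \<le> 1" for \<sigma> q y by (simp add: gaussian_wave_def norm_mult)
  have ii: "integrable lborel (\<lambda>q. indicator {a..b} q * c)" for c :: real
    by (intro integrable_mult_left integrable_real_indicator) (auto simp: emeasure_lborel_Icc_eq)
  have lhs: "(\<lambda>n. LBINT q:{a..b}. LBINT y. f y * gaussian_wave (s n) q y) \<longlonglongrightarrow> (LBINT q:{a..b}. fourier f q)"
    unfolding set_lebesgue_integral_def
  proof (rule integral_dominated_convergence[where w = "\<lambda>q. indicator {a..b} q * M"])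
    have "(\<lambda>n. LBINT y. f y * gaussian_wave (s n) q y) \<longlonglongrightarrow> (LBINT y. f y * cis (- (q * y)))" for q
    proof (rule integral_dominated_convergence[where w = "\<lambda>y. cmod (f y)"])
      have "(\<lambda>n. gaussian_wave (s n) q y) \<longlonglongrightarrow> of_real (exp (- (0 * y)\<^sup>2 / 2)) * cis (- (q * y))" for y
        unfolding gaussian_wave_def by (intro tendsto_intros s0) auto
      thus "AE y in lborel. (\<lambda>n. f y * gaussian_wave (s n) q y) \<longlonglongrightarrow> f y * cis (- (q * y))"
        by (intro AE_I2 tendsto_intros) auto
      show "AE y in lborel. cmod (f y * gaussian_wave (s n) q y) \<le> cmod (f y)" for n
        using gw by (intro AE_I2) (auto simp: norm_mult intro!: mult_right_le_one_le)
    qed (use f in auto)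
    thus "AE q in lborel. (\<lambda>n. indicator {a..b} q *\<^sub>R (LBINT y. f y * gaussian_wave (s n) q y)) \<longlonglongrightarrow> indicator {a..b} q *\<^sub>R fourier f q"
      unfolding fourier_def by (intro AE_I2 tendsto_intros) (simp add: mult.commute)
    have "cmod (LBINT y. f y * gaussian_wave (s n) q y) \<le> M" for n q
    proof -
      have "cmod (LBINT y. f y * gaussian_wave (s n) q y) \<le> (LBINT y. cmod (f y * gaussian_wave (s n) q y))"
        by (rule Bochner_Integration.integral_norm_bound)
      also have "\<dots> \<le> M" unfolding M_def
        by (rule Bochner_Integration.integral_mono_AE')
          (use f gw in \<open>auto simp: norm_mult intro!: mult_right_le_one_le\<close>)
      finally show ?thesis .
    qed
    thus "AE q in lborel. norm (indicator {a..b} q *\<^sub>R (LBINT y. f y * gaussian_wave (s n) q y)) \<le> indicator {a..b} q * M" for n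
      by (intro AE_I2) (auto split: split_indicator)
    show "(\<lambda>q. indicator {a..b} q *\<^sub>R (LBINT y. f y * gaussian_wave (s n) q y)) \<in> borel_measurable lborel" for n
      unfolding gaussian_wave_def by measurable
  qed (use ii in auto)
  \<comment> \<open>The indicator of [a, b] smoothed by an unnormalised Gaussian of scale
    \<open>s n\<close>; hence the factor sqrt(2\<pi>) in its limit.\<close>
  define P where "P n p = (LBINT z. indicator {a..b} (p - s n * z) * exp (- z\<^sup>2 / 2))" for n p
  have [measurable]: "P n \<in> borel_measurable borel" for n unfolding P_def by measurable
  define K where "K = (LBINT z::real. exp (\<bar>z\<bar> - z\<^sup>2 / 2))"
  have gi: "integrable lborel (\<lambda>z::real. exp (- z\<^sup>2 / 2))" using integrable_gaussian[of 1] by simp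
  have gv: "(LBINT z. exp (- z\<^sup>2 / 2)) = sqrt (2 * pi)"
    using gaussian_fourier[of 1 0] by (simp flip: of_real_mult)
  have rhs: "(LBINT q:{a..b}. LBINT y. f y * gaussian_wave (s n) q y) =
      (LBINT p. indicator {0<..} p *\<^sub>R (u p * of_real (P n p)))" for n
  proof -
    define \<sigma> where "\<sigma> = s n"
    have \<sigma>: "\<sigma> > 0" using s by (simp add: \<sigma>_def)
    have "(LBINT q:{a..b}. LBINT y. f y * gaussian_wave \<sigma> q y) =
        (LBINT q. LBINT p. indicator {a..b} q *\<^sub>R indicator {0<..} p *\<^sub>R (u p * of_real (exp (- ((p - q) / \<sigma>)\<^sup>2 / 2) / \<sigma>)))"
      unfolding gaussian_wave_pairing[OF u F \<sigma>] set_lebesgue_integral_def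
      by (rule Bochner_Integration.integral_cong[OF refl], rule integral_scaleR_right[symmetric])
    also have "\<dots> = (LBINT p. LBINT q. indicator {a..b} q *\<^sub>R indicator {0<..} p *\<^sub>R (u p * of_real (exp (- ((p - q) / \<sigma>)\<^sup>2 / 2) / \<sigma>)))"
    proof (rule Fubini_product_bound)
      show "integrable lborel (\<lambda>q. indicator {a..b} q * (exp (\<sigma>\<^sup>2 / 2 + b) / \<sigma>))" by (rule ii)
      show "norm (indicator {a..b} q *\<^sub>R indicator {0<..} p *\<^sub>R (u p * complex_of_real (exp (- ((p - q) / \<sigma>)\<^sup>2 / 2) / \<sigma>))) \<le>
          indicator {a..b} q * (exp (\<sigma>\<^sup>2 / 2 + b) / \<sigma>) * (indicator {0<..} p * (cmod (u p) * exp (- p)))" for q p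
      proof (cases "a \<le> q \<and> q \<le> b \<and> p > 0")
        case True
        have "0 \<le> ((p - q) / \<sigma> - \<sigma>)\<^sup>2" by simp
        hence "- ((p - q) / \<sigma>)\<^sup>2 / 2 \<le> \<sigma>\<^sup>2 / 2 + q - p" using \<sigma> by (simp add: power2_diff)
        hence "- ((p - q) / \<sigma>)\<^sup>2 / 2 \<le> (\<sigma>\<^sup>2 / 2 + b) + - p" using True by linarith
        hence "exp (- ((p - q) / \<sigma>)\<^sup>2 / 2) \<le> exp (\<sigma>\<^sup>2 / 2 + b) * exp (- p)" unfolding exp_add[symmetric] by simp
        hence "exp (- ((p - q) / \<sigma>)\<^sup>2 / 2) / \<sigma> \<le> exp (\<sigma>\<^sup>2 / 2 + b) * exp (- p) / \<sigma>"
          using \<sigma> by (intro divide_right_mono) auto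
        from mult_left_mono[OF this, of "cmod (u p)"] show ?thesis
          using True \<sigma> by (simp add: norm_mult norm_divide mult_ac)
      qed (auto split: split_indicator)
    qed (use W in measurable)
    also have "\<dots> = (LBINT p. indicator {0<..} p *\<^sub>R (u p * of_real (P n p)))"
    proof (rule Bochner_Integration.integral_cong[OF refl])
      fix p
      have "(LBINT q. indicator {a..b} q *\<^sub>R indicator {0<..} p *\<^sub>R (u p * complex_of_real (exp (- ((p - q) / \<sigma>)\<^sup>2 / 2) / \<sigma>))) =
          (LBINT q. (indicator {0<..} p *\<^sub>R u p) * of_real (indicator {a..b} q * (exp (- ((p - q) / \<sigma>)\<^sup>2 / 2) / \<sigma>)))"
        by (rule Bochner_Integration.integral_cong[OF refl]) (auto split: split_indicator)
      also have "\<dots> = (indicator {0<..} p *\<^sub>R u p) * of_real (LBINT q. indicator {a..b} q * (exp (- ((p - q) / \<sigma>)\<^sup>2 / 2) / \<sigma>))"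
        by (simp only: integral_mult_right_zero integral_complex_of_real)
      also have "(LBINT q. indicator {a..b} q * (exp (- ((p - q) / \<sigma>)\<^sup>2 / 2) / \<sigma>)) = P n p"
        unfolding P_def using \<sigma>
        by (subst lborel_integral_real_affine[of "- \<sigma>" _ p]) (auto simp: \<sigma>_def[symmetric])
      finally show "(LBINT q. indicator {a..b} q *\<^sub>R indicator {0<..} p *\<^sub>R (u p * complex_of_real (exp (- ((p - q) / \<sigma>)\<^sup>2 / 2) / \<sigma>))) =
          indicator {0<..} p *\<^sub>R (u p * of_real (P n p))" by simp
    qed
    finally show ?thesis unfolding \<sigma>_def .
  qed
  \<comment> \<open>Where the indicator does not vanish, p \<le> b + |z| because
    \<open>s n \<le> 1\<close>, hence 1 \<le> e^(b - p + |z|). The resulting decay e^(- p) matches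
    the integrability of \<open>u\<close>.\<close>
  have Pb: "\<bar>P n p\<bar> \<le> exp b * K * exp (- p)" for n p
  proof -
    have "norm (P n p) \<le> (LBINT z. exp (b - p) * exp (\<bar>z\<bar> - z\<^sup>2 / 2))"
      unfolding P_def
    proof (rule order_trans[OF Bochner_Integration.integral_norm_bound Bochner_Integration.integral_mono_AE'])
      show "integrable lborel (\<lambda>z. exp (b - p) * exp (\<bar>z\<bar> - z\<^sup>2 / 2))"
        using integrable_gaussian_exp_abs by (rule integrable_mult_right)
      show "AE z in lborel. norm (indicator {a..b} (p - s n * z) * exp (- z\<^sup>2 / 2)) \<le> exp (b - p) * exp (\<bar>z\<bar> - z\<^sup>2 / 2)"
      proof (rule AE_I2)
        fix z :: real
        show "norm (indicator {a..b} (p - s n * z) * exp (- z\<^sup>2 / 2)) \<le> exp (b - p) * exp (\<bar>z\<bar> - z\<^sup>2 / 2)"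
        proof (cases "p - s n * z \<le> b")
          case True
          have "s n * z \<le> \<bar>s n * z\<bar>" by simp
          also have "\<dots> \<le> 1 * \<bar>z\<bar>" unfolding abs_mult using s[of n] by (intro mult_right_mono) auto
          finally have "- z\<^sup>2 / 2 \<le> b - p + (\<bar>z\<bar> - z\<^sup>2 / 2)" using True by linarith
          hence "exp (- z\<^sup>2 / 2) \<le> exp (b - p) * exp (\<bar>z\<bar> - z\<^sup>2 / 2)" unfolding exp_add[symmetric] by simp
          thus ?thesis by (auto split: split_indicator intro: order_trans)
        qed auto
      qed
    qed simp
    also have "\<dots> = exp b * K * exp (- p)" by (simp add: K_def exp_diff exp_minus field_simps)
    finally show ?thesis by simp
  qed
  have Plim: "(\<lambda>n. P n p) \<longlonglongrightarrow> indicator {a..b} p * sqrt (2 * pi)" if p: "p \<noteq> a" "p \<noteq> b" for p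
  proof -
    have "(\<lambda>n. P n p) \<longlonglongrightarrow> (LBINT z. indicator {a..b} p * exp (- z\<^sup>2 / 2))"
      unfolding P_def
    proof (rule integral_dominated_convergence[where w = "\<lambda>z. exp (- z\<^sup>2 / 2)"])
      show "AE z in lborel. (\<lambda>n. indicator {a..b} (p - s n * z) * exp (- z\<^sup>2 / 2)) \<longlonglongrightarrow> indicator {a..b} p * exp (- z\<^sup>2 / 2)"
      proof (rule AE_I2)
        fix z :: real
        have l: "(\<lambda>n. p - s n * z) \<longlonglongrightarrow> p - 0 * z" by (intro tendsto_intros s0)
        have "\<forall>\<^sub>F n in sequentially. (indicator {a..b} (p - s n * z) :: real) = indicator {a..b} p"
        proof (cases "a < p \<and> p < b")
          case True
          have "\<forall>\<^sub>F n in sequentially. a < p - s n * z" "\<forall>\<^sub>F n in sequentially. p - s n * z < b"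
            using order_tendstoD[OF l] True by auto
          thus ?thesis by eventually_elim (use True in auto)
        next
          case False
          hence "p < a \<or> b < p" using p by auto
          thus ?thesis
          proof
            assume pa: "p < a"
            have "\<forall>\<^sub>F n in sequentially. p - s n * z < a" using order_tendstoD(2)[OF l] pa by auto
            thus ?thesis by eventually_elim (use pa in auto)
          next
            assume pb: "b < p"
            have "\<forall>\<^sub>F n in sequentially. b < p - s n * z" using order_tendstoD(1)[OF l] pb by auto
            thus ?thesis by eventually_elim (use pb in auto)
          qed
        qed
        thus "(\<lambda>n. indicator {a..b} (p - s n * z) * exp (- z\<^sup>2 / 2)) \<longlonglongrightarrow> indicator {a..b} p * exp (- z\<^sup>2 / 2)"
          by (intro tendsto_eventually) (auto elim: eventually_mono)
      qed
    qed (use gi in \<open>auto split: split_indicator\<close>)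
    thus ?thesis using gv by simp
  qed
  have "(\<lambda>n. LBINT p. indicator {0<..} p *\<^sub>R (u p * of_real (P n p))) \<longlonglongrightarrow>
      (LBINT p. indicator {0<..} p *\<^sub>R (u p * of_real (indicator {a..b} p * sqrt (2 * pi))))"
  proof (rule integral_dominated_convergence[where w = "\<lambda>p. exp b * K * (indicator {0<..} p * (cmod (u p) * exp (- p)))"])
    show "integrable lborel (\<lambda>p. exp b * K * (indicator {0<..} p * (cmod (u p) * exp (- p))))"
      using W by (rule integrable_mult_right)
    show "AE p in lborel. (\<lambda>n. indicator {0<..} p *\<^sub>R (u p * of_real (P n p))) \<longlonglongrightarrow>
        indicator {0<..} p *\<^sub>R (u p * of_real (indicator {a..b} p * sqrt (2 * pi)))"
      using AE_lborel_singleton[of a] AE_lborel_singleton[of b]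
    proof eventually_elim
      fix p assume "p \<noteq> a" "p \<noteq> b"
      thus "(\<lambda>n. indicator {0<..} p *\<^sub>R (u p * complex_of_real (P n p))) \<longlonglongrightarrow>
        indicator {0<..} p *\<^sub>R (u p * of_real (indicator {a..b} p * sqrt (2 * pi)))"
        by (intro tendsto_intros Plim)
    qed
    have "cmod (u p * of_real (P n p)) \<le> exp b * K * (cmod (u p) * exp (- p))" for n p
      using mult_left_mono[OF Pb[of n p], of "cmod (u p)"] by (simp add: norm_mult mult_ac)
    thus "AE p in lborel. norm (indicator {0<..} p *\<^sub>R (u p * complex_of_real (P n p))) \<le>
        exp b * K * (indicator {0<..} p * (cmod (u p) * exp (- p)))" for n
      by (intro AE_I2) (auto split: split_indicator)
  qed measurable
  hence "(LBINT q:{a..b}. fourier f q) = (LBINT p. indicator {0<..} p *\<^sub>R (u p * of_real (indicator {a..b} p * sqrt (2 * pi))))"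
    using LIMSEQ_unique[OF lhs] unfolding rhs by blast
  also have "\<dots> = (LBINT q:{a..b}. indicator {0<..} q *\<^sub>R (of_real (sqrt (2 * pi)) * u q))"
    unfolding set_lebesgue_integral_def
    by (rule Bochner_Integration.integral_cong[OF refl]) (auto split: split_indicator)
  finally show ?thesis .
qed

text \<open>Equality of all interval integrals gives equality almost everywhere. The comparison is
  made on each [-n, n], since only local integrability is at hand, and countably many null sets are
  joined.\<close>

theorem fourier_integral_imp_AE_fourier:
  assumes u: "wave_function u" and F: "fourier_integral u f"
  shows "AE p in lborel. fourier f p = indicator {0<..} p *\<^sub>R (of_real (sqrt (2 * pi)) * u p)"
proof -
  note W = wave_function_integrable_exp(1)[OF u]
  note [measurable] = wave_function_integrable_exp(2)[OF u]
  have f: "integrable lborel f" using F by (simp add: fourier_integral_def)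
  have [measurable]: "f \<in> borel_measurable borel" using f by (auto dest: borel_measurable_integrable)
  define g where "g p = indicator {0<..} p *\<^sub>R (of_real (sqrt (2 * pi)) * u p)" for p
  have gi: "set_integrable lborel {a..b} g" for a b
    unfolding set_integrable_def
  proof (rule Bochner_Integration.integrable_bound)
    show "integrable lborel (\<lambda>p. exp b * sqrt (2 * pi) * (indicator {0<..} p * (cmod (u p) * exp (- p))))"
      using W by (rule integrable_mult_right)
    show "AE p in lborel. norm (indicator {a..b} p *\<^sub>R g p) \<le> norm (exp b * sqrt (2 * pi) * (indicator {0<..} p * (cmod (u p) * exp (- p))))"
    proof (rule AE_I2)
      fix p
      show "norm (indicator {a..b} p *\<^sub>R g p) \<le> norm (exp b * sqrt (2 * pi) * (indicator {0<..} p * (cmod (u p) * exp (- p))))"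
      proof (cases "0 < p \<and> p \<le> b")
        case True
        hence "1 \<le> exp b * exp (- p)" by (simp flip: exp_add)
        hence "(sqrt (2 * pi) * cmod (u p)) * 1 \<le> (sqrt (2 * pi) * cmod (u p)) * (exp b * exp (- p))"
          by (intro mult_left_mono) auto
        thus ?thesis using True by (auto simp: g_def norm_mult abs_mult mult_ac split: split_indicator)
      qed (auto simp: g_def split: split_indicator)
    qed
  qed (simp add: g_def)
  have fi: "set_integrable lborel {a..b} (fourier f)" for a b
    by (rule borel_integrable_atLeastAtMost') (rule continuous_on_subset[OF continuous_fourier[OF f]], simp)
  have "AE p in lborel. indicator {- real n..real n} p *\<^sub>R (fourier f p - g p) = 0" for n
  proof (rule AE_zero_if_interval_integrals_zero)
    show "integrable lborel (\<lambda>p. indicator {- real n..real n} p *\<^sub>R (fourier f p - g p))"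
      using set_integral_diff(1)[OF fi gi] unfolding set_integrable_def .
    fix a b
    have "(LBINT t:{a..b}. indicator {- real n..real n} t *\<^sub>R (fourier f t - g t)) =
        (LBINT t:{max a (- real n)..min b (real n)}. fourier f t - g t)"
      unfolding set_lebesgue_integral_def
      by (rule Bochner_Integration.integral_cong[OF refl]) (auto split: split_indicator)
    also have "\<dots> = 0"
      unfolding set_integral_diff(2)[OF fi gi] unfolding g_def using interval_integral_fourier[OF u F] by simp
    finally show "(LBINT t:{a..b}. indicator {- real n..real n} t *\<^sub>R (fourier f t - g t)) = 0" .
  qed
  hence "AE p in lborel. \<forall>n. indicator {- real n..real n} p *\<^sub>R (fourier f p - g p) = 0"
    unfolding AE_all_countable by blast
  thus ?thesis
  proof eventually_elim
    fix p assume *: "\<forall>n. indicator {- real n..real n} p *\<^sub>R (fourier f p - g p) = 0"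
    obtain n where "\<bar>p\<bar> \<le> real n" using real_arch_simple by blast
    hence "p \<in> {- real n..real n}" by auto
    thus "fourier f p = indicator {0<..} p *\<^sub>R (of_real (sqrt (2 * pi)) * u p)"
      using *[rule_format, of n] by (simp add: g_def)
  qed
qed

text \<open>Continuity of the transform turns equality almost everywhere into equality at every
  point. The approximating points lie strictly below \<open>p\<close>, so that p = 0 is included,
  where the claim is that \<open>f\<close> has integral 0.\<close>

corollary fourier_integral_fourier_nonpos:
  assumes u: "wave_function u" and F: "fourier_integral u f" and p: "p \<le> 0"
  shows "fourier f p = 0"
proof -
  have f: "integrable lborel f" using F by (simp add: fourier_integral_def)
  have "\<exists>x. p - 1 / real (Suc n) < x \<and> x < p \<and> fourier f x = indicator {0<..} x *\<^sub>R (of_real (sqrt (2 * pi)) * u x)" for n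
    by (rule AE_lborel_Ex[OF fourier_integral_imp_AE_fourier[OF u F]]) simp
  then obtain x where x: "\<And>n. p - 1 / real (Suc n) < x n" "\<And>n. x n < p"
      "\<And>n. fourier f (x n) = indicator {0<..} (x n) *\<^sub>R (of_real (sqrt (2 * pi)) * u (x n))" by metis
  have "x \<longlonglongrightarrow> p"
  proof (rule tendsto_sandwich)
    show "(\<lambda>n. p - 1 / real (Suc n)) \<longlonglongrightarrow> p" by real_asymp
  qed (use x in \<open>auto intro!: always_eventually less_imp_le\<close>)
  hence "(\<lambda>n. fourier f (x n)) \<longlonglongrightarrow> fourier f p"
    using continuous_on_tendsto_compose[OF continuous_fourier[OF f]] by auto
  moreover have "fourier f (x n) = 0" for n
  proof -
    have "x n \<le> 0" using x(2)[of n] p by linarith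
    thus ?thesis unfolding x(3) by simp
  qed
  ultimately show ?thesis by (simp add: LIMSEQ_const_iff)
qed

subsection \<open>The pairings as absolutely convergent integrals\<close>

definition sgn_transform :: "(real \<Rightarrow> real) \<Rightarrow> (real \<Rightarrow> complex) \<Rightarrow> real \<Rightarrow> complex" where
  "sgn_transform X f x = (LBINT y. f y * of_real (sgn (x - X y)))"

lemma integral_sin_kernel:
  assumes "0 < a" "a \<le> b"
  shows "(LBINT k. indicator {a..b} k * (sin (k * u) / k)) = sgn u * Si (b * \<bar>u\<bar>) - sgn u * Si (a * \<bar>u\<bar>)"
proof -
  have ii: "interval_lebesgue_integrable lborel (ereal (min 0 b)) (ereal (max 0 b)) (\<lambda>k. sin (k * u) / k)"
    using integrable_sinc'[of b u] assms by (simp add: zero_ereal_def[symmetric])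
  have "(LBINT k=0..a. sin (k * u) / k) + (LBINT k=a..b. sin (k * u) / k) = (LBINT k=0..b. sin (k * u) / k)"
    using interval_integral_sum[of "ereal 0" "ereal a" "ereal b" "\<lambda>k. sin (k * u) / k"] integrable_sinc'[of b u] assms
    by (simp add: zero_ereal_def)
  moreover have "(LBINT k=a..b. sin (k * u) / k) = (LBINT k. indicator {a..b} k * (sin (k * u) / k))"
    using assms by (simp add: interval_integral_Icc set_lebesgue_integral_def)
  ultimately show ?thesis
    using LBINT_I0c_sin_scale_divide[of a u] LBINT_I0c_sin_scale_divide[of b u] assms
    by (simp add: zero_ereal_def)
qed

text \<open>\<open>sgn u * Si (c * \<bar>u\<bar>)\<close> is the integral of sin(k u) / k over 0 < k
  < c: up to a constant, this is the contribution of the momenta below \<open>c\<close> to a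
  pairing.\<close>

definition Si_transform :: "(real \<Rightarrow> real) \<Rightarrow> (real \<Rightarrow> complex) \<Rightarrow> (real \<Rightarrow> complex) \<Rightarrow> real \<Rightarrow> complex" where
  "Si_transform X \<gamma> f c = (LBINT x. \<gamma> x * (LBINT y. f y * of_real (sgn (x - X y) * Si (c * \<bar>x - X y\<bar>))))"

lemma Si_transform_tendsto:
  assumes \<gamma>: "integrable lborel \<gamma>" and f: "integrable lborel f" and X[measurable]: "X \<in> borel_measurable borel"
  shows "(Si_transform X \<gamma> f \<longlongrightarrow> of_real (pi / 2) * (LBINT x. \<gamma> x * sgn_transform X f x)) at_top" (is ?top)
    and "(Si_transform X \<gamma> f \<longlongrightarrow> 0) (at_right 0)" (is ?zero)
proof -
  have [measurable]: "f \<in> borel_measurable borel" "\<gamma> \<in> borel_measurable borel"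
    using f \<gamma> by (auto dest: borel_measurable_integrable)
  obtain B where B: "\<And>T. \<bar>Si T\<bar> \<le> B" using bounded_Si by blast
  have B0: "B \<ge> 0" using B[of 0] by linarith
  define S where "S c u = sgn u * Si (c * \<bar>u\<bar>)" for c u :: real
  have S: "\<bar>S c u\<bar> \<le> B" for c u
    using B[of "c * \<bar>u\<bar>"] B0 by (auto simp: S_def abs_mult sgn_real_def)
  define M where "M = (LBINT y. cmod (f y))"
  \<comment> \<open>Both limits are dominated by means of the bound on Si. The reparametrisation
    \<open>h\<close> covers them together: the identity for large \<open>c\<close>, the inverse for
    \<open>c\<close> tending to 0.\<close>
  have gen: "((\<lambda>c. LBINT x. \<gamma> x * (LBINT y. f y * of_real (S (h c) (x - X y)))) \<longlongrightarrow>
      (LBINT x. \<gamma> x * (LBINT y. f y * of_real (L (x - X y))))) at_top"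
    if lim: "\<And>u. ((\<lambda>c. S (h c) u) \<longlongrightarrow> L u) at_top" and [measurable]: "L \<in> borel_measurable borel" for h :: "real \<Rightarrow> real" and L
  proof (rule integral_dominated_convergence_at_top[where w = "\<lambda>x. cmod (\<gamma> x) * (M * B)"])
    have "((\<lambda>c. LBINT y. f y * of_real (S (h c) (x - X y))) \<longlongrightarrow> (LBINT y. f y * of_real (L (x - X y)))) at_top" for x
    proof (rule integral_dominated_convergence_at_top[where w = "\<lambda>y. cmod (f y) * B"])
      show "AE y in lborel. ((\<lambda>c. f y * complex_of_real (S (h c) (x - X y))) \<longlongrightarrow> f y * of_real (L (x - X y))) at_top"
        by (intro AE_I2 tendsto_intros lim)
      show "\<forall>\<^sub>F c in at_top. AE y in lborel. cmod (f y * of_real (S (h c) (x - X y))) \<le> cmod (f y) * B"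
        by (intro always_eventually allI AE_I2) (simp add: norm_mult S mult_left_mono)
    qed (use f in \<open>auto simp: S_def\<close>)
    thus "AE x in lborel. ((\<lambda>c. \<gamma> x * (LBINT y. f y * of_real (S (h c) (x - X y)))) \<longlongrightarrow> \<gamma> x * (LBINT y. f y * of_real (L (x - X y)))) at_top"
      by (intro AE_I2 tendsto_intros)
    have "cmod (LBINT y. f y * of_real (S c (x - X y))) \<le> M * B" for c x
    proof -
      have "cmod (LBINT y. f y * of_real (S c (x - X y))) \<le> (LBINT y. cmod (f y * of_real (S c (x - X y))))"
        by (rule Bochner_Integration.integral_norm_bound)
      also have "\<dots> \<le> (LBINT y. cmod (f y) * B)"
        by (rule Bochner_Integration.integral_mono_AE')
          (use f S B0 in \<open>auto simp: norm_mult intro!: mult_left_mono\<close>)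
      finally show ?thesis by (simp add: M_def)
    qed
    thus "\<forall>\<^sub>F c in at_top. AE x in lborel. cmod (\<gamma> x * (LBINT y. f y * of_real (S (h c) (x - X y)))) \<le> cmod (\<gamma> x) * (M * B)"
      by (auto simp: norm_mult intro!: always_eventually mult_left_mono)
  qed (use \<gamma> in \<open>auto simp: S_def\<close>)
  have "((\<lambda>c. S c u) \<longlongrightarrow> sgn u * (pi / 2)) at_top" for u
  proof (cases "u = 0")
    case False
    have "filterlim (\<lambda>c. \<bar>u\<bar> * c) at_top at_top"
      using False by (intro filterlim_tendsto_pos_mult_at_top[OF tendsto_const _ filterlim_ident]) auto
    hence "((\<lambda>c. Si (\<bar>u\<bar> * c)) \<longlongrightarrow> pi / 2) at_top" by (rule filterlim_compose[OF Si_at_top])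
    thus ?thesis unfolding S_def by (intro tendsto_intros) (simp add: mult.commute)
  qed (simp add: S_def)
  hence "((\<lambda>c. LBINT x. \<gamma> x * (LBINT y. f y * of_real (S c (x - X y)))) \<longlongrightarrow>
      (LBINT x. \<gamma> x * (LBINT y. f y * of_real (sgn (x - X y) * (pi / 2))))) at_top"
    by (rule gen) simp
  also have "(LBINT x. \<gamma> x * (LBINT y. f y * of_real (sgn (x - X y) * (pi / 2)))) =
      (LBINT x. of_real (pi / 2) * (\<gamma> x * sgn_transform X f x))"
  proof (rule Bochner_Integration.integral_cong[OF refl])
    fix x
    have "(LBINT y. f y * of_real (sgn (x - X y) * (pi / 2))) = (LBINT y. of_real (pi / 2) * (f y * of_real (sgn (x - X y))))"
      by (rule Bochner_Integration.integral_cong[OF refl]) simp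
    also have "\<dots> = of_real (pi / 2) * sgn_transform X f x"
      unfolding sgn_transform_def by (rule integral_mult_right_zero)
    finally show "\<gamma> x * (LBINT y. f y * of_real (sgn (x - X y) * (pi / 2))) = of_real (pi / 2) * (\<gamma> x * sgn_transform X f x)"
      by simp
  qed
  also have "\<dots> = of_real (pi / 2) * (LBINT x. \<gamma> x * sgn_transform X f x)"
    by (rule integral_mult_right_zero)
  finally show ?top unfolding Si_transform_def S_def .
  have "((\<lambda>c. S (inverse c) u) \<longlongrightarrow> 0) at_top" for u
  proof -
    have "((\<lambda>c. inverse c * \<bar>u\<bar>) \<longlongrightarrow> 0) at_top" by real_asymp
    hence "((\<lambda>c. Si (inverse c * \<bar>u\<bar>)) \<longlongrightarrow> Si 0) at_top"
      by (rule isCont_tendsto_compose[OF isCont_Si])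
    hence "((\<lambda>c. S (inverse c) u) \<longlongrightarrow> sgn u * Si 0) at_top" unfolding S_def by (intro tendsto_intros)
    thus ?thesis by (simp add: Si_def zero_ereal_def)
  qed
  hence "((\<lambda>c. LBINT x. \<gamma> x * (LBINT y. f y * of_real (S (inverse c) (x - X y)))) \<longlongrightarrow>
      (LBINT x. \<gamma> x * (LBINT y. f y * of_real 0))) at_top"
    by (rule gen) simp
  thus ?zero unfolding filterlim_at_right_to_top Si_transform_def S_def by simp
qed

text \<open>Since \<open>fourier g\<close> vanishes on the negative half-line, the integrand over \<open>{a..b}\<close> may be replaced
  by its sum with the one over \<open>{- b..- a}\<close>; this cancels the logarithmically divergent even part of the
  kernel and leaves \<open>sin (k u) / k\<close>.\<close>

lemma truncated_inner_eq:
  assumes g: "integrable lborel g" and f: "integrable lborel f" and X[measurable]: "X \<in> borel_measurable borel"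
    and supp: "\<And>p. p \<le> 0 \<Longrightarrow> fourier g p = 0"
    and gt_meas[measurable]: "gt \<in> borel_measurable borel"
    and gt: "AE k in lborel. k > 0 \<longrightarrow> gt k = fourier g k / of_real (sqrt (2 * pi))"
    and ab: "0 < a" "a \<le> b"
  shows "(LBINT k:{a..b}. cnj (gt k) * U_op X f k / of_real (2 * k)) =
    \<i> / of_real (2 * pi) * (Si_transform X (\<lambda>x. cnj (g x)) f b - Si_transform X (\<lambda>x. cnj (g x)) f a)"
proof -
  have [measurable]: "f \<in> borel_measurable borel" "g \<in> borel_measurable borel"
    using f g by (auto dest: borel_measurable_integrable)
  define \<gamma> where "\<gamma> x = cnj (g x)" for x
  have [measurable]: "\<gamma> \<in> borel_measurable borel" unfolding \<gamma>_def by measurable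
  have \<gamma>: "integrable lborel \<gamma>" unfolding \<gamma>_def using g by simp
  define H where "H k = (LBINT y. cis (- (k * X y)) * f y)" for k
  define D where "D k = (LBINT x. cis (k * x) * \<gamma> x)" for k
  have [measurable]: "H \<in> borel_measurable borel" "D \<in> borel_measurable borel"
    unfolding H_def D_def by measurable
  have D: "D k = cnj (fourier g k)" for k
    unfolding D_def fourier_def \<gamma>_def Bochner_Integration.integral_cnj[symmetric] by (simp add: cis_cnj)
  have DH: "D k * H k = (LBINT x. LBINT y. \<gamma> x * f y * cis (k * (x - X y)))" for k
  proof -
    have "D k * H k = (LBINT x. cis (k * x) * \<gamma> x * H k)"
      unfolding D_def by (rule integral_mult_left_zero[symmetric])
    also have "\<dots> = (LBINT x. LBINT y. \<gamma> x * f y * cis (k * (x - X y)))"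
    proof (rule Bochner_Integration.integral_cong[OF refl])
      fix x
      have "cis (k * x) * \<gamma> x * H k = (LBINT y. cis (k * x) * \<gamma> x * (cis (- (k * X y)) * f y))"
        unfolding H_def by (rule integral_mult_right_zero[symmetric])
      also have "\<dots> = (LBINT y. \<gamma> x * f y * cis (k * (x - X y)))"
        by (rule Bochner_Integration.integral_cong[OF refl]) (auto simp: cis_mult algebra_simps)
      finally show "cis (k * x) * \<gamma> x * H k = \<dots>" .
    qed
    finally show ?thesis .
  qed
  have fi: "integrable lborel (\<lambda>y. f y * h y)" if "h \<in> borel_measurable borel" "\<And>y. cmod (h y) \<le> 1" for h
    using integrable_bounded_mult[OF f that] by (simp add: mult.commute)
  \<comment> \<open>What remains of e^(i k (x - X y)), integrated against \<open>f\<close>, after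
    antisymmetrising in \<open>k\<close>, up to the factor 2 i.\<close>
  define J where "J k x = (LBINT y. f y * of_real (sin (k * (x - X y))))" for k x
  have Jm: "(\<lambda>z. J (fst z) (snd z)) \<in> borel_measurable (borel \<Otimes>\<^sub>M borel)"
    unfolding J_def by measurable
  define M where "M = (LBINT y. cmod (f y))"
  have J: "cmod (J k x) \<le> M" for k x
  proof -
    have "cmod (J k x) \<le> (LBINT y. cmod (f y * of_real (sin (k * (x - X y)))))"
      unfolding J_def by (rule Bochner_Integration.integral_norm_bound)
    also have "\<dots> \<le> M" unfolding M_def
      by (rule Bochner_Integration.integral_mono_AE')
        (use f in \<open>auto simp: norm_mult intro!: mult_right_le_one_le\<close>)
    finally show ?thesis .
  qed
  have M0: "M \<ge> 0" unfolding M_def by simp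
  have im: "(LBINT y. \<gamma> x * f y * cis (k * (x - X y))) - (LBINT y. \<gamma> x * f y * cis (- k * (x - X y))) = 2 * \<i> * (\<gamma> x * J k x)" for k x
  proof -
    have i: "integrable lborel (\<lambda>y. \<gamma> x * f y * cis (c * (x - X y)))" for c
    proof -
      have "integrable lborel (\<lambda>y. \<gamma> x * (f y * cis (c * (x - X y))))"
        by (intro integrable_mult_right fi) auto
      thus ?thesis by (simp add: mult.assoc)
    qed
    have "(LBINT y. \<gamma> x * f y * cis (k * (x - X y))) - (LBINT y. \<gamma> x * f y * cis (- k * (x - X y))) =
        (LBINT y. \<gamma> x * f y * cis (k * (x - X y)) - \<gamma> x * f y * cis (- k * (x - X y)))"
      by (rule Bochner_Integration.integral_diff[OF i i, symmetric])
    also have "\<dots> = (LBINT y. 2 * \<i> * \<gamma> x * (f y * of_real (sin (k * (x - X y)))))"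
    proof (rule Bochner_Integration.integral_cong[OF refl])
      fix y
      have "cis (k * (x - X y)) - cis (- k * (x - X y)) = 2 * \<i> * of_real (sin (k * (x - X y)))"
        by (simp add: complex_eq_iff)
      thus "\<gamma> x * f y * cis (k * (x - X y)) - \<gamma> x * f y * cis (- k * (x - X y)) =
          2 * \<i> * \<gamma> x * (f y * of_real (sin (k * (x - X y))))"
        unfolding right_diff_distrib[symmetric] by simp
    qed
    also have "\<dots> = 2 * \<i> * \<gamma> x * J k x"
      unfolding J_def by (rule integral_mult_right_zero)
    finally show ?thesis by simp
  qed
  have odd: "D k * H k - D (- k) * H (- k) = 2 * \<i> * (LBINT x. \<gamma> x * J k x)" for k
  proof -
    have i: "integrable lborel (\<lambda>x. LBINT y. \<gamma> x * f y * cis (c * (x - X y)))" for c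
    proof -
      have "integrable (lborel \<Otimes>\<^sub>M lborel) (\<lambda>z. \<gamma> (fst z) * f (snd z) * cis (c * (fst z - X (snd z))))"
        by (rule integrable_pair_product[where a = "\<lambda>x. cmod (\<gamma> x)" and b = "\<lambda>y. cmod (f y)"])
          (use \<gamma> f in \<open>auto simp: norm_mult\<close>)
      thus ?thesis
        by (intro lborel_pair.integrable_fst) (simp add: case_prod_unfold)
    qed
    have "D k * H k - D (- k) * H (- k) = (LBINT x. (LBINT y. \<gamma> x * f y * cis (k * (x - X y))) - (LBINT y. \<gamma> x * f y * cis (- k * (x - X y))))"
      unfolding DH by (rule Bochner_Integration.integral_diff[OF i i, symmetric])
    also have "\<dots> = 2 * \<i> * (LBINT x. \<gamma> x * J k x)"
      unfolding im by (rule integral_mult_right_zero)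
    finally show ?thesis .
  qed
  have ik: "integrable lborel (\<lambda>k. indicator {a..b} k * c)" for c :: real
    by (intro integrable_mult_left integrable_real_indicator) (auto simp: emeasure_lborel_Icc_eq)
  have ka: "indicator {a..b} k * inverse \<bar>k\<bar> \<le> indicator {a..b} k * inverse a" for k
    using ab by (auto split: split_indicator)
  \<comment> \<open>The constant 1/(4\<pi>) collects 1/(2\<pi>) from the two factors 1/sqrt(2\<pi>)
    and 1/2 from dk/2k.\<close>
  have "(LBINT k:{a..b}. cnj (gt k) * U_op X f k / of_real (2 * k)) =
      (LBINT k. of_real (1 / (4 * pi)) * (of_real (indicator {a..b} k * inverse k) * (2 * \<i> * (LBINT x. \<gamma> x * J k x))))"
    unfolding set_lebesgue_integral_def
  proof (rule integral_cong_AE)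
    show "(\<lambda>k. indicator {a..b} k *\<^sub>R (cnj (gt k) * U_op X f k / of_real (2 * k))) \<in> borel_measurable lborel"
      unfolding U_op_def by measurable
    show "(\<lambda>k. of_real (1 / (4 * pi)) * (of_real (indicator {a..b} k * inverse k) * (2 * \<i> * (LBINT x. \<gamma> x * J k x)))) \<in> borel_measurable lborel"
      unfolding odd[symmetric] by measurable
    show "AE k in lborel. indicator {a..b} k *\<^sub>R (cnj (gt k) * U_op X f k / of_real (2 * k)) =
       of_real (1 / (4 * pi)) * (of_real (indicator {a..b} k * inverse k) * (2 * \<i> * (LBINT x. \<gamma> x * J k x)))"
      using gt
    proof eventually_elim
      fix k :: real assume k: "k > 0 \<longrightarrow> gt k = fourier g k / of_real (sqrt (2 * pi))"
      show "indicator {a..b} k *\<^sub>R (cnj (gt k) * U_op X f k / of_real (2 * k)) =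
         of_real (1 / (4 * pi)) * (of_real (indicator {a..b} k * inverse k) * (2 * \<i> * (LBINT x. \<gamma> x * J k x)))"
      proof (cases "k \<in> {a..b}")
        case True
        hence k0: "k > 0" using ab by auto
        have "D (- k) = 0" using supp[of "- k"] k0 by (simp add: D)
        moreover have "cnj (gt k) * U_op X f k = D k * H k / of_real (2 * pi)"
        proof -
          have 1: "cnj (gt k) = D k / of_real (sqrt (2 * pi))" using k k0 by (simp add: D)
          have 2: "U_op X f k = H k / of_real (sqrt (2 * pi))" by (simp add: U_op_def H_def)
          have 3: "complex_of_real (sqrt (2 * pi)) * of_real (sqrt (2 * pi)) = of_real (2 * pi)"
            by (simp flip: of_real_mult)
          show ?thesis by (simp only: 1 2 3 times_divide_times_eq)
        qed
        ultimately have "cnj (gt k) * U_op X f k / of_real (2 * k) = (D k * H k - D (- k) * H (- k)) / of_real (4 * pi * k)"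
          by simp
        thus ?thesis using True unfolding odd by (simp add: field_simps)
      qed simp
    qed
  qed
  also have "\<dots> = of_real (1 / (4 * pi)) * (LBINT k. of_real (indicator {a..b} k * inverse k) * (2 * \<i> * (LBINT x. \<gamma> x * J k x)))"
    by (rule integral_mult_right_zero)
  also have "(LBINT k. of_real (indicator {a..b} k * inverse k) * (2 * \<i> * (LBINT x. \<gamma> x * J k x))) =
      (LBINT k. LBINT x. of_real (indicator {a..b} k * inverse k) * (2 * \<i> * (\<gamma> x * J k x)))"
    by simp
  also have "\<dots> = (LBINT x. LBINT k. of_real (indicator {a..b} k * inverse k) * (2 * \<i> * (\<gamma> x * J k x)))"
  proof (rule Fubini_product_bound)
    show "integrable lborel (\<lambda>k. indicator {a..b} k * inverse a * (2 * M))"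
      using ik[of "inverse a * (2 * M)"] by (simp add: mult.assoc)
    show "integrable lborel (\<lambda>x. cmod (\<gamma> x))" using \<gamma> by simp
    show "norm (of_real (indicator {a..b} k * inverse k) * (2 * \<i> * (\<gamma> x * J k x))) \<le> indicator {a..b} k * inverse a * (2 * M) * cmod (\<gamma> x)" for k x
    proof -
      have "norm (of_real (indicator {a..b} k * inverse k) * (2 * \<i> * (\<gamma> x * J k x))) =
          (indicator {a..b} k * inverse \<bar>k\<bar>) * (2 * cmod (J k x)) * cmod (\<gamma> x)"
        by (simp add: norm_mult norm_inverse)
      also have "\<dots> \<le> (indicator {a..b} k * inverse a) * (2 * M) * cmod (\<gamma> x)"
        by (rule mult_right_mono[OF mult_mono[OF ka]]) (use J M0 ab in auto)
      finally show ?thesis .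
    qed
    show "(\<lambda>z. complex_of_real (indicator {a..b} (fst z) * inverse (fst z)) * (2 * \<i> * (\<gamma> (snd z) * J (fst z) (snd z)))) \<in> borel_measurable (borel \<Otimes>\<^sub>M borel)"
      using Jm by measurable
  qed
  also have "\<dots> = (LBINT x. 2 * \<i> * (\<gamma> x * (LBINT y. f y * of_real (sgn (x - X y) * Si (b * \<bar>x - X y\<bar>))) -
      \<gamma> x * (LBINT y. f y * of_real (sgn (x - X y) * Si (a * \<bar>x - X y\<bar>)))))"
  proof (rule Bochner_Integration.integral_cong[OF refl])
    fix x
    obtain B where B: "\<And>T. \<bar>Si T\<bar> \<le> B" using bounded_Si by blast
    have iS: "integrable lborel (\<lambda>y. f y * of_real (sgn (x - X y) * Si (c * \<bar>x - X y\<bar>)))" for c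
    proof -
      have "cmod (of_real (sgn (x - X y) * Si (c * \<bar>x - X y\<bar>))) \<le> B" for y
        using B[of "c * \<bar>x - X y\<bar>"] B[of 0] by (auto simp: norm_mult sgn_real_def)
      from integrable_bounded_mult[OF f _ this] show ?thesis by (simp add: mult.commute)
    qed
    have "(LBINT k. of_real (indicator {a..b} k * inverse k) * (2 * \<i> * (\<gamma> x * J k x))) =
        (LBINT k. (2 * \<i> * \<gamma> x) * (LBINT y. of_real (indicator {a..b} k * inverse k) * (f y * of_real (sin (k * (x - X y))))))"
      unfolding J_def by (rule Bochner_Integration.integral_cong[OF refl]) simp
    also have "\<dots> = (2 * \<i> * \<gamma> x) * (LBINT k. LBINT y. of_real (indicator {a..b} k * inverse k) * (f y * of_real (sin (k * (x - X y)))))"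
      by (rule integral_mult_right_zero)
    also have "(LBINT k. LBINT y. of_real (indicator {a..b} k * inverse k) * (f y * of_real (sin (k * (x - X y))))) =
        (LBINT y. LBINT k. of_real (indicator {a..b} k * inverse k) * (f y * of_real (sin (k * (x - X y)))))"
    proof (rule Fubini_product_bound)
      show "integrable lborel (\<lambda>k. indicator {a..b} k * inverse a)" by (rule ik)
      show "integrable lborel (\<lambda>y. cmod (f y))" using f by simp
      show "norm (complex_of_real (indicator {a..b} k * inverse k) * (f y * of_real (sin (k * (x - X y))))) \<le> indicator {a..b} k * inverse a * cmod (f y)" for k y
      proof -
        have "norm (complex_of_real (indicator {a..b} k * inverse k) * (f y * of_real (sin (k * (x - X y))))) =
            (indicator {a..b} k * inverse \<bar>k\<bar>) * (cmod (f y) * \<bar>sin (k * (x - X y))\<bar>)"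
          by (simp add: norm_mult norm_inverse)
        also have "\<dots> \<le> (indicator {a..b} k * inverse a) * (cmod (f y) * 1)"
          by (rule mult_mono[OF ka]) (use ab in \<open>auto simp: mult_left_le\<close>)
        finally show ?thesis by simp
      qed
    qed measurable
    also have "\<dots> = (LBINT y. f y * of_real (sgn (x - X y) * Si (b * \<bar>x - X y\<bar>)) - f y * of_real (sgn (x - X y) * Si (a * \<bar>x - X y\<bar>)))"
    proof (rule Bochner_Integration.integral_cong[OF refl])
      fix y
      have "(LBINT k. of_real (indicator {a..b} k * inverse k) * (f y * of_real (sin (k * (x - X y))))) =
          (LBINT k. f y * of_real (indicator {a..b} k * (sin (k * (x - X y)) / k)))"
        by (rule Bochner_Integration.integral_cong[OF refl]) (simp add: divide_inverse)
      also have "\<dots> = f y * of_real (LBINT k. indicator {a..b} k * (sin (k * (x - X y)) / k))"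
        by (simp only: integral_mult_right_zero integral_complex_of_real)
      finally show "(LBINT k. of_real (indicator {a..b} k * inverse k) * (f y * of_real (sin (k * (x - X y))))) =
          f y * of_real (sgn (x - X y) * Si (b * \<bar>x - X y\<bar>)) - f y * of_real (sgn (x - X y) * Si (a * \<bar>x - X y\<bar>))"
        unfolding integral_sin_kernel[OF ab] by (simp add: right_diff_distrib)
    qed
    also have "\<dots> = (LBINT y. f y * of_real (sgn (x - X y) * Si (b * \<bar>x - X y\<bar>))) - (LBINT y. f y * of_real (sgn (x - X y) * Si (a * \<bar>x - X y\<bar>)))"
      by (rule Bochner_Integration.integral_diff[OF iS iS])
    finally show "(LBINT k. of_real (indicator {a..b} k * inverse k) * (2 * \<i> * (\<gamma> x * J k x))) =
      2 * \<i> * (\<gamma> x * (LBINT y. f y * of_real (sgn (x - X y) * Si (b * \<bar>x - X y\<bar>))) -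
        \<gamma> x * (LBINT y. f y * of_real (sgn (x - X y) * Si (a * \<bar>x - X y\<bar>))))"
      by (simp add: algebra_simps)
  qed
  also have "\<dots> = 2 * \<i> * (Si_transform X \<gamma> f b - Si_transform X \<gamma> f a)"
  proof -
    obtain B where B: "\<And>T. \<bar>Si T\<bar> \<le> B" using bounded_Si by blast
    have "integrable lborel (\<lambda>x. \<gamma> x * (LBINT y. f y * of_real (sgn (x - X y) * Si (c * \<bar>x - X y\<bar>))))" for c
    proof -
      have "integrable (lborel \<Otimes>\<^sub>M lborel) (\<lambda>z. \<gamma> (fst z) * (f (snd z) * of_real (sgn (fst z - X (snd z)) * Si (c * \<bar>fst z - X (snd z)\<bar>))))"
      proof (rule integrable_pair_product[where a = "\<lambda>x. cmod (\<gamma> x)" and b = "\<lambda>y. cmod (f y) * B"])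
        fix x y
        have h: "\<bar>sgn (x - X y) * Si (c * \<bar>x - X y\<bar>)\<bar> \<le> B"
          using B[of "c * \<bar>x - X y\<bar>"] B[of 0] by (auto simp: abs_mult sgn_real_def)
        show "norm (\<gamma> (fst (x, y)) * (f (snd (x, y)) * complex_of_real (sgn (fst (x, y) - X (snd (x, y))) * Si (c * \<bar>fst (x, y) - X (snd (x, y))\<bar>)))) \<le> cmod (\<gamma> x) * (cmod (f y) * B)"
          unfolding fst_conv snd_conv norm_mult[of "\<gamma> x"] norm_mult[of "f y"] norm_of_real
          by (intro mult_left_mono h norm_ge_zero)
      qed (use \<gamma> f in auto)
      hence "integrable lborel (\<lambda>x. LBINT y. \<gamma> x * (f y * of_real (sgn (x - X y) * Si (c * \<bar>x - X y\<bar>))))"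
        by (intro lborel_pair.integrable_fst) (simp add: case_prod_unfold)
      thus ?thesis by simp
    qed
    thus ?thesis unfolding Si_transform_def
      by (simp only: integral_mult_right_zero Bochner_Integration.integral_diff)
  qed
  also have "of_real (1 / (4 * pi)) * (2 * \<i> * Z) = \<i> / of_real (2 * pi) * Z" for Z :: complex
    by (simp add: field_simps)
  finally show ?thesis unfolding \<gamma>_def[abs_def] .
qed

lemma truncated_inner_tendsto:
  assumes g: "integrable lborel g" and f: "integrable lborel f" and X: "X \<in> borel_measurable borel"
    and supp: "\<And>p. p \<le> 0 \<Longrightarrow> fourier g p = 0"
    and gt_meas: "gt \<in> borel_measurable borel"
    and gt: "AE k in lborel. k > 0 \<longrightarrow> gt k = fourier g k / of_real (sqrt (2 * pi))"
  shows "((\<lambda>(a, b). LBINT k:{a..b}. cnj (gt k) * U_op X f k / of_real (2 * k)) \<longlongrightarrow>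
    \<i> / 4 * (LBINT x. cnj (g x) * sgn_transform X f x)) (at_right 0 \<times>\<^sub>F at_top)"
proof -
  define T where "T = Si_transform X (\<lambda>x. cnj (g x)) f"
  have g': "integrable lborel (\<lambda>x. cnj (g x))" using g by simp
  have "((\<lambda>z. \<i> / of_real (2 * pi) * (T (snd z) - T (fst z))) \<longlongrightarrow>
      \<i> / of_real (2 * pi) * (of_real (pi / 2) * (LBINT x. cnj (g x) * sgn_transform X f x) - 0)) (at_right 0 \<times>\<^sub>F at_top)"
    unfolding T_def
    by (intro tendsto_intros filterlim_compose[OF Si_transform_tendsto(1)[OF g' f X] filterlim_snd]
        filterlim_compose[OF Si_transform_tendsto(2)[OF g' f X] filterlim_fst])
  moreover have "\<forall>\<^sub>F z in at_right 0 \<times>\<^sub>F at_top. \<i> / of_real (2 * pi) * (T (snd z) - T (fst z)) =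
      (case z of (a, b) \<Rightarrow> LBINT k:{a..b}. cnj (gt k) * U_op X f k / of_real (2 * k))"
  proof -
    have "\<forall>\<^sub>F a in at_right (0::real). 0 < a \<and> a < 1"
      using eventually_at_right_real[OF zero_less_one[where 'a = real]] by eventually_elim simp
    from eventually_prodI[OF this eventually_gt_at_top[of "1::real"]] show ?thesis
    proof eventually_elim
      fix z :: "real \<times> real" assume z: "(0 < fst z \<and> fst z < 1) \<and> 1 < snd z"
      have "(LBINT k:{fst z..snd z}. cnj (gt k) * U_op X f k / of_real (2 * k)) =
          \<i> / of_real (2 * pi) * (T (snd z) - T (fst z))"
        unfolding T_def by (rule truncated_inner_eq[OF g f X supp gt_meas gt]) (use z in auto)
      thus "\<i> / of_real (2 * pi) * (T (snd z) - T (fst z)) =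
          (case z of (a, b) \<Rightarrow> LBINT k:{a..b}. cnj (gt k) * U_op X f k / of_real (2 * k))"
        by (simp only: split_beta)
    qed
  qed
  ultimately have "((\<lambda>(a, b). LBINT k:{a..b}. cnj (gt k) * U_op X f k / of_real (2 * k)) \<longlongrightarrow>
      \<i> / of_real (2 * pi) * (of_real (pi / 2) * (LBINT x. cnj (g x) * sgn_transform X f x) - 0)) (at_right 0 \<times>\<^sub>F at_top)"
    by (rule Lim_transform_eventually)
  thus ?thesis by simp
qed

section \<open>The two pairings and the size of the stimulated part\<close>

lemma U_op_uminus: "U_op X f (- k) = cnj (U_op X (\<lambda>y. cnj (f y)) k)"
  unfolding U_op_def complex_cnj_divide Bochner_Integration.integral_cnj[symmetric] by (simp add: cis_cnj)

text \<open>The second pairing is the conjugate of the first with \<open>f\<close> replaced by its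
  conjugate, since conjugation exchanges U at k and at - k. The exchange is harmless because the
  limit of the pairing constrains the momentum support of \<open>g\<close> and asks only
  integrability of \<open>f\<close>.\<close>

lemma wf_inner_A_op_B_op:
  assumes g: "integrable lborel g" and f: "integrable lborel f" and X: "X \<in> borel_measurable borel"
    and supp: "\<And>p. p \<le> 0 \<Longrightarrow> fourier g p = 0"
    and gt_meas: "gt \<in> borel_measurable borel"
    and gt: "AE k in lborel. k > 0 \<longrightarrow> gt k = fourier g k / of_real (sqrt (2 * pi))"
  shows "wf_inner gt (A_op X f) = \<i> / 4 * (LBINT x. cnj (g x) * sgn_transform X f x)"
    and "wf_inner (\<lambda>k. cnj (gt k)) (B_op X f) = - \<i> / 4 * (LBINT x. g x * sgn_transform X f x)"
proof -
  show "wf_inner gt (A_op X f) = \<i> / 4 * (LBINT x. cnj (g x) * sgn_transform X f x)"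
    unfolding wf_inner_def A_op_def
    by (rule tendsto_Lim[OF _ truncated_inner_tendsto[OF g f X supp gt_meas gt]])
      (auto simp: prod_filter_eq_bot)
  have f': "integrable lborel (\<lambda>y. cnj (f y))" using f by simp
  have "((\<lambda>z. cnj (case z of (a, b) \<Rightarrow> LBINT k:{a..b}. cnj (gt k) * U_op X (\<lambda>y. cnj (f y)) k / of_real (2 * k))) \<longlongrightarrow>
      cnj (\<i> / 4 * (LBINT x. cnj (g x) * sgn_transform X (\<lambda>y. cnj (f y)) x))) (at_right 0 \<times>\<^sub>F at_top)"
    by (intro tendsto_cnj truncated_inner_tendsto[OF g f' X supp gt_meas gt])
  moreover have "(\<lambda>z. cnj (case z of (a, b) \<Rightarrow> LBINT k:{a..b}. cnj (gt k) * U_op X (\<lambda>y. cnj (f y)) k / of_real (2 * k))) =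
      (\<lambda>(a, b). LBINT k:{a..b}. cnj (cnj (gt k)) * B_op X f k / of_real (2 * k))"
    unfolding B_op_def U_op_uminus set_lebesgue_integral_def
    by (auto simp: fun_eq_iff Bochner_Integration.integral_cnj[symmetric] simp del: Bochner_Integration.integral_cnj)
  moreover have "cnj (\<i> / 4 * (LBINT x. cnj (g x) * sgn_transform X (\<lambda>y. cnj (f y)) x)) = - \<i> / 4 * (LBINT x. g x * sgn_transform X f x)"
  proof -
    have "cnj (sgn_transform X (\<lambda>y. cnj (f y)) x) = sgn_transform X f x" for x
      unfolding sgn_transform_def by (subst Bochner_Integration.integral_cnj[symmetric]) simp
    hence "cnj (LBINT x. cnj (g x) * sgn_transform X (\<lambda>y. cnj (f y)) x) = (LBINT x. g x * sgn_transform X f x)"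
      by (subst Bochner_Integration.integral_cnj[symmetric]) simp
    thus ?thesis by simp
  qed
  ultimately have "((\<lambda>(a, b). LBINT k:{a..b}. cnj (cnj (gt k)) * B_op X f k / of_real (2 * k)) \<longlongrightarrow>
      - \<i> / 4 * (LBINT x. g x * sgn_transform X f x)) (at_right 0 \<times>\<^sub>F at_top)" by simp
  thus "wf_inner (\<lambda>k. cnj (gt k)) (B_op X f) = - \<i> / 4 * (LBINT x. g x * sgn_transform X f x)"
    unfolding wf_inner_def by (intro tendsto_Lim) (auto simp: prod_filter_eq_bot)
qed

text \<open>Both pairings have modulus at most a quarter of the same integral, so each squared
  modulus contributes at most 1/16 of its square.\<close>

lemma N_induced_le:
  assumes g: "integrable lborel g" and f: "integrable lborel f" and X: "X \<in> borel_measurable borel"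
    and supp: "\<And>p. p \<le> 0 \<Longrightarrow> fourier g p = 0"
    and gt_meas: "gt \<in> borel_measurable borel"
    and gt: "AE k in lborel. k > 0 \<longrightarrow> gt k = fourier g k / of_real (sqrt (2 * pi))"
  shows "N_induced X gt f \<le> (LBINT x. cmod (g x) * cmod (sgn_transform X f x))\<^sup>2 / 8"
proof -
  define I where "I = (LBINT x. cmod (g x) * cmod (sgn_transform X f x))"
  have "cmod (LBINT x. cnj (g x) * sgn_transform X f x) \<le> I" "cmod (LBINT x. g x * sgn_transform X f x) \<le> I"
    unfolding I_def
    by (rule order_trans[OF Bochner_Integration.integral_norm_bound], simp add: norm_mult)+
  hence *: "(cmod (LBINT x. cnj (g x) * sgn_transform X f x))\<^sup>2 \<le> I\<^sup>2" "(cmod (LBINT x. g x * sgn_transform X f x))\<^sup>2 \<le> I\<^sup>2"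
    by (intro power_mono; simp)+
  show ?thesis
  proof -
    have w1: "wf_inner gt (A_op X f) = \<i> / 4 * (LBINT x. cnj (g x) * sgn_transform X f x)"
      by (rule wf_inner_A_op_B_op(1)[OF assms])
    have w2: "wf_inner (\<lambda>k. cnj (gt k)) (B_op X f) = - \<i> / 4 * (LBINT x. g x * sgn_transform X f x)"
      by (rule wf_inner_A_op_B_op(2)[OF assms])
    show ?thesis
      unfolding N_induced_def w1 w2 I_def[symmetric]
      using * by (simp add: norm_mult norm_divide power_mult_distrib power_divide)
  qed
qed

subsection \<open>Decay of the stimulated part\<close>

lemma relativistic_x_measurable [measurable]: "relativistic_x \<in> borel_measurable borel"
  unfolding relativistic_x_def by measurable

lemma sgn_transform_measurable [measurable]:
  assumes [measurable]: "X \<in> borel_measurable borel" "f \<in> borel_measurable borel"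
  shows "sgn_transform X f \<in> borel_measurable borel"
  unfolding sgn_transform_def by measurable

lemma sgn_transform_bound:
  assumes f: "integrable lborel f" and [measurable]: "X \<in> borel_measurable borel"
  shows "cmod (sgn_transform X f x) \<le> (LBINT y. cmod (f y))"
  unfolding sgn_transform_def
  by (rule order_trans[OF Bochner_Integration.integral_norm_bound Bochner_Integration.integral_mono_AE'])
    (use f in \<open>auto simp: norm_mult sgn_real_def\<close>)

lemma sgn_transform_relativistic_nonneg:
  assumes "x \<ge> 0"
  shows "sgn_transform relativistic_x f x = (LBINT y. f y)"
proof -
  have "0 < x - relativistic_x y" for y
    using assms by (simp add: relativistic_x_def add_nonneg_pos)
  hence "sgn (x - relativistic_x y) = 1" for y by (simp add: sgn_pos)
  thus ?thesis by (simp add: sgn_transform_def)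
qed

text \<open>As \<open>f\<close> has integral 0, adding 1 to the sign does not change the transform.
  For y > z the point x(y) lies to the right of \<open>x\<close> and the sign is - 1, so only y
  \<le> z contributes, with weight at most 2.\<close>

lemma sgn_transform_relativistic_bound:
  assumes f: "integrable lborel f" and f0: "(LBINT y. f y) = 0" and x: "x \<le> - exp (- z)"
  shows "cmod (sgn_transform relativistic_x f x) \<le> 2 * (LBINT y:{..z}. cmod (f y))"
proof -
  have [measurable]: "f \<in> borel_measurable borel" using f by (auto dest: borel_measurable_integrable)
  have i: "integrable lborel (\<lambda>y. f y * of_real (sgn (x - relativistic_x y)))"
    by (rule Bochner_Integration.integrable_bound[OF f]) (auto simp: norm_mult sgn_real_def)
  have i2: "integrable lborel (\<lambda>y. indicator {..z} y *\<^sub>R cmod (f y))"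
    by (rule integrable_mult_indicator) (use f in auto)
  have "sgn_transform relativistic_x f x = (LBINT y. f y * of_real (sgn (x - relativistic_x y)) + f y)"
    using i f f0 by (simp add: sgn_transform_def)
  also have "cmod \<dots> \<le> (LBINT y. cmod (f y * of_real (sgn (x - relativistic_x y)) + f y))"
    by (rule Bochner_Integration.integral_norm_bound)
  also have "\<dots> \<le> (LBINT y. 2 * (indicator {..z} y *\<^sub>R cmod (f y)))"
  proof (rule Bochner_Integration.integral_mono_AE')
    show "integrable lborel (\<lambda>y. 2 * (indicator {..z} y *\<^sub>R cmod (f y)))"
      using i2 by (rule integrable_mult_right)
    show "AE y in lborel. cmod (f y * of_real (sgn (x - relativistic_x y)) + f y) \<le> 2 * (indicator {..z} y *\<^sub>R cmod (f y))"
    proof (rule AE_I2)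
      fix y
      show "cmod (f y * of_real (sgn (x - relativistic_x y)) + f y) \<le> 2 * (indicator {..z} y *\<^sub>R cmod (f y))"
      proof (cases "y \<le> z")
        case True
        have "cmod (f y * of_real (sgn (x - relativistic_x y)) + f y) \<le> cmod (f y * of_real (sgn (x - relativistic_x y))) + cmod (f y)"
          by (rule norm_triangle_ineq)
        also have "\<dots> \<le> 2 * cmod (f y)" by (auto simp: norm_mult sgn_real_def)
        finally show ?thesis using True by simp
      next
        case False
        hence "exp (- y) < exp (- z)" by simp
        hence "x - relativistic_x y < 0" using x unfolding relativistic_x_def by linarith
        hence "sgn (x - relativistic_x y) = - 1" by (rule sgn_neg)
        thus ?thesis using False by simp
      qed
    qed
  qed simp
  also have "\<dots> = 2 * (LBINT y:{..z}. cmod (f y))"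
    unfolding set_lebesgue_integral_def by (rule integral_mult_right_zero)
  finally show ?thesis .
qed

lemma set_integral_powr_tail:
  assumes f: "integrable lborel f" and \<alpha>: "\<alpha> > 0" and R: "R > 0" "R \<ge> L" and C: "C > 0"
    and dec: "AE y in lborel. y \<le> - L \<longrightarrow> cmod (f y) \<le> C / \<bar>y\<bar> powr (1 + \<alpha>)"
  shows "(LBINT y:{..- R}. cmod (f y)) \<le> C / (\<alpha> * R powr \<alpha>)"
proof -
  have [measurable]: "f \<in> borel_measurable borel" using f by (auto dest: borel_measurable_integrable)
  have hi: "((\<lambda>x. x powr (- (1 + \<alpha>))) has_integral R powr (- \<alpha>) / \<alpha>) {R..}"
    using has_integral_powr_to_inf[of "- (1 + \<alpha>)" R] \<alpha> R by simp
  have "(\<integral>\<^sup>+ x. ennreal (indicator {R..} x * x powr (- (1 + \<alpha>))) \<partial>lborel) = ennreal (R powr (- \<alpha>) / \<alpha>)"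
  proof (rule nn_integral_has_integral_lborel)
    have "(\<lambda>x. indicator {R..} x * x powr (- (1 + \<alpha>))) = (\<lambda>x. if x \<in> {R..} then x powr (- (1 + \<alpha>)) else 0)"
      by (auto simp: fun_eq_iff)
    thus "((\<lambda>x. indicator {R..} x * x powr (- (1 + \<alpha>))) has_integral R powr (- \<alpha>) / \<alpha>) UNIV"
      using hi by (simp only: has_integral_restrict_UNIV)
  qed auto
  hence hb: "has_bochner_integral lborel (\<lambda>x. indicator {R..} x * x powr (- (1 + \<alpha>))) (R powr (- \<alpha>) / \<alpha>)"
    using \<alpha> by (intro has_bochner_integral_nn_integral) auto
  hence iR: "integrable lborel (\<lambda>x. indicator {R..} x * x powr (- (1 + \<alpha>)))"
    and vR: "(LBINT x. indicator {R..} x * x powr (- (1 + \<alpha>))) = R powr (- \<alpha>) / \<alpha>"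
    by (auto simp: has_bochner_integral_iff)
  have iR': "integrable lborel (\<lambda>y. C * (indicator {R..} (- y) * (- y) powr (- (1 + \<alpha>))))"
    using lborel_integrable_real_affine[OF iR, of "-1" 0] by simp
  have "(LBINT y:{..- R}. cmod (f y)) \<le> (LBINT y. C * (indicator {R..} (- y) * (- y) powr (- (1 + \<alpha>))))"
    unfolding set_lebesgue_integral_def
  proof (rule Bochner_Integration.integral_mono_AE'[OF iR'])
    show "AE y in lborel. indicator {..- R} y *\<^sub>R cmod (f y) \<le> C * (indicator {R..} (- y) * (- y) powr (- (1 + \<alpha>)))"
      using dec
    proof eventually_elim
      fix y assume y: "y \<le> - L \<longrightarrow> cmod (f y) \<le> C / \<bar>y\<bar> powr (1 + \<alpha>)"
      show "indicator {..- R} y *\<^sub>R cmod (f y) \<le> C * (indicator {R..} (- y) * (- y) powr (- (1 + \<alpha>)))"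
      proof (cases "y \<le> - R")
        case True
        have "cmod (f y) \<le> C / (- y) powr (1 + \<alpha>)" using y True R by simp
        also have "\<dots> = C * (- y) powr (- (1 + \<alpha>))"
          unfolding powr_minus[of "- y" "1 + \<alpha>"] by (simp add: divide_inverse)
        finally show ?thesis using True by simp
      qed (use C in auto)
    qed
  qed (use C in auto)
  also have "\<dots> = C * (LBINT x. indicator {R..} x * x powr (- (1 + \<alpha>)))"
    using lborel_integral_real_affine[of "-1" "\<lambda>y. C * (indicator {R..} (- y) * (- y) powr (- (1 + \<alpha>)))" 0] by simp
  also have "\<dots> = C / (\<alpha> * R powr \<alpha>)"
    unfolding vR by (simp add: powr_minus divide_inverse mult_ac)
  finally show ?thesis .
qed

text \<open>Serves the degenerate case in which \<open>g\<close> vanishes almost everywhere on the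
  negative half-line. Since the mean zero of \<open>f\<close> removes the range x \<ge> 0, the
  stimulated part is then 0.\<close>

lemma integral_norm_sgn_transform_le:
  assumes g: "integrable lborel g" and f: "integrable lborel f" and f0: "(LBINT y. f y) = 0"
  shows "(LBINT x. cmod (g x) * cmod (sgn_transform relativistic_x f x)) \<le>
    (LBINT x:{..<0}. cmod (g x)) * (LBINT y. cmod (f y))"
proof -
  have [measurable]: "f \<in> borel_measurable borel" "g \<in> borel_measurable borel"
    using f g by (auto dest: borel_measurable_integrable)
  have i: "integrable lborel (\<lambda>x. indicator {..<0::real} x *\<^sub>R cmod (g x))"
    by (rule integrable_mult_indicator) (use g in auto)
  have "(LBINT x. cmod (g x) * cmod (sgn_transform relativistic_x f x)) \<le>
      (LBINT x. (indicator {..<0} x *\<^sub>R cmod (g x)) * (LBINT y. cmod (f y)))"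
  proof (rule Bochner_Integration.integral_mono_AE')
    show "integrable lborel (\<lambda>x. (indicator {..<0::real} x *\<^sub>R cmod (g x)) * (LBINT y. cmod (f y)))"
      using i by (rule integrable_mult_left)
    show "AE x in lborel. cmod (g x) * cmod (sgn_transform relativistic_x f x) \<le> (indicator {..<0} x *\<^sub>R cmod (g x)) * (LBINT y. cmod (f y))"
      using sgn_transform_relativistic_nonneg[of _ f] sgn_transform_bound[OF f relativistic_x_measurable] f0
      by (intro AE_I2) (auto simp: not_less split: split_indicator intro!: mult_left_mono)
  qed simp
  thus ?thesis by (simp add: set_lebesgue_integral_def)
qed

text \<open>To the left of - e^(- z) the sign transform is small by the tail of \<open>f\<close>.
  Between - e^(- z) and 0 it is only bounded, and smallness comes from the length e^(- z) of that
  interval; this is where a bound of \<open>g\<close> near 0 enters.\<close>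

lemma integral_norm_sgn_transform_split:
  assumes g: "integrable lborel g" and f: "integrable lborel f" and f0: "(LBINT y. f y) = 0"
    and near: "\<And>x. - exp (- z) < x \<Longrightarrow> x < 0 \<Longrightarrow> cmod (g x) \<le> G"
    and tail: "(LBINT y:{..z}. cmod (f y)) \<le> c"
  shows "(LBINT x. cmod (g x) * cmod (sgn_transform relativistic_x f x)) \<le>
    2 * c * (LBINT x:{..<0}. cmod (g x)) + exp (- z) * (G * (LBINT y. cmod (f y)))"
proof -
  have [measurable]: "f \<in> borel_measurable borel" "g \<in> borel_measurable borel"
    using f g by (auto dest: borel_measurable_integrable)
  define M where "M = (LBINT y. cmod (f y))"
  have M0: "M \<ge> 0" unfolding M_def by simp
  have G0: "G \<ge> 0"
    using near[of "- exp (- z) / 2"] order_trans[OF norm_ge_zero] by fastforce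
  have c0: "c \<ge> 0" by (rule order_trans[OF _ tail]) (simp add: set_lebesgue_integral_def)
  have i1: "integrable lborel (\<lambda>x. 2 * c * (indicator {..<0::real} x *\<^sub>R cmod (g x)))"
    by (intro integrable_mult_right integrable_mult_indicator) (use g in auto)
  have i2: "integrable lborel (\<lambda>x. indicator {- exp (- z)<..<0} x * (G * M))"
    by (intro integrable_mult_left integrable_real_indicator) auto
  have "(LBINT x. cmod (g x) * cmod (sgn_transform relativistic_x f x)) \<le>
      (LBINT x. 2 * c * (indicator {..<0} x *\<^sub>R cmod (g x)) + indicator {- exp (- z)<..<0} x * (G * M))"
  proof (rule Bochner_Integration.integral_mono_AE'[OF Bochner_Integration.integrable_add[OF i1 i2]])
    show "AE x in lborel. cmod (g x) * cmod (sgn_transform relativistic_x f x) \<le>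
        2 * c * (indicator {..<0} x *\<^sub>R cmod (g x)) + indicator {- exp (- z)<..<0} x * (G * M)"
    proof (rule AE_I2)
      fix x :: real
      consider "x \<ge> 0" | "x \<le> - exp (- z)" | "- exp (- z) < x" "x < 0" by linarith
      thus "cmod (g x) * cmod (sgn_transform relativistic_x f x) \<le>
        2 * c * (indicator {..<0} x *\<^sub>R cmod (g x)) + indicator {- exp (- z)<..<0} x * (G * M)"
      proof cases
        case 1
        thus ?thesis using f0 sgn_transform_relativistic_nonneg[of x f] by simp
      next
        case 2
        have x0: "x < 0" using 2 exp_gt_zero[of "- z"] by linarith
        have "cmod (sgn_transform relativistic_x f x) \<le> 2 * c"
          using sgn_transform_relativistic_bound[OF f f0 2] tail by linarith
        hence "cmod (g x) * cmod (sgn_transform relativistic_x f x) \<le> cmod (g x) * (2 * c)"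
          by (intro mult_left_mono) auto
        thus ?thesis using 2 x0 by (simp add: mult_ac)
      next
        case 3
        have "cmod (g x) * cmod (sgn_transform relativistic_x f x) \<le> G * M"
          using near[OF 3] sgn_transform_bound[OF f relativistic_x_measurable, of x] G0
          unfolding M_def by (intro mult_mono) auto
        thus ?thesis using 3 c0 by (simp add: add_increasing)
      qed
    qed
  qed (use c0 G0 M0 in auto)
  also have "\<dots> = 2 * c * (LBINT x:{..<0}. cmod (g x)) + exp (- z) * (G * M)"
    unfolding Bochner_Integration.integral_add[OF i1 i2] set_lebesgue_integral_def
    by (simp add: measure_def)
  finally show ?thesis unfolding M_def .
qed

section \<open>The estimate for large translations\<close>

lemma N_difference_eq_N_induced:
  assumes "N_spontaneous X f = N_thermal \<beta> ft"
  shows "N_difference X gt \<beta> ft f = ereal (N_induced X gt f)"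
proof (cases "N_thermal \<beta> ft = \<infinity>")
  case True
  thus ?thesis using assms by (simp add: N_difference_def N_stimulated_def)
next
  case False
  then obtain r where r: "N_thermal \<beta> ft = ennreal r" "r \<ge> 0"
    by (cases "N_thermal \<beta> ft") auto
  have i: "N_induced X gt f \<ge> 0" by (simp add: N_induced_def)
  have "N_stimulated X gt f = ennreal (r + N_induced X gt f)"
    unfolding N_stimulated_def assms r(1) using r(2) i by simp
  thus ?thesis using r i unfolding N_difference_def by (simp add: enn2ereal_ennreal del: ennreal_plus)
qed

theorem corollary1:
  fixes ft gt f g :: "real \<Rightarrow> complex" and g0 :: complex and \<alpha> C L :: real
  assumes "wave_function ft" and "normalized ft"
    and "wave_function gt" and "normalized gt"
    and "fourier_integral ft f" and "fourier_integral gt g"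
    and "(g \<longlongrightarrow> g0) (at_left 0)"
    and "\<alpha> > 0" and "C > 0" and "L \<ge> 0"
    and "AE y in lborel. y \<le> - L \<longrightarrow> cmod (f y) \<le> C / \<bar>y\<bar> powr (1 + \<alpha>)"
  shows "\<forall>\<^sub>F yo in at_top.
    \<bar>N_difference relativistic_x gt (2 * pi)
        (translate_momentum yo ft) (translate_position yo f)\<bar>
      \<le> ereal ((LBINT x:{..<0}. cmod (g x))\<^sup>2 * (4 * C\<^sup>2 / (\<alpha>\<^sup>2 * (yo / 2 + L) powr (2 * \<alpha>)))
          + exp (2 * L - yo) * (LBINT y. cmod (f y))\<^sup>2 * (cmod g0)\<^sup>2)"
proof -
  note ft = assms(1) and gt = assms(3) and F = assms(5) and Gg = assms(6) and g_lim = assms(7)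
    and \<alpha> = assms(8) and C = assms(9) and L = assms(10) and dec = assms(11)
  define M where "M = (LBINT x:{..<0}. cmod (g x))"
  define N where "N = (LBINT y. cmod (f y))"
  \<comment> \<open>Any number above the modulus of \<open>g0\<close> bounds that of
    \<open>g\<close> on some interval to the left of 0.\<close>
  define K where "K = cmod g0 + 1"
  have f: "integrable lborel f" and g: "integrable lborel g"
    using F Gg by (simp_all add: fourier_integral_def)
  have M0: "M \<ge> 0" unfolding M_def set_lebesgue_integral_def by simp
  have N0: "N \<ge> 0" unfolding N_def by simp
  have gt_meas: "gt \<in> borel_measurable borel" by (rule wave_function_integrable_exp(2)[OF gt])
  have gt_AE: "AE k in lborel. k > 0 \<longrightarrow> gt k = fourier g k / of_real (sqrt (2 * pi))"
    using fourier_integral_imp_AE_fourier[OF gt Gg] by eventually_elim (simp add: field_simps)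
  have diff: "N_difference relativistic_x gt (2 * pi) (translate_momentum s ft) (translate_position s f) =
      ereal (N_induced relativistic_x gt (translate_position s f))" for s
  proof (rule N_difference_eq_N_induced, rule N_spontaneous_eq_N_thermal)
    have u: "wave_function (translate_momentum s ft)"
    proof -
      have "(\<lambda>p. cis (- (p * s))) \<in> borel_measurable wf_measure" by (simp add: wf_measure_def)
      thus ?thesis using ft unfolding wave_function_def translate_momentum_def
        by (auto simp: norm_mult intro!: borel_measurable_times)
    qed
    have v: "fourier_integral (translate_momentum s ft) (translate_position s f)"
      by (rule fourier_integral_translate[OF F])
    show "integrable lborel (translate_position s f)" using v by (simp add: fourier_integral_def)
    show "fourier (translate_position s f) p = 0" if "p \<le> 0" for p
      by (rule fourier_integral_fourier_nonpos[OF u v that])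
    show "translate_momentum s ft \<in> borel_measurable borel" by (rule wave_function_integrable_exp(2)[OF u])
    show "AE p in lborel. p > 0 \<longrightarrow> translate_momentum s ft p = fourier (translate_position s f) p / of_real (sqrt (2 * pi))"
      using fourier_integral_imp_AE_fourier[OF u v] by eventually_elim (simp add: field_simps)
  qed
  have shift: "integrable lborel (translate_position s f)"
      "(LBINT y. translate_position s f y) = 0"
      "(LBINT y. cmod (translate_position s f y)) = N"
      "(LBINT y:{..z}. cmod (translate_position s f y)) = (LBINT y:{..z - s}. cmod (f y))" for s z
  proof -
    show "integrable lborel (translate_position s f)"
      using fourier_integral_translate[OF F, of s] by (simp add: fourier_integral_def)
    have "(LBINT y. f y) = 0"
      using fourier_integral_fourier_nonpos[OF ft F, of 0] by (simp add: fourier_def)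
    thus "(LBINT y. translate_position s f y) = 0"
      using lborel_integral_real_affine[of 1 f "- s"] by (simp add: translate_position_def)
    show "(LBINT y. cmod (translate_position s f y)) = N"
      using lborel_integral_real_affine[of 1 "\<lambda>y. cmod (f y)" "- s"] by (simp add: translate_position_def N_def)
    have "indicator {..z - s} (y - s) = (indicator {..z} y :: real)" for y by (auto split: split_indicator)
    thus "(LBINT y:{..z}. cmod (translate_position s f y)) = (LBINT y:{..z - s}. cmod (f y))"
      using lborel_integral_real_affine[of 1 "\<lambda>y. indicator {..z - s} y *\<^sub>R cmod (f y)" "- s"]
      by (simp add: translate_position_def set_lebesgue_integral_def)
  qed
  have ind: "N_induced relativistic_x gt (translate_position s f) \<le>
      (LBINT x. cmod (g x) * cmod (sgn_transform relativistic_x (translate_position s f) x))\<^sup>2 / 8" for s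
    by (rule N_induced_le[OF g shift(1) relativistic_x_measurable _ gt_meas gt_AE])
      (rule fourier_integral_fourier_nonpos[OF gt Gg])
  have ind0: "N_induced relativistic_x gt h \<ge> 0" for h by (simp add: N_induced_def)
  have I0: "0 \<le> (LBINT x. cmod (g x) * cmod (sgn_transform relativistic_x h x))" for h by simp
  define bnd where "bnd s = M\<^sup>2 * (4 * C\<^sup>2 / (\<alpha>\<^sup>2 * (s / 2 + L) powr (2 * \<alpha>))) + exp (2 * L - s) * N\<^sup>2 * (cmod g0)\<^sup>2" for s
  have "\<forall>\<^sub>F s in at_top. N_induced relativistic_x gt (translate_position s f) \<le> bnd s"
  \<comment> \<open>The main case works with a gap proportional to M^2. For M = 0 the gap closes,
    but then the stimulated part itself is 0.\<close>
  proof (cases "M = 0")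
    case True
    have "N_induced relativistic_x gt (translate_position s f) \<le> bnd s" for s
    proof -
      have "(LBINT x. cmod (g x) * cmod (sgn_transform relativistic_x (translate_position s f) x)) = 0"
        using integral_norm_sgn_transform_le[OF g shift(1,2), of s] True I0[of "translate_position s f"]
        unfolding M_def[symmetric] by simp
      hence "N_induced relativistic_x gt (translate_position s f) \<le> 0" using ind[of s] by simp
      also have "0 \<le> bnd s" by (simp add: bnd_def)
      finally show ?thesis .
    qed
    thus ?thesis by simp
  next
    case False
    hence M: "M > 0" using M0 by simp
    have "\<forall>\<^sub>F x in at_left 0. cmod (g x) < K"
      using order_tendstoD(2)[OF tendsto_norm[OF g_lim], of K] by (simp add: K_def)
    then obtain d where d: "d < 0" "\<And>x. d < x \<Longrightarrow> x < 0 \<Longrightarrow> cmod (g x) < K"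
      unfolding eventually_at_left[of "-1::real" 0, simplified] by blast
    \<comment> \<open>With a = M C / (\<alpha> R^\<alpha>) the power term of the claim is 4 a^2, the
      estimate below produces a^2 + b^2 / 4, and 3 a^2 = c / R^(2 \<alpha>) is left to absorb b^2 /
      4.\<close>
    define c where "c = 3 * (M\<^sup>2 * C\<^sup>2 / \<alpha>\<^sup>2)"
    have c: "c > 0" using M C \<alpha> by (simp add: c_def)
    have e1: "\<forall>\<^sub>F s in at_top. (K * N)\<^sup>2 / 4 * (exp (2 * L - s) * (s / 2 + L) powr (2 * \<alpha>)) < c"
    proof -
      have "((\<lambda>s. exp (2 * L - s) * (s / 2 + L) powr (2 * \<alpha>)) \<longlongrightarrow> 0) at_top"
        using \<alpha> L by real_asymp
      hence "((\<lambda>s. (K * N)\<^sup>2 / 4 * (exp (2 * L - s) * (s / 2 + L) powr (2 * \<alpha>))) \<longlongrightarrow> 0) at_top"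
        by (rule tendsto_mult_right_zero)
      thus ?thesis using c by (rule order_tendstoD(2))
    qed
    have "((\<lambda>s. - exp (- (s / 2 - L))) \<longlongrightarrow> 0) at_top" by real_asymp
    hence e2: "\<forall>\<^sub>F s in at_top. - exp (- (s / 2 - L)) > d" using d(1) by (rule order_tendstoD(1))
    show ?thesis using e1 e2 eventually_gt_at_top[of 0]
    proof eventually_elim
      fix s :: real
      assume s: "(K * N)\<^sup>2 / 4 * (exp (2 * L - s) * (s / 2 + L) powr (2 * \<alpha>)) < c"
        "d < - exp (- (s / 2 - L))" "0 < s"
      \<comment> \<open>The split is made at z = s/2 - L. For the untranslated \<open>f\<close> this
        is the point z - s = - R, which lies below - L, so that the decay of \<open>f\<close>
        applies.\<close>
      define R where "R = s / 2 + L"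
      have R: "R > 0" "R \<ge> L" using s L by (auto simp: R_def)
      define a where "a = M * (C / (\<alpha> * R powr \<alpha>))"
      define b where "b = exp (- (s / 2 - L)) * (K * N)"
      have "(LBINT y:{..s / 2 - L}. cmod (translate_position s f y)) = (LBINT y:{..- R}. cmod (f y))"
        unfolding shift(4) by (simp add: R_def algebra_simps)
      also have "\<dots> \<le> C / (\<alpha> * R powr \<alpha>)"
        by (rule set_integral_powr_tail[OF f \<alpha> R C dec])
      finally have "(LBINT x. cmod (g x) * cmod (sgn_transform relativistic_x (translate_position s f) x)) \<le>
          2 * (C / (\<alpha> * R powr \<alpha>)) * M + exp (- (s / 2 - L)) * (K * (LBINT y. cmod (translate_position s f y)))"
        unfolding M_def
        by (rule integral_norm_sgn_transform_split[OF g shift(1,2), rotated])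
          (use d(2) s(2) in \<open>auto intro!: less_imp_le\<close>)
      hence "(LBINT x. cmod (g x) * cmod (sgn_transform relativistic_x (translate_position s f) x)) \<le> 2 * a + b"
        unfolding shift(3) by (simp add: a_def b_def mult_ac)
      hence "(LBINT x. cmod (g x) * cmod (sgn_transform relativistic_x (translate_position s f) x))\<^sup>2 \<le> (2 * a + b)\<^sup>2"
        using I0 by (rule power_mono)
      hence "N_induced relativistic_x gt (translate_position s f) \<le> (2 * a + b)\<^sup>2 / 8"
        using ind[of s] by linarith
      also have "\<dots> \<le> a\<^sup>2 + b\<^sup>2 / 4"
      proof -
        \<comment> \<open>Amounts to (2 a + b)^2 \<le> 8 a^2 + 2 b^2; the factor 8 cancels the
          denominator from the two pairings.\<close>
        have "0 \<le> (2 * a - b)\<^sup>2" by simp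
        thus ?thesis by (simp add: power2_eq_square algebra_simps)
      qed
      also have "b\<^sup>2 / 4 \<le> 3 * a\<^sup>2"
      proof -
        have pw: "R powr (2 * \<alpha>) > 0" using R by simp
        have ex: "(exp (- (s / 2 - L)))\<^sup>2 = exp (2 * L - s)" by (simp add: exp_double[symmetric] algebra_simps)
        have b2: "b\<^sup>2 / 4 = (K * N)\<^sup>2 / 4 * exp (2 * L - s)" unfolding b_def power_mult_distrib ex by simp
        have "(R powr \<alpha>)\<^sup>2 = R powr (2 * \<alpha>)" by (simp add: power2_eq_square powr_add[symmetric])
        hence a2: "3 * a\<^sup>2 = c / R powr (2 * \<alpha>)"
          by (simp add: a_def c_def power_mult_distrib power_divide)
        have "b\<^sup>2 / 4 * R powr (2 * \<alpha>) \<le> c" unfolding b2 using s(1) by (simp add: R_def mult_ac)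
        thus ?thesis unfolding a2 using pw by (simp add: field_simps)
      qed
      also have "a\<^sup>2 + 3 * a\<^sup>2 = M\<^sup>2 * (4 * C\<^sup>2 / (\<alpha>\<^sup>2 * (s / 2 + L) powr (2 * \<alpha>)))"
      proof -
        have "(R powr \<alpha>)\<^sup>2 = R powr (2 * \<alpha>)" by (simp add: power2_eq_square powr_add[symmetric])
        thus ?thesis by (simp add: a_def power_mult_distrib power_divide R_def[symmetric])
      qed
      also have "\<dots> \<le> bnd s" by (simp add: bnd_def)
      finally show "N_induced relativistic_x gt (translate_position s f) \<le> bnd s" by simp
    qed
  qed
  thus ?thesis
    unfolding diff M_def[symmetric] N_def[symmetric] by eventually_elim (simp add: bnd_def ind0)
qed

end
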